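(* For any $k \geq 0$, \textsc{1-Edge Contraction($\gamma_{t2}$)} is polynomial-time solvable on $(P_3+kP_2)$-free graphs.
   Context: All graphs are finite, simple and connected. A semitotal dominating set of $G$ is a set $D\subseteq V(G)$ such that every vertex outside $D$ has a neighbour in $D$ and every vertex of $D$ is at distance at most two from another vertex of $D$; $\gamma_{t2}(G)$ is its minimum size. $ct_{\gamma_{t2}}(G)$ is the smallest $k$ such that contracting some $k$ edges of $G$ (contracting $uv$ replaces $u,v$ by one vertex adjacent to all neighbours of $u$ or $v$) yields $G'$ with $\gamma_{t2}(G')<\gamma_{t2}(G)$. \textsc{1-Edge Contraction($\gamma_{t2}$)}: given $G$, decide whether $ct_{\gamma_{t2}}(G)\leq 1$. $P_3+kP_2$ is the disjoint union of a path on three vertices and $k$ copies of a single edge. *)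

theory Defs
  imports Main
begin

type_synonym graph = "nat set \<times> nat set set"

definition verts :: "graph \<Rightarrow> nat set" where "verts G = fst G"
definition edges :: "graph \<Rightarrow> nat set set" where "edges G = snd G"

definition simple_graph :: "graph \<Rightarrow> bool" where
  "simple_graph G \<longleftrightarrow> finite (verts G) \<and>
     (\<forall>e\<in>edges G. \<exists>u v. u \<noteq> v \<and> e = {u, v} \<and> u \<in> verts G \<and> v \<in> verts G)"

definition adj :: "graph \<Rightarrow> nat \<Rightarrow> nat \<Rightarrow> bool" where
  "adj G u v \<longleftrightarrow> u \<noteq> v \<and> {u, v} \<in> edges G"

definition connected_graph :: "graph \<Rightarrow> bool" where
  "connected_graph G \<longleftrightarrow> verts G \<noteq> {} \<and>
     (\<forall>u\<in>verts G. \<forall>v\<in>verts G. (adj G)\<^sup>*\<^sup>* u v)"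

definition within2 :: "graph \<Rightarrow> nat \<Rightarrow> nat \<Rightarrow> bool" where
  "within2 G u v \<longleftrightarrow> u \<noteq> v \<and> (adj G u v \<or> (\<exists>w. adj G u w \<and> adj G w v))"

definition semitotal_dom :: "graph \<Rightarrow> nat set \<Rightarrow> bool" where
  "semitotal_dom G D \<longleftrightarrow> D \<subseteq> verts G \<and>
     (\<forall>x\<in>verts G - D. \<exists>y\<in>D. adj G x y) \<and>
     (\<forall>x\<in>D. \<exists>y\<in>D. y \<noteq> x \<and> within2 G x y)"

definition gamma_t2 :: "graph \<Rightarrow> nat" where
  "gamma_t2 G = (LEAST n. \<exists>D. semitotal_dom G D \<and> card D = n)"

definition contract :: "graph \<Rightarrow> nat \<Rightarrow> nat \<Rightarrow> graph" where
  "contract G u v =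
     (verts G - {v},
      {e \<in> edges G. v \<notin> e} \<union> {{u, w} | w. {v, w} \<in> edges G \<and> w \<noteq> u \<and> w \<noteq> v})"

text \<open>ct_gamma_t2(G) \<le> 1.  (Contracting zero edges never decreases gamma_t2,
  so this holds iff a single contraction decreases gamma_t2.)\<close>
definition one_edge_contraction :: "graph \<Rightarrow> bool" where
  "one_edge_contraction G \<longleftrightarrow>
     (\<exists>u v. adj G u v \<and> gamma_t2 (contract G u v) < gamma_t2 G \<and>
            (\<exists>D. semitotal_dom (contract G u v) D))"

definition P3_kP2_adj :: "nat \<Rightarrow> nat \<Rightarrow> nat \<Rightarrow> bool" where
  "P3_kP2_adj k i j \<longleftrightarrow> {i, j} = {0, 1} \<or> {i, j} = {1, 2} \<or>
     (\<exists>t<k. {i, j} = {3 + 2 * t, 4 + 2 * t})"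

definition P3_kP2_free :: "nat \<Rightarrow> graph \<Rightarrow> bool" where
  "P3_kP2_free k G \<longleftrightarrow>
     \<not> (\<exists>f. inj_on f {0..<2 * k + 3} \<and> f ` {0..<2 * k + 3} \<subseteq> verts G \<and>
            (\<forall>i<2 * k + 3. \<forall>j<2 * k + 3. i \<noteq> j \<longrightarrow>
                (adj G (f i) (f j) \<longleftrightarrow> P3_kP2_adj k i j)))"

text \<open>States are naturals < Q (0 = start, 1 = accept, 2 = reject), tape symbols are
  naturals < S (0 = blank, 1 = input bit False, 2 = input bit True).
  The transition function gives (new state, written symbol, head move in {-1,0,1}).\<close>
type_synonym tm = "nat \<Rightarrow> nat \<Rightarrow> nat \<times> nat \<times> int"
type_synonym config = "nat \<times> (int \<Rightarrow> nat) \<times> int"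

definition valid_tm :: "nat \<Rightarrow> nat \<Rightarrow> tm \<Rightarrow> bool" where
  "valid_tm Q S \<delta> \<longleftrightarrow> 3 \<le> Q \<and> 3 \<le> S \<and>
     (\<forall>q<Q. \<forall>s<S. case \<delta> q s of (q', s', d) \<Rightarrow> q' < Q \<and> s' < S \<and> d \<in> {-1, 0, 1})"

definition tm_step :: "tm \<Rightarrow> config \<Rightarrow> config" where
  "tm_step \<delta> c = (case c of (q, tp, h) \<Rightarrow>
     if q = 1 \<or> q = 2 then (q, tp, h)
     else (case \<delta> q (tp h) of (q', s, d) \<Rightarrow> (q', tp(h := s), h + d)))"

definition init_config :: "bool list \<Rightarrow> config" where
  "init_config w = (0, (\<lambda>i. if 0 \<le> i \<and> i < int (length w)
                            then (if w ! nat i then 2 else 1) else 0), 0)"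

definition tm_decides_within :: "tm \<Rightarrow> bool list \<Rightarrow> nat \<Rightarrow> bool \<Rightarrow> bool" where
  "tm_decides_within \<delta> w T b \<longleftrightarrow>
     fst ((tm_step \<delta> ^^ T) (init_config w)) = (if b then 1 else 2)"

definition encode_graph :: "nat \<Rightarrow> graph \<Rightarrow> bool list" where
  "encode_graph n G = map (\<lambda>p. adj G (p div n) (p mod n)) [0..<n * n]"

end

theory Submission
  imports Defs "HOL-Library.Nat_Bijection" "HOL-Library.Countable"
begin

text \<open>Contracting some edge decreases the semitotal domination number iff a minimum semitotal dominating set
  (STD set) contains a triple: adjacent vertices \<open>a\<close>, \<open>b\<close> and a third vertex within distance two of \<open>b\<close>.
  Suppose that \<open>G\<close> has no such triple and that the minimum is large.  Exchange arguments then
  produce a minimum STD set and an induced matching \<open>L\<close> of fixed size such that no vertex touching almost all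
  edges of \<open>L\<close> belongs to that set.
  Given any large induced matching \<open>L\<close>, every vertex either touches all but fewer than \<open>k\<close> edges
  of \<open>L\<close>, or belongs to the set \<open>W\<close> of the remaining vertices, and \<open>W\<close> induces a disjoint union of cliques.
  There is no triple iff \<open>L\<close> can be chosen such that no nonempty set \<open>R\<close> of vertices outside \<open>W\<close> dominates at least
  as many of these cliques as it has elements: then the minimum STD sets are exactly the STD transversals of the cliques, and these
  are independent.  Moreover it suffices to test sets \<open>R\<close> of bounded size.

  Hence for fixed \<open>k\<close> the yes-instances are described by one first-order sentence over the
  adjacency relation.  Such a sentence is evaluated by nested loops over the vertices, which a counter program
  does in polynomial time, and a single-tape machine simulates counters by marks on its tape.\<close>

section \<open>Semitotal domination and induced matchings\<close>

text \<open>For k \<ge> 1 the semitotal domination number is unbounded on this class (take a star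
  with every edge subdivided), so a negative answer needs a certificate of fixed size even where
  minimum STD sets are large. \<open>L\<close> is such a certificate because of a count: an STD set
  contains a separate vertex for each clique of \<open>W\<close> that it does not dominate from
  outside \<open>W\<close>. A set \<open>R\<close> as in the overview is a trade that costs nothing:
  it replaces the transversal vertices of cliques it dominates, and each vertex of \<open>R\<close>,
  seeing two remaining transversal vertices, is the middle of a triple. If there is no triple, this
  trade argument needs an \<open>L\<close> with no more cliques than the minimum; that is why the
  exchanges must produce \<open>L\<close> together with a minimum STD set avoiding all vertices that
  touch nearly all of \<open>L\<close>. The constant \<open>9*k+10\<close> covers the cliques an
  exchange may spoil: \<open>5*k+2\<close> given up to \<open>R\<close>, fewer than \<open>k\<close>
  missed twice by each of two vertices, \<open>2*k+2\<close> dominated by a pair, with two to spare.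
  \<open>5*k+2\<close> exceeds the number of cliques any \<open>R\<close> can dominate once all
  tests succeed.\<close>

locale fin_graph =
  fixes V :: "'a set" and nb :: "'a \<Rightarrow> 'a \<Rightarrow> bool" (infix "\<sim>" 50)
  assumes finV: "finite V" and nb_sym: "x \<sim> y \<Longrightarrow> y \<sim> x" and nb_irrefl: "\<not> x \<sim> x"
    and nb_V: "x \<sim> y \<Longrightarrow> x \<in> V"
begin

definition tch :: "'a \<Rightarrow> 'a \<Rightarrow> bool" (infix "\<simeq>" 50) where "x \<simeq> y \<longleftrightarrow> x = y \<or> x \<sim> y"

definition near :: "'a \<Rightarrow> 'a \<Rightarrow> bool" where
  "near x y \<longleftrightarrow> x \<noteq> y \<and> (x \<sim> y \<or> (\<exists>w. x \<sim> w \<and> w \<sim> y))"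

definition STD :: "'a set \<Rightarrow> bool" where
  "STD D \<longleftrightarrow> D \<subseteq> V \<and> (\<forall>x\<in>V. \<exists>y\<in>D. x \<simeq> y) \<and> (\<forall>x\<in>D. \<exists>y\<in>D. near x y)"

definition triple :: "'a set \<Rightarrow> bool" where
  "triple D \<longleftrightarrow> (\<exists>a\<in>D. \<exists>b\<in>D. \<exists>c\<in>D. a \<sim> b \<and> near b c \<and> c \<noteq> a)"

definition touch :: "'a \<Rightarrow> 'a \<times> 'a \<Rightarrow> bool" where
  "touch f p \<longleftrightarrow> f \<simeq> fst p \<or> f \<simeq> snd p"

text \<open>Edges are ordered pairs, but an edge and its reversal touch each other and cannot both
  belong to \<open>L\<close>; so \<open>card L\<close> counts edges.\<close>

definition imatch :: "('a \<times> 'a) set \<Rightarrow> bool" where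
  "imatch L \<longleftrightarrow> (\<forall>p\<in>L. fst p \<sim> snd p) \<and>
     (\<forall>p\<in>L. \<forall>q\<in>L. p \<noteq> q \<longrightarrow> \<not> touch (fst p) q \<and> \<not> touch (snd p) q)"

definition P3 :: "'a \<Rightarrow> 'a \<Rightarrow> 'a \<Rightarrow> bool" where
  "P3 x y z \<longleftrightarrow> x \<sim> y \<and> y \<sim> z \<and> \<not> x \<simeq> z"

definition indep :: "'a set \<Rightarrow> bool" where "indep Q \<longleftrightarrow> (\<forall>x\<in>Q. \<forall>y\<in>Q. \<not> x \<sim> y)"

definition dom :: "'a set \<Rightarrow> 'a set \<Rightarrow> bool" where "dom T U \<longleftrightarrow> (\<forall>u\<in>U. \<exists>t\<in>T. u \<simeq> t)"

text \<open>A counting form of forbidding P3 + kP2, convenient for contradictions by size. For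
  \<open>k = 0\<close> it excludes every induced P3.\<close>

definition free :: "nat \<Rightarrow> bool" where
  "free k \<longleftrightarrow> (\<forall>L x y z. finite L \<and> imatch L \<and> P3 x y z \<and>
     (\<forall>p\<in>L. \<not> touch x p \<and> \<not> touch y p \<and> \<not> touch z p) \<longrightarrow> card L < k)"

lemma tch_sym: "x \<simeq> y \<Longrightarrow> y \<simeq> x" using nb_sym by (auto simp: tch_def)
lemma tch_refl [simp]: "x \<simeq> x" by (simp add: tch_def)
lemma nb_tch: "x \<sim> y \<Longrightarrow> x \<simeq> y" by (simp add: tch_def)
lemma nb_V2: "x \<sim> y \<Longrightarrow> y \<in> V" using nb_V nb_sym by blast
lemma nb_neq: "x \<sim> y \<Longrightarrow> x \<noteq> y" using nb_irrefl by blast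
lemma nb_comm: "x \<sim> y \<longleftrightarrow> y \<sim> x" using nb_sym by blast
lemma tch_comm: "x \<simeq> y \<longleftrightarrow> y \<simeq> x" using tch_sym by blast
lemma indepD: "indep Q \<Longrightarrow> x \<in> Q \<Longrightarrow> y \<in> Q \<Longrightarrow> \<not> x \<sim> y" by (simp add: indep_def)
lemma indepD2: "indep Q \<Longrightarrow> x \<in> Q \<Longrightarrow> y \<in> Q \<Longrightarrow> x \<noteq> y \<Longrightarrow> \<not> x \<simeq> y" by (simp add: indep_def tch_def)
lemma near_sym: "near x y \<Longrightarrow> near y x" unfolding near_def using nb_sym by blast
lemma nearI1: "x \<sim> y \<Longrightarrow> near x y" unfolding near_def using nb_irrefl by blast
lemma nearI2: "x \<sim> w \<Longrightarrow> w \<sim> y \<Longrightarrow> x \<noteq> y \<Longrightarrow> near x y" unfolding near_def by blast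
lemma near_neq: "near x y \<Longrightarrow> x \<noteq> y" by (simp add: near_def)
lemma near_tch: "x \<sim> w \<Longrightarrow> w \<simeq> y \<Longrightarrow> x \<noteq> y \<Longrightarrow> near x y" unfolding near_def tch_def by blast

lemma tripleI: "a \<in> D \<Longrightarrow> b \<in> D \<Longrightarrow> c \<in> D \<Longrightarrow> a \<sim> b \<Longrightarrow> near b c \<Longrightarrow> c \<noteq> a \<Longrightarrow> triple D"
  unfolding triple_def by blast

lemma freeD: "free k \<Longrightarrow> finite L \<Longrightarrow> imatch L \<Longrightarrow> P3 x y z \<Longrightarrow>
   (\<And>p. p \<in> L \<Longrightarrow> \<not> touch x p \<and> \<not> touch y p \<and> \<not> touch z p) \<Longrightarrow> card L < k"
  unfolding free_def by blast

lemma STD_V: "STD D \<Longrightarrow> D \<subseteq> V" by (simp add: STD_def)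
lemma STD_fin: "STD D \<Longrightarrow> finite D" using STD_V finV finite_subset by blast

lemma imatch_subset: "imatch L \<Longrightarrow> L' \<subseteq> L \<Longrightarrow> imatch L'"
  unfolding imatch_def by blast

text \<open>The fourth combination, \<open>h s\<close> against \<open>g s'\<close>, follows from the
  third by exchanging the indices; the second condition makes the indexing injective.\<close>

lemma imatchI:
  assumes "\<And>s. s \<in> S \<Longrightarrow> g s \<sim> h s"
    and "\<And>s s'. s \<in> S \<Longrightarrow> s' \<in> S \<Longrightarrow> s \<noteq> s' \<Longrightarrow> \<not> g s \<simeq> g s'"
    and "\<And>s s'. s \<in> S \<Longrightarrow> s' \<in> S \<Longrightarrow> s \<noteq> s' \<Longrightarrow> \<not> g s \<simeq> h s'"
    and "\<And>s s'. s \<in> S \<Longrightarrow> s' \<in> S \<Longrightarrow> s \<noteq> s' \<Longrightarrow> \<not> h s \<simeq> h s'"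
  shows "imatch ((\<lambda>s. (g s, h s)) ` S) \<and> card ((\<lambda>s. (g s, h s)) ` S) = card S"
proof
  show "imatch ((\<lambda>s. (g s, h s)) ` S)"
    unfolding imatch_def
  proof (intro conjI ballI impI)
    fix p assume "p \<in> (\<lambda>s. (g s, h s)) ` S"
    then show "fst p \<sim> snd p" using assms(1) by auto
  next
    fix p q assume pq: "p \<in> (\<lambda>s. (g s, h s)) ` S" "q \<in> (\<lambda>s. (g s, h s)) ` S" "p \<noteq> q"
    then obtain s t where st: "p = (g s, h s)" "q = (g t, h t)" "s \<in> S" "t \<in> S" by blast
    then have "s \<noteq> t" using pq(3) by auto
    note a = assms(2-4)[OF st(3,4) this] assms(3)[OF st(4,3) this[symmetric]]
    show "\<not> touch (fst p) q" "\<not> touch (snd p) q"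
      using a tch_comm[of "h s" "g t"] unfolding st touch_def by auto
  qed
  have i: "inj_on (\<lambda>s. (g s, h s)) S"
    unfolding inj_on_def using assms(2) tch_refl by (metis (no_types, lifting) prod.inject)
  show "card ((\<lambda>s. (g s, h s)) ` S) = card S" using i by (rule card_image)
qed

section \<open>Small dominating sets from small covers\<close>

lemma max_indep: "finite U \<Longrightarrow> \<exists>Q\<subseteq>U. indep Q \<and> dom Q U"
proof (induction rule: finite_induct)
  case empty then show ?case by (auto simp: indep_def dom_def)
next
  case (insert u U)
  then obtain Q where Q: "Q \<subseteq> U" "indep Q" "dom Q U" by blast
  show ?case
  proof (cases "\<exists>q\<in>Q. u \<simeq> q")
    case True then show ?thesis using Q by (auto simp: dom_def)
  next
    case False
    then have "indep (insert u Q)" using Q(2) nb_sym nb_irrefl by (auto simp: indep_def tch_def)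
    moreover have "dom (insert u Q) (insert u U)" using Q(3) by (auto simp: dom_def)
    ultimately show ?thesis using Q(1) by blast
  qed
qed

text \<open>\<open>A\<close> is the vertex set of a maximal induced \<open>P3 + jP2\<close> in \<open>U\<close>.\<close>

lemma core:
  assumes fr: "free k" and U: "U \<subseteq> V" and xyz: "P3 x y z" "x \<in> U" "y \<in> U" "z \<in> U"
  shows "\<exists>A. A \<subseteq> U \<and> card A \<le> 2*k+1 \<and> (\<exists>x\<in>A. \<exists>y\<in>A. \<exists>z\<in>A. P3 x y z) \<and>
    (\<forall>a\<in>A. \<exists>b\<in>A. a \<sim> b) \<and>
    (\<forall>u\<in>U. \<forall>w\<in>U. u \<sim> w \<longrightarrow> (\<exists>a\<in>A. u \<simeq> a \<or> w \<simeq> a))"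
proof -
  define PP where "PP L \<longleftrightarrow> L \<subseteq> U \<times> U \<and> imatch L \<and> (\<forall>p\<in>L. \<not> touch x p \<and> \<not> touch y p \<and> \<not> touch z p)" for L
  have finU: "finite U" using U finV finite_subset by blast
  have fL: "finite L" if "PP L" for L using that finU unfolding PP_def by (meson finite_SigmaI finite_subset)
  have lt: "card L < k" if "PP L" for L
    using freeD[OF fr fL[OF that] _ xyz(1)] that unfolding PP_def by blast
  have "PP {}" by (simp add: PP_def imatch_def)
  then obtain L where L: "PP L" and mx: "\<And>L'. PP L' \<Longrightarrow> card L' \<le> card L"
    using ex_has_greatest_nat[of PP "{}" card k] lt by (metis less_imp_le)
  define A where "A = {x,y,z} \<union> fst ` L \<union> snd ` L"
  have k: "card L < k" by (rule lt[OF L])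
  have "card A \<le> card {x,y,z} + card (fst ` L) + card (snd ` L)"
    unfolding A_def by (meson add_le_mono1 card_Un_le le_trans)
  also have "\<dots> \<le> 3 + card L + card L"
    by (intro add_mono card_image_le fL[OF L]) (simp add: card_insert_if)
  \<comment> \<open>Freeness leaves at most \<open>k - 1\<close> edges beside the path, hence at
    most 3 + 2(k - 1) vertices.\<close>
  also have "\<dots> \<le> 2*k+1" using k by simp
  finally have c: "card A \<le> 2*k+1" .
  have sub: "A \<subseteq> U" using L xyz unfolding A_def PP_def by auto
  have nbA: "\<exists>b\<in>A. a \<sim> b" if "a \<in> A" for a
  proof -
    have 1: "x \<sim> y" "z \<sim> y" "y \<sim> x" using xyz(1) nb_sym unfolding P3_def by auto
    have 2: "fst p \<sim> snd p" "snd p \<sim> fst p" if "p \<in> L" for p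
      using L that nb_sym unfolding PP_def imatch_def by auto
    show ?thesis using that 1 2 unfolding A_def by blast
  qed
  \<comment> \<open>An edge apart from \<open>A\<close> could be added to \<open>L\<close>, against
    its maximality.\<close>
  have ind: "\<exists>a\<in>A. u \<simeq> a \<or> w \<simeq> a" if uw: "u \<in> U" "w \<in> U" "u \<sim> w" for u w
  proof (rule ccontr)
    assume n: "\<not> ?thesis"
    have nu: "\<not> u \<simeq> a" "\<not> w \<simeq> a" "\<not> a \<simeq> u" "\<not> a \<simeq> w" if "a \<in> A" for a using n that tch_sym by blast+
    have inA: "fst p \<in> A" "snd p \<in> A" if "p \<in> L" for p using that unfolding A_def by auto
    have new: "(u,w) \<notin> L" using inA nu(1) tch_refl by fastforce
    have "imatch (insert (u,w) L)"
      using L uw(3) inA nu unfolding PP_def imatch_def touch_def by auto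
    then have "PP (insert (u,w) L)"
      using L uw nu unfolding PP_def touch_def A_def by auto
    from mx[OF this] show False using fL[OF L] new by simp
  qed
  have "\<exists>x\<in>A. \<exists>y\<in>A. \<exists>z\<in>A. P3 x y z"
    by (rule bexI[of _ x], rule bexI[of _ y], rule bexI[of _ z], rule xyz(1)) (simp_all add: A_def)
  then show ?thesis using sub c nbA ind by (intro exI[of _ A] conjI ballI impI)
qed

text \<open>If \<open>U\<close> contains an induced \<open>P3\<close>, the core dominates all of \<open>U\<close> but an independent set.
  Otherwise \<open>U\<close> is a union of cliques; after covering two transversals, a vertex \<open>s\<close> covering many cliques that still contain
  an undominated vertex would yield \<open>P3\<close> (through \<open>s\<close>, in one clique) plus \<open>k\<close> edges in the others.\<close>

lemma small_dom_or_big_cover: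
  assumes fr: "free k" and U: "U \<subseteq> V" and X: "X \<subseteq> V"
    and cov: "\<And>Q. Q \<subseteq> U \<Longrightarrow> indep Q \<Longrightarrow> \<exists>S\<subseteq>X. card S \<le> m \<and> (\<forall>q\<in>Q. \<exists>s\<in>S. q \<sim> s)"
  shows "\<exists>T\<subseteq>U \<union> X. card T \<le> (k+2)*m + 2*k+1 \<and> dom T U"
proof (cases "\<exists>x\<in>U. \<exists>y\<in>U. \<exists>z\<in>U. P3 x y z")
  case True
  then obtain x y z where p: "P3 x y z" "x \<in> U" "y \<in> U" "z \<in> U" by blast
  from core[OF fr U p] obtain A where A: "A \<subseteq> U" "card A \<le> 2*k+1"
    "\<forall>u\<in>U. \<forall>w\<in>U. u \<sim> w \<longrightarrow> (\<exists>a\<in>A. u \<simeq> a \<or> w \<simeq> a)" by (elim exE conjE)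
  define Q where "Q = {u\<in>U. \<forall>a\<in>A. \<not> u \<simeq> a}"
  have "indep Q" unfolding indep_def Q_def using A(3) by blast
  moreover have "Q \<subseteq> U" unfolding Q_def by blast
  ultimately obtain S where S: "S \<subseteq> X" "card S \<le> m" "\<forall>q\<in>Q. \<exists>s\<in>S. q \<sim> s"
    using cov[of Q] by blast
  have "dom (A \<union> S) U" unfolding dom_def
  proof
    fix u assume "u \<in> U"
    show "\<exists>t\<in>A \<union> S. u \<simeq> t"
    proof (cases "u \<in> Q")
      case True then show ?thesis using S(3) nb_tch by blast
    next
      case False then show ?thesis using \<open>u \<in> U\<close> unfolding Q_def by blast
    qed
  qed
  moreover have "card (A \<union> S) \<le> (k+2)*m + 2*k+1"
    using card_Un_le[of A S] A(2) S(2) by (simp add: algebra_simps)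
  ultimately show ?thesis using A(1) S(1) by (intro exI[of _ "A \<union> S"]) auto
next
  case False
  have tr: "a \<simeq> c" if "a \<simeq> b" "b \<simeq> c" "a \<in> U" "b \<in> U" "c \<in> U" for a b c
  proof (rule ccontr)
    assume n: "\<not> a \<simeq> c"
    then have "a \<noteq> b" "b \<noteq> c" using that by auto
    then have "P3 a b c" using n that unfolding P3_def by (simp add: tch_def)
    then show False using False that by blast
  qed
  have finU: "finite U" using U finV finite_subset by blast
  obtain Q0 where Q0: "Q0 \<subseteq> U" "indep Q0" "dom Q0 U" using max_indep[OF finU] by blast
  obtain S0 where S0: "S0 \<subseteq> X" "card S0 \<le> m" "\<forall>q\<in>Q0. \<exists>s\<in>S0. q \<sim> s" using cov[OF Q0(1,2)] by blast
  define B0 where "B0 = {u\<in>U. \<forall>s\<in>S0. \<not> u \<simeq> s}"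
  have fB0: "finite B0" "B0 \<subseteq> U" unfolding B0_def using finU by auto
  obtain Q1 where Q1: "Q1 \<subseteq> B0" "indep Q1" "dom Q1 B0" using max_indep[OF fB0(1)] by blast
  obtain S1 where S1: "S1 \<subseteq> X" "card S1 \<le> m" "\<forall>q\<in>Q1. \<exists>s\<in>S1. q \<sim> s"
    using cov[of Q1] Q1 fB0 by blast
  define B1 where "B1 = {u\<in>B0. \<forall>s\<in>S1. \<not> u \<simeq> s}"
  have fB1: "finite B1" "B1 \<subseteq> B0" unfolding B1_def using fB0 by auto
  obtain Q2 where Q2: "Q2 \<subseteq> B1" "indep Q2" "dom Q2 B1" using max_indep[OF fB1(1)] by blast
  have finS0: "finite S0" using S0(1) X finV finite_subset by (meson finite_subset)
  \<comment> \<open>The two rounds of covering leave three different vertices in the clique of each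
    undominated \<open>p\<close>: \<open>q0\<close> adjacent to \<open>S0\<close>, \<open>q1\<close>
    not touched by \<open>S0\<close>, and \<open>p\<close> touched by neither \<open>S0\<close> nor
    \<open>S1\<close>. The path will be \<open>s\<close>, \<open>q0\<close>, \<open>q1\<close> for
    one clique, the matching will consist of the edges \<open>q1 p\<close> of the others.\<close>
  have ex: "\<exists>q1 q0 s. q1 \<in> Q1 \<and> p \<sim> q1 \<and> q0 \<in> Q0 \<and> q1 \<sim> q0 \<and> s \<in> S0 \<and> q0 \<sim> s" if "p \<in> Q2" for p
  proof -
    have p: "p \<in> B1" "p \<in> B0" using that Q2 fB1 by auto
    then obtain q1 where q1: "q1 \<in> Q1" "p \<simeq> q1" using Q1(3) unfolding dom_def by blast
    obtain s1 where s1: "s1 \<in> S1" "q1 \<sim> s1" using S1(3) q1 by blast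
    have "p \<noteq> q1" using p(1) s1 nb_tch unfolding B1_def by blast
    then have a: "p \<sim> q1" using q1 by (simp add: tch_def)
    have q1B: "q1 \<in> B0" using q1 Q1 by auto
    then obtain q0 where q0: "q0 \<in> Q0" "q1 \<simeq> q0" using Q0(3) fB0 unfolding dom_def by blast
    obtain s0 where s0: "s0 \<in> S0" "q0 \<sim> s0" using S0(3) q0 by blast
    have "q1 \<noteq> q0" using q1B s0 nb_tch unfolding B0_def by blast
    then have "q1 \<sim> q0" using q0 by (simp add: tch_def)
    then show ?thesis using a q1(1) q0(1) s0 by blast
  qed
  then obtain f g h where fgh: "\<And>p. p \<in> Q2 \<Longrightarrow> f p \<in> Q1 \<and> p \<sim> f p \<and> g p \<in> Q0 \<and> f p \<sim> g p \<and> h p \<in> S0 \<and> g p \<sim> h p"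
    by metis
  have finQ2: "finite Q2" using Q2(1) fB1 finite_subset by blast
  have small: "card {p\<in>Q2. h p = s} \<le> k" if "s \<in> S0" for s
  proof (rule ccontr)
    assume "\<not> ?thesis"
    then have big: "card {p\<in>Q2. h p = s} > k" by simp
    then have "{p\<in>Q2. h p = s} \<noteq> {}" by force
    then obtain p0 where p0: "p0 \<in> Q2" "h p0 = s" by blast
    define P where "P = {p\<in>Q2. h p = s} - {p0}"
    have PQ: "p \<in> Q2" "h p = s" "p \<noteq> p0" if "p \<in> P" for p using that unfolding P_def by auto
    have cP: "card P \<ge> k" unfolding P_def using big p0 finQ2 by (subst card_Diff_singleton) auto
    have mem: "p \<in> U" "f p \<in> U" "g p \<in> U" "p \<in> B0" "f p \<in> B0" if "p \<in> Q2" for p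
      using that fgh[OF that] Q0 Q1 Q2 fB0 fB1 by auto
    have far: "\<not> a \<simeq> b" if "p \<in> Q2" "p' \<in> Q2" "p \<noteq> p'" "a \<in> {p, f p, g p}" "b \<in> {p', f p', g p'}" for a b p p'
    proof
      assume ab: "a \<simeq> b"
      have F: "p \<simeq> f p" "f p \<simeq> g p" "p' \<simeq> f p'" "f p' \<simeq> g p'" "p \<simeq> g p" "p' \<simeq> g p'"
        using fgh[OF that(1)] fgh[OF that(2)] nb_tch mem[OF that(1)] mem[OF that(2)] tr by blast+
      have "p \<simeq> a" using that(4) F by auto
      moreover have "b \<simeq> p'" using that(5) F tch_sym by auto
      moreover have "a \<in> U" "b \<in> U" using that mem by auto
      ultimately have "p \<simeq> p'" using ab tr mem(1)[OF that(1)] mem(1)[OF that(2)] by metis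
      then show False using Q2(2) that(1-3) unfolding indep_def tch_def by blast
    qed
    have im: "imatch ((\<lambda>p. (f p, p)) ` P) \<and> card ((\<lambda>p. (f p, p)) ` P) = card P"
    proof (rule imatchI)
      fix p p' assume pp: "p \<in> P" "p' \<in> P" "p \<noteq> p'"
      note far' = far[OF PQ(1)[OF pp(1)] PQ(1)[OF pp(2)] pp(3)]
      show "\<not> f p \<simeq> f p'" "\<not> f p \<simeq> p'" "\<not> p \<simeq> p'" by (rule far'; simp)+
    qed (use fgh[OF PQ(1)] nb_sym in blast)
    have p3: "P3 s (g p0) (f p0)" unfolding P3_def
      using fgh[OF p0(1)] p0(2) nb_sym mem(5)[OF p0(1)] tch_sym \<open>s \<in> S0\<close> unfolding B0_def by blast
    have "card ((\<lambda>p. (f p, p)) ` P) < k"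
    proof (rule freeD[OF fr _ conjunct1[OF im] p3])
      show "finite ((\<lambda>p. (f p, p)) ` P)" unfolding P_def using finQ2 by auto
      fix q assume "q \<in> (\<lambda>p. (f p, p)) ` P"
      then obtain p where p: "p \<in> P" "q = (f p, p)" by blast
      have "\<not> s \<simeq> f p" "\<not> s \<simeq> p" using mem(4,5)[OF PQ(1)[OF p(1)]] \<open>s \<in> S0\<close> tch_sym unfolding B0_def by blast+
      moreover have "\<not> a \<simeq> b" if "a \<in> {g p0, f p0}" "b \<in> {f p, p}" for a b
        using far[OF p0(1) PQ(1)[OF p(1)], of a b] PQ(3)[OF p(1)] that by blast
      ultimately show "\<not> touch s q \<and> \<not> touch (g p0) q \<and> \<not> touch (f p0) q"
        unfolding touch_def p(2) by auto
    qed
    then show False using im cP by simp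
  qed
  have "card Q2 \<le> (\<Sum>s\<in>S0. card {p\<in>Q2. h p = s})"
  proof -
    have "Q2 = (\<Union>s\<in>S0. {p\<in>Q2. h p = s})" using fgh by blast
    then show ?thesis using card_UN_le[OF finS0, of "\<lambda>s. {p\<in>Q2. h p = s}"] by simp
  qed
  also have "\<dots> \<le> (\<Sum>s\<in>S0. k)" by (rule sum_mono) (rule small)
  also have "\<dots> \<le> k * m" using S0(2) by (simp add: mult.commute)
  finally have cQ2: "card Q2 \<le> k * m" .
  have "dom (S0 \<union> S1 \<union> Q2) U"
    using Q2(3) unfolding dom_def B1_def B0_def by blast
  moreover have "card (S0 \<union> S1 \<union> Q2) \<le> (k+2)*m + 2*k+1"
    using card_Un_le[of "S0 \<union> S1" Q2] card_Un_le[of S0 S1] S0(2) S1(2) cQ2 by (simp add: algebra_simps)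
  moreover have "S0 \<union> S1 \<union> Q2 \<subseteq> U \<union> X" using S0(1) S1(1) Q2(1) fB0 fB1 by blast
  ultimately show ?thesis by blast
qed

text \<open>An element without a private vertex could be dropped from the cover.\<close>

lemma minimal_cover_privates:
  assumes fS: "finite S" and cov: "\<forall>q\<in>Q. \<exists>s\<in>S. q \<sim> s"
    and mn: "\<And>S'. S' \<subseteq> S \<Longrightarrow> (\<forall>q\<in>Q. \<exists>s\<in>S'. q \<sim> s) \<Longrightarrow> card S \<le> card S'"
  shows "\<exists>pr. (\<forall>s\<in>S. pr s \<in> Q \<and> pr s \<sim> s) \<and> (\<forall>s\<in>S. \<forall>t\<in>S. pr s \<sim> t \<longrightarrow> t = s)"
proof -
  have "\<exists>q\<in>Q. q \<sim> s \<and> (\<forall>t\<in>S. q \<sim> t \<longrightarrow> t = s)" if s: "s \<in> S" for s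
  proof (rule ccontr)
    assume "\<not> ?thesis"
    then have "\<forall>q\<in>Q. \<exists>t\<in>S-{s}. q \<sim> t" using cov by blast
    then have "card S \<le> card (S-{s})" using mn[of "S-{s}"] by blast
    then show False using card_Diff1_less[OF fS s] by simp
  qed
  then have "\<forall>s\<in>S. \<exists>q. q \<in> Q \<and> q \<sim> s \<and> (\<forall>t\<in>S. q \<sim> t \<longrightarrow> t = s)" by blast
  from bchoice[OF this] obtain pr where
    "\<forall>s\<in>S. pr s \<in> Q \<and> pr s \<sim> s \<and> (\<forall>t\<in>S. pr s \<sim> t \<longrightarrow> t = s)" ..
  then show ?thesis by (intro exI[of _ pr]) simp
qed

lemma min_cover_exists:
  assumes "finite S" "\<forall>q\<in>Q. \<exists>s\<in>S. q \<sim> s"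
  shows "\<exists>S'\<subseteq>S. (\<forall>q\<in>Q. \<exists>s\<in>S'. q \<sim> s) \<and>
    (\<forall>S''\<subseteq>S. (\<forall>q\<in>Q. \<exists>s\<in>S''. q \<sim> s) \<longrightarrow> card S' \<le> card S'')"
proof -
  define P where "P S' \<longleftrightarrow> S' \<subseteq> S \<and> (\<forall>q\<in>Q. \<exists>s\<in>S'. q \<sim> s)" for S'
  have "P S" using assms by (simp add: P_def)
  then obtain S' where "P S' \<and> (\<forall>y. P y \<longrightarrow> card S' \<le> card y)"
    using ex_has_least_nat[of P S card] by metis
  then show ?thesis by (intro exI[of _ S']) (simp add: P_def)
qed

text \<open>In a minimum cover \<open>S\<close> each \<open>s\<close> has a private vertex \<open>pr s\<close>.  A vertex of \<open>X\<close> seeing two of these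
  could replace one element of \<open>S\<close>; the private vertices of the rest then give a forbidden \<open>P3 + kP2\<close>.\<close>

lemma cover_matching:
  assumes fr: "free k" and X: "X \<subseteq> V" "indep X" and Q: "Q \<subseteq> V" "indep Q" "X \<inter> Q = {}"
    and cov: "\<forall>q\<in>Q. \<exists>x\<in>X. q \<sim> x"
    and big': "\<forall>S\<subseteq>X. (\<forall>q\<in>Q. \<exists>s\<in>S. q \<sim> s) \<longrightarrow> k + 3 \<le> card S \<and> m \<le> card S"
  shows "\<exists>S pr. S \<subseteq> X \<and> m \<le> card S \<and> (\<forall>s\<in>S. pr s \<in> Q \<and> pr s \<sim> s) \<and>
    (\<forall>s\<in>S. \<forall>t\<in>S. pr s \<sim> t \<longrightarrow> t = s) \<and>
    (\<forall>f\<in>X. \<forall>s\<in>S. \<forall>t\<in>S. pr s \<sim> f \<longrightarrow> pr t \<sim> f \<longrightarrow> s = t)"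
proof -
  have big: "k + 3 \<le> card S \<and> m \<le> card S" if "S \<subseteq> X" "\<forall>q\<in>Q. \<exists>s\<in>S. q \<sim> s" for S
    using big' that by simp
  have finX: "finite X" using X finV finite_subset by blast
  obtain S where S: "S \<subseteq> X" "\<forall>q\<in>Q. \<exists>s\<in>S. q \<sim> s"
    and Smin: "\<And>S''. S'' \<subseteq> X \<Longrightarrow> (\<forall>q\<in>Q. \<exists>s\<in>S''. q \<sim> s) \<Longrightarrow> card S \<le> card S''"
    using min_cover_exists[OF finX cov] by blast
  have finS: "finite S" using S finX finite_subset by blast
  have Smin': "card S \<le> card S''" if "S'' \<subseteq> S" "\<forall>q\<in>Q. \<exists>s\<in>S''. q \<sim> s" for S''
    using Smin[OF subset_trans[OF that(1) S(1)] that(2)] .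
  obtain pr where pr: "\<And>s. s \<in> S \<Longrightarrow> pr s \<in> Q \<and> pr s \<sim> s"
    "\<And>s t. s \<in> S \<Longrightarrow> t \<in> S \<Longrightarrow> pr s \<sim> t \<Longrightarrow> t = s"
    using minimal_cover_privates[OF finS S(2) Smin'] by blast
  have uniq: "a = b" if f: "f \<in> X" "a \<in> S" "b \<in> S" "pr a \<sim> f" "pr b \<sim> f" for f a b
  proof (rule ccontr)
    assume ab: "a \<noteq> b"
    \<comment> \<open>\<open>f\<close> covers everything outside \<open>Q1\<close>, so a minimum
      cover \<open>S1\<close> of \<open>Q1\<close> is at most one smaller than \<open>S\<close>.
      Removing \<open>a\<close> and \<open>b\<close> as well, the only elements of \<open>S\<close>
      that see \<open>pr a\<close> and \<open>pr b\<close>, leaves at least \<open>k\<close>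
      elements; this accounts for \<open>k + 3\<close>.\<close>
    define Q1 where "Q1 = {q\<in>Q. \<not> q \<sim> f}"
    have c1: "\<forall>q\<in>Q1. \<exists>s\<in>S. q \<sim> s" using S(2) unfolding Q1_def by blast
    obtain S1 where S1: "S1 \<subseteq> S" "\<forall>q\<in>Q1. \<exists>s\<in>S1. q \<sim> s"
      and S1min: "\<And>S''. S'' \<subseteq> S \<Longrightarrow> (\<forall>q\<in>Q1. \<exists>s\<in>S''. q \<sim> s) \<Longrightarrow> card S1 \<le> card S''"
      using min_cover_exists[OF finS c1] by blast
    have finS1: "finite S1" using S1 finS finite_subset by blast
    have S1min': "card S1 \<le> card S''" if "S'' \<subseteq> S1" "\<forall>q\<in>Q1. \<exists>s\<in>S''. q \<sim> s" for S''
      using S1min[OF subset_trans[OF that(1) S1(1)] that(2)] .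
    obtain pr1 where pr1: "\<And>s. s \<in> S1 \<Longrightarrow> pr1 s \<in> Q1 \<and> pr1 s \<sim> s"
      "\<And>s t. s \<in> S1 \<Longrightarrow> t \<in> S1 \<Longrightarrow> pr1 s \<sim> t \<Longrightarrow> t = s"
      using minimal_cover_privates[OF finS1 S1(2) S1min'] by blast
    have "\<forall>q\<in>Q. \<exists>s\<in>insert f S1. q \<sim> s" using S1(2) unfolding Q1_def by blast
    then have "card S \<le> card (insert f S1)" using Smin[of "insert f S1"] f(1) S1(1) S(1) by blast
    also have "\<dots> \<le> card S1 + 1" using card_insert_le_m1 finS1 by (simp add: card_insert_if)
    finally have "k + 3 \<le> card S1 + 1" using big[OF S] by linarith
    define P where "P = S1 - {a,b}"
    have cP: "card P \<ge> k"
      using diff_card_le_card_Diff[of "{a,b}" S1] \<open>k + 3 \<le> card S1 + 1\<close> ab unfolding P_def by simp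
    have PS: "s \<in> S1" "s \<in> S" "s \<in> X" "s \<noteq> a" "s \<noteq> b" if "s \<in> P" for s using that S1 S unfolding P_def by auto
    have q1: "pr1 s \<in> Q" "\<not> pr1 s \<sim> f" "pr1 s \<sim> s" "\<not> pr1 s \<simeq> f" if "s \<in> P" for s
      using pr1(1)[OF PS(1)[OF that]] Q(3) f(1) unfolding Q1_def tch_def by auto
    have im: "imatch ((\<lambda>s. (s, pr1 s)) ` P) \<and> card ((\<lambda>s. (s, pr1 s)) ` P) = card P"
    proof (rule imatchI)
      fix s t assume st: "s \<in> P" "t \<in> P" "s \<noteq> t"
      show "\<not> s \<simeq> t" by (rule indepD2[OF X(2) PS(3)[OF st(1)] PS(3)[OF st(2)] st(3)])
      have "\<not> pr1 t \<sim> s" using pr1(2)[OF PS(1)[OF st(2)] PS(1)[OF st(1)]] st(3) by blast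
      moreover have "s \<noteq> pr1 t" using Q(3) PS(3)[OF st(1)] q1(1)[OF st(2)] by blast
      ultimately show "\<not> s \<simeq> pr1 t" by (simp add: tch_def nb_comm)
      have "pr1 s \<noteq> pr1 t" using pr1(2)[OF PS(1)[OF st(1)] PS(1)[OF st(2)]] q1(3)[OF st(2)] st(3) by auto
      then show "\<not> pr1 s \<simeq> pr1 t" by (rule indepD2[OF Q(2) q1(1)[OF st(1)] q1(1)[OF st(2)]])
    next
      fix s assume "s \<in> P" then show "s \<sim> pr1 s" by (rule nb_sym[OF q1(3)])
    qed
    have "pr a \<noteq> pr b" using pr(2)[OF f(2,3)] pr(1)[OF f(3)] ab by auto
    then have p3: "P3 (pr a) f (pr b)" unfolding P3_def
      using f(4) nb_sym[OF f(5)] indepD2[OF Q(2)] pr(1)[OF f(2)] pr(1)[OF f(3)] by simp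
    have "card ((\<lambda>s. (s, pr1 s)) ` P) < k"
    proof (rule freeD[OF fr _ conjunct1[OF im] p3])
      show "finite ((\<lambda>s. (s, pr1 s)) ` P)" unfolding P_def using finS1 by auto
      fix q assume "q \<in> (\<lambda>s. (s, pr1 s)) ` P"
      then obtain s where s: "s \<in> P" "q = (s, pr1 s)" by blast
      have pq: "\<not> pr c \<simeq> s" "\<not> pr c \<simeq> pr1 s" if c: "c \<in> {a,b}" for c
      proof -
        have cS: "c \<in> S" "c \<noteq> s" "pr c \<sim> f" "pr c \<in> Q" using c f PS[OF s(1)] pr(1) by auto
        show "\<not> pr c \<simeq> s" using pr(2)[OF cS(1) PS(2)[OF s(1)]] cS PS(3)[OF s(1)] Q(3) unfolding tch_def by auto
        have "pr c \<noteq> pr1 s" using cS(3) q1(2)[OF s(1)] by auto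
        then show "\<not> pr c \<simeq> pr1 s" by (rule indepD2[OF Q(2) cS(4) q1(1)[OF s(1)]])
      qed
      have "\<not> f \<sim> s" by (rule indepD[OF X(2) f(1) PS(3)[OF s(1)]])
      moreover have "f \<noteq> s" using pr(2)[OF f(2) PS(2)[OF s(1)]] f(4) PS(4)[OF s(1)] by auto
      ultimately have "\<not> f \<simeq> s" by (simp add: tch_def)
      moreover have "\<not> f \<simeq> pr1 s" using q1(4)[OF s(1)] tch_sym by blast
      ultimately show "\<not> touch (pr a) q \<and> \<not> touch f q \<and> \<not> touch (pr b) q"
        using pq unfolding touch_def s(2) by auto
    qed
    then show False using im cP by simp
  qed
  show ?thesis
    by (intro exI[of _ S] exI[of _ pr] conjI S(1) ballI impI) (use big[OF S] pr uniq in simp_all)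
qed

end

section \<open>A vertex with many neighbours in a minimum set\<close>

context fin_graph begin

text \<open>If \<open>g\<close> is the minimum, this is the negative instance. The bound
  \<open>card D \<le> g\<close> in place of equality spares exact counts after an exchange.\<close>

definition rigid :: "nat \<Rightarrow> bool" where
  "rigid g \<longleftrightarrow> (\<forall>D. STD D \<longrightarrow> g \<le> card D) \<and> (\<forall>D. STD D \<and> card D \<le> g \<longrightarrow> \<not> triple D)"

lemma rigidD: "rigid g \<Longrightarrow> STD D \<Longrightarrow> card D \<le> g \<Longrightarrow> \<not> triple D" "rigid g \<Longrightarrow> STD D \<Longrightarrow> g \<le> card D"
  unfolding rigid_def by auto

lemma STDI:
  assumes "D \<subseteq> V" "\<And>x. x \<in> V \<Longrightarrow> \<exists>y\<in>D. x \<simeq> y" "\<And>x. x \<in> D \<Longrightarrow> \<exists>y\<in>D. near x y"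
  shows "STD D"
  using assms by (simp add: STD_def)

text \<open>Let \<open>X1\<close> be most of the \<open>D\<close>-neighbours of \<open>v\<close>.  Removing \<open>X1\<close> from \<open>D\<close> and adding \<open>v\<close> creates a triple,
  so the repair must cost at least as many vertices as were removed.  What has to be repaired is the set \<open>U\<close>: the vertices \<open>U0\<close> that lose
  domination, and one common neighbour \<open>zz y\<close> for each \<open>y\<close> all of whose companions lie in \<open>X1\<close>.\<close>

lemma many_common_neighbours_matching:
  assumes fr: "free k" and rg: "rigid g" and D: "STD D" "card D \<le> g"
    and big: "(k+2)*m + 2*k + 4 \<le> card {x\<in>D. x \<sim> v}" and m: "k + 3 \<le> m"
  shows "\<exists>L. finite L \<and> imatch L \<and> card L = m \<and> (\<forall>f\<in>D. k \<le> card {p\<in>L. \<not> touch f p})"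
proof -
  define X where "X = {x\<in>D. x \<sim> v}"
  have finD: "finite D" and DV: "D \<subseteq> V" using STD_fin STD_V D by auto
  have finX: "finite X" unfolding X_def using finD by auto
  have nt: "\<not> triple D" using rigidD(1)[OF rg] D by blast
  have XD: "x \<in> D" "x \<sim> v" "v \<sim> x" if "x \<in> X" for x using that nb_sym unfolding X_def by auto
  have third: "\<exists>z\<in>X. z \<noteq> a \<and> z \<noteq> b" for a b
  proof (rule ccontr)
    assume "\<not> ?thesis"
    then have "X \<subseteq> {a,b}" by blast
    then have "card X \<le> card {a,b}" by (intro card_mono) auto
    also have "\<dots> \<le> 2" by (simp add: card_insert_if)
    finally show False using big unfolding X_def by simp
  qed
  have vD: "v \<notin> D"
  proof
    assume v: "v \<in> D"
    obtain x where x: "x \<in> X" using third by blast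
    obtain x' where x': "x' \<in> X" "x' \<noteq> x" using third by blast
    show False using nt tripleI[OF XD(1)[OF x] v XD(1)[OF x'(1)] XD(2)[OF x] nearI1[OF XD(3)[OF x'(1)]] x'(2)] by blast
  qed
  have vV: "v \<in> V"
  proof -
    obtain x where x: "x \<in> X" using third by blast
    show ?thesis using nb_V[OF XD(3)[OF x]] .
  qed
  \<comment> \<open>Any two elements of \<open>X\<close> are within distance two through
    \<open>v\<close>, so a neighbour of one of them in \<open>D\<close> would complete a
    triple.\<close>
  have nadj: "\<not> f \<sim> x" if f: "f \<in> D" and x: "x \<in> X" for f x
  proof
    assume fx: "f \<sim> x"
    obtain x' where x': "x' \<in> X" "x' \<noteq> f" "x' \<noteq> x" using third by blast
    have "near x x'" by (rule nearI2[OF XD(2)[OF x] XD(3)[OF x'(1)]]) (use x' in auto)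
    from tripleI[OF f XD(1)[OF x] XD(1)[OF x'(1)] fx this x'(2)] show False using nt by blast
  qed
  \<comment> \<open>\<open>X1\<close> is one larger than the dominating sets supplied by
    \<open>small_dom_or_big_cover\<close>; this one vertex pays for \<open>v\<close>. Two further
    neighbours \<open>x1\<close>, \<open>x2\<close> of \<open>v\<close> stay in the set, so that
    \<open>x1\<close>, \<open>v\<close>, \<open>x2\<close> is a triple after the exchange.\<close>
  have "(k+2)*m + 2*k + 2 \<le> card X" using big unfolding X_def by simp
  then obtain X1 where X1: "X1 \<subseteq> X" "card X1 = (k+2)*m + 2*k + 2" by (rule obtain_subset_with_card_n) auto
  have finX1: "finite X1" using X1 finX finite_subset by blast
  have "2 \<le> card (X - X1)" using big X1 finX1 unfolding X_def[symmetric] by (simp add: card_Diff_subset)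
  then obtain X2 where "X2 \<subseteq> X - X1" "card X2 = 2" by (rule obtain_subset_with_card_n) auto
  then obtain x1 x2 where x12: "x1 \<in> X - X1" "x2 \<in> X - X1" "x1 \<noteq> x2"
    by (auto simp: card_2_iff)
  define zP where "zP y z \<longleftrightarrow> z \<sim> y \<and> z \<notin> D \<and> \<not> z \<simeq> v \<and> (\<exists>x\<in>X1. z \<sim> x)" for y z
  define Y where "Y = {y\<in>D-X1. (\<forall>y'\<in>D. near y y' \<longrightarrow> y' \<in> X1) \<and> (\<exists>z. zP y z)}"
  define zz where "zz y = (SOME z. zP y z)" for y
  have zz: "zP y (zz y)" if "y \<in> Y" for y using that someI_ex[of "zP y"] unfolding Y_def zz_def by auto
  define U0 where "U0 = {u\<in>V-D. \<not> u \<simeq> v \<and> (\<forall>d\<in>D. u \<sim> d \<longrightarrow> d \<in> X1)}"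
  define U where "U = U0 \<union> zz ` Y"
  have U1: "u \<in> V \<and> u \<notin> D \<and> \<not> u \<simeq> v \<and> (\<exists>x\<in>X1. u \<sim> x)" if uU: "u \<in> U" for u
  proof (cases "u \<in> U0")
    case True
    then have u: "u \<in> V" "u \<notin> D" "\<not> u \<simeq> v" "\<forall>d\<in>D. u \<sim> d \<longrightarrow> d \<in> X1" unfolding U0_def by auto
    obtain d where d: "d \<in> D" "u \<simeq> d" using u(1) D(1) unfolding STD_def by blast
    then have "u \<sim> d" using u(2) unfolding tch_def by auto
    then show ?thesis using u d by blast
  next
    case False
    then obtain y where y: "y \<in> Y" "u = zz y" using uU unfolding U_def by blast
    then have "zP y u" using zz by simp
    then show ?thesis unfolding zP_def using nb_V by blast
  qed
  \<comment> \<open>Vertices of \<open>U0\<close> have no neighbour in \<open>D\<close> outside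
    \<open>X1\<close>. If \<open>zz y\<close> is adjacent to such an \<open>f\<close> different from
    \<open>y\<close>, then \<open>f\<close> is a companion of \<open>y\<close> outside
    \<open>X1\<close>, which membership in \<open>Y\<close> excludes.\<close>
  have Uuniq: "u = u'" if f: "f \<in> D" "f \<notin> X1" and u: "u \<in> U" "u' \<in> U" "u \<sim> f" "u' \<sim> f" for f u u'
  proof -
    have *: "w = zz f" if w: "w \<in> U" "w \<sim> f" for w
    proof -
      have "w \<notin> U0" using w f unfolding U0_def by blast
      then obtain y where y: "y \<in> Y" "w = zz y" using w unfolding U_def by blast
      have "y = f"
      proof (rule ccontr)
        assume "y \<noteq> f"
        moreover have "w \<sim> y" using zz[OF y(1)] y(2) unfolding zP_def by blast
        ultimately have "near y f" using nearI2[OF nb_sym w(2)] by blast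
        then show False using y(1) f unfolding Y_def by blast
      qed
      then show ?thesis using y by simp
    qed
    show ?thesis using *[OF u(1,3)] *[OF u(2,4)] by simp
  qed
  have UV: "U \<subseteq> V" and UD: "U \<inter> D = {}" using U1 by auto
  have X1D: "X1 \<subseteq> D" using X1(1) XD(1) by auto
  have X1V: "X1 \<subseteq> V" using X1D DV by auto
  have exch: False if T: "T \<subseteq> U \<union> X1" "dom T U" "card T < card X1" for T
  proof -
    define D1 where "D1 = (D - X1) \<union> insert v T"
    have "card D1 \<le> card (D - X1) + card (insert v T)" unfolding D1_def by (rule card_Un_le)
    also have "card (insert v T) \<le> card T + 1"
      by (metis card_insert_if card.infinite finite_insert le_add1 le_refl Suc_eq_plus1)
    also have "card (D - X1) = card D - card X1" by (rule card_Diff_subset[OF finX1 X1D])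
    finally have cD1: "card D1 \<le> g" using T(3) D(2) card_mono[OF finD X1D] by linarith
    have sub: "D1 \<subseteq> V" unfolding D1_def using DV vV T(1) UV X1V by auto
    have x1: "x1 \<in> D1" "x2 \<in> D1" "v \<in> D1" using x12 XD(1) unfolding D1_def by auto
    have "STD D1"
    proof (rule STDI[OF sub])
      fix z assume z: "z \<in> V"
      show "\<exists>y\<in>D1. z \<simeq> y"
      proof (cases "z \<simeq> v \<or> (\<exists>d\<in>D-X1. z \<simeq> d)")
        case True then show ?thesis using x1(3) unfolding D1_def by blast
      next
        case False
        have "z \<notin> D" using False XD(2) X1(1) unfolding tch_def by blast
        then have "z \<in> U0" using False z nb_tch unfolding U0_def by blast
        then show ?thesis using T(2) unfolding dom_def U_def D1_def by blast
      qed
    next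
      fix y assume y: "y \<in> D1"
      consider "y = v" | "y \<in> X1" | "y \<in> U" | "y \<in> D - X1" using y T(1) unfolding D1_def by blast
      then show "\<exists>y'\<in>D1. near y y'"
      proof cases
        case 1 then show ?thesis using x1(1) nearI1[OF XD(3)[of x1]] x12 by blast
      next
        case 2 then show ?thesis using x1(3) nearI1[OF XD(2)[of y]] X1(1) by blast
      next
        case 3
        then obtain x where x: "x \<in> X1" "y \<sim> x" "\<not> y \<simeq> v" using U1 by blast
        have "near y v" by (rule nearI2[OF x(2) XD(2)]) (use x X1(1) in auto)
        then show ?thesis using x1(3) by blast
      next
        case 4
        show ?thesis
        proof (cases "\<exists>y'\<in>D. near y y' \<and> y' \<notin> X1")
          case True then show ?thesis unfolding D1_def by blast
        next
          case False
          have yv: "y \<noteq> v" using 4 vD by blast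
          obtain x where x: "x \<in> D" "near y x" using D(1) 4 unfolding STD_def by blast
          then have xX: "x \<in> X1" "x \<in> X" using False X1(1) by auto
          have "\<not> y \<sim> x" using nadj 4 xX by blast
          then obtain w where w: "y \<sim> w" "w \<sim> x" using x(2) unfolding near_def by blast
          show ?thesis
          proof (cases "w \<simeq> v")
            case True
            then have "near y v" using near_tch[OF w(1)] yv by blast
            then show ?thesis using x1(3) by blast
          next
            case wv: False
            have "w \<notin> D" using nadj[OF _ xX(2)] w(2) by blast
            then have "zP y w" unfolding zP_def using w nb_sym[OF w(1)] wv xX(1) by blast
            then have yY: "y \<in> Y" using 4 False unfolding Y_def by blast
            then have "zz y \<in> U" unfolding U_def by blast
            then obtain t where t: "t \<in> T" "zz y \<simeq> t" using T(2) unfolding dom_def by blast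
            have "y \<sim> zz y" using zz[OF yY] nb_sym unfolding zP_def by blast
            moreover have "y \<noteq> t" using t(1) T(1) UD 4 by blast
            ultimately have "near y t" using near_tch t(2) by blast
            then show ?thesis using t(1) unfolding D1_def by blast
          qed
        qed
      qed
    qed
    moreover have "triple D1" using tripleI[OF x1(1,3,2) XD(2) nearI1[OF XD(3)]] x12 by blast
    ultimately show False using rigidD(1)[OF rg _ cD1] by blast
  qed
  have "\<exists>Q\<subseteq>U. indep Q \<and> (\<forall>S\<subseteq>X1. (\<forall>q\<in>Q. \<exists>s\<in>S. q \<sim> s) \<longrightarrow> m < card S)"
  proof (rule ccontr)
    assume n: "\<not> ?thesis"
    have "\<exists>S\<subseteq>X1. card S \<le> m \<and> (\<forall>q\<in>Q. \<exists>s\<in>S. q \<sim> s)" if Q: "Q \<subseteq> U" "indep Q" for Q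
    proof -
      have "\<not> (\<forall>S\<subseteq>X1. (\<forall>q\<in>Q. \<exists>s\<in>S. q \<sim> s) \<longrightarrow> m < card S)" using n Q by blast
      then show ?thesis using not_less by auto
    qed
    from small_dom_or_big_cover[OF fr UV X1V this] obtain T where
      T: "T \<subseteq> U \<union> X1" "card T \<le> (k+2)*m + 2*k+1" "dom T U" by blast
    show False using exch[OF T(1,3)] T(2) X1(2) by simp
  qed
  then obtain Q where Q: "Q \<subseteq> U" "indep Q"
    and Qb: "\<And>S. S \<subseteq> X1 \<Longrightarrow> (\<forall>q\<in>Q. \<exists>s\<in>S. q \<sim> s) \<Longrightarrow> m < card S" by blast
  have X1i: "indep X1" unfolding indep_def using nadj X1(1) X1D by blast
  have dis: "X1 \<inter> Q = {}" using Q UD X1D by blast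
  have QV: "Q \<subseteq> V" using Q UV by blast
  have Qc: "\<forall>q\<in>Q. \<exists>x\<in>X1. q \<sim> x" using Q U1 by blast
  have Qb': "\<forall>S\<subseteq>X1. (\<forall>q\<in>Q. \<exists>s\<in>S. q \<sim> s) \<longrightarrow> k + 3 \<le> card S \<and> m \<le> card S"
    using Qb m by (meson add_leD1 le_trans less_imp_le)
  obtain S pr where S: "S \<subseteq> X1" "card S \<ge> m" and pr1: "\<And>s. s \<in> S \<Longrightarrow> pr s \<in> Q \<and> pr s \<sim> s"
    and pr2: "\<And>s t. s \<in> S \<Longrightarrow> t \<in> S \<Longrightarrow> pr s \<sim> t \<Longrightarrow> t = s"
    and pr3: "\<And>f s t. f \<in> X1 \<Longrightarrow> s \<in> S \<Longrightarrow> t \<in> S \<Longrightarrow> pr s \<sim> f \<Longrightarrow> pr t \<sim> f \<Longrightarrow> s = t"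
  proof -
    from cover_matching[OF fr X1V X1i QV Q(2) dis Qc Qb'] obtain S pr where
      c: "S \<subseteq> X1" "m \<le> card S" "\<forall>s\<in>S. pr s \<in> Q \<and> pr s \<sim> s"
      "\<forall>s\<in>S. \<forall>t\<in>S. pr s \<sim> t \<longrightarrow> t = s"
      "\<forall>f\<in>X1. \<forall>s\<in>S. \<forall>t\<in>S. pr s \<sim> f \<longrightarrow> pr t \<sim> f \<longrightarrow> s = t" by (elim exE conjE)
    show ?thesis
      by (rule that[OF c(1,2) bspec[OF c(3)]])
        (use bspec[OF bspec[OF c(4)]] bspec[OF bspec[OF bspec[OF c(5)]]] in blast)+
  qed
  obtain S' where S': "S' \<subseteq> S" "card S' = m" by (rule obtain_subset_with_card_n[OF S(2)])
  have finS': "finite S'" by (rule finite_subset[OF subset_trans[OF S'(1) S(1)] finX1])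
  define L where "L = (\<lambda>s. (s, pr s)) ` S'"
  have mem: "s \<in> S" "s \<in> X1" "s \<in> X" "pr s \<in> Q" "pr s \<sim> s" "pr s \<in> U" "pr s \<notin> D" if "s \<in> S'" for s
  proof -
    show a: "s \<in> S" using that S'(1) by blast
    show b: "s \<in> X1" using a S(1) by blast
    show "s \<in> X" using b X1(1) by blast
    show c: "pr s \<in> Q" "pr s \<sim> s" using pr1[OF a] by auto
    show d: "pr s \<in> U" using c(1) Q(1) by blast
    show "pr s \<notin> D" using d UD by blast
  qed
  have "imatch L \<and> card L = card S'" unfolding L_def
  proof (rule imatchI)
    fix s assume "s \<in> S'" then show "s \<sim> pr s" using nb_sym[OF mem(5)] by simp
  next
    fix s t assume st: "s \<in> S'" "t \<in> S'" "s \<noteq> t"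
    show "\<not> s \<simeq> t" by (rule indepD2[OF X1i mem(2)[OF st(1)] mem(2)[OF st(2)] st(3)])
    have "s \<noteq> pr t" using dis mem(2)[OF st(1)] mem(4)[OF st(2)] by blast
    then show "\<not> s \<simeq> pr t" using pr2[OF mem(1)[OF st(2)] mem(1)[OF st(1)]] st(3) by (auto simp: tch_def nb_comm)
    have "pr s \<noteq> pr t" using pr2[OF mem(1)[OF st(1)] mem(1)[OF st(2)]] mem(5)[OF st(2)] st(3) by auto
    then show "\<not> pr s \<simeq> pr t" by (rule indepD2[OF Q(2) mem(4)[OF st(1)] mem(4)[OF st(2)]])
  qed
  then have L: "imatch L" "card L = m" using S'(2) by auto
  have finL: "finite L" unfolding L_def using finS' by simp
  \<comment> \<open>\<open>f\<close> touches the edge of \<open>s\<close> only if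
    \<open>f = s\<close> or \<open>pr s\<close> is adjacent to \<open>f\<close>. The second happens
    for at most one \<open>s\<close>, by \<open>pr3\<close> if \<open>f\<close> is in
    \<open>X1\<close> and by \<open>Uuniq\<close> otherwise; so at most two edges are
    touched.\<close>
  have "k \<le> card {p\<in>L. \<not> touch f p}" if f: "f \<in> D" for f
  proof -
    define B where "B = {s\<in>S'. pr s \<sim> f}"
    have "s = t" if "s \<in> B" "t \<in> B" for s t
    proof (cases "f \<in> X1")
      case True then show ?thesis using pr3[OF True] that mem(1) unfolding B_def by blast
    next
      case False
      have st: "s \<in> S'" "t \<in> S'" "pr s \<sim> f" "pr t \<sim> f" using that unfolding B_def by auto
      have "pr s = pr t" using Uuniq[OF f False mem(6)[OF st(1)] mem(6)[OF st(2)] st(3,4)] .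
      then have "pr s \<sim> t" using mem(5)[OF st(2)] by simp
      then show ?thesis using pr2[OF mem(1)[OF st(1)] mem(1)[OF st(2)]] by simp
    qed
    then have "card B \<le> 1" using finS' card_le_Suc0_iff_eq[of B] unfolding B_def by auto
    have "{p\<in>L. touch f p} \<subseteq> (\<lambda>s. (s, pr s)) ` insert f B"
    proof
      fix p assume "p \<in> {p\<in>L. touch f p}"
      then obtain s where s: "s \<in> S'" "p = (s, pr s)" "f \<simeq> s \<or> f \<simeq> pr s" unfolding L_def touch_def by auto
      have "s \<in> insert f B" using s(1,3) nadj[OF f mem(3)[OF s(1)]] mem(7)[OF s(1)] f
        unfolding tch_def B_def using nb_comm[of f "pr s"] by auto
      then show "p \<in> (\<lambda>s. (s, pr s)) ` insert f B" using s(2) by blast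
    qed
    then have "card {p\<in>L. touch f p} \<le> card (insert f B)"
      using finS' unfolding B_def by (intro surj_card_le) auto
    also have "\<dots> \<le> 2" using \<open>card B \<le> 1\<close> finS' unfolding B_def by (simp add: card_insert_if)
    finally have 2: "card {p\<in>L. touch f p} \<le> 2" .
    have "card L = card {p\<in>L. touch f p} + card {p\<in>L. \<not> touch f p}"
      using finL by (subst card_Un_disjoint[symmetric]) (auto intro: arg_cong[where f=card])
    then show ?thesis using 2 L(2) m by linarith
  qed
  then show ?thesis using L finL by blast
qed

end

section \<open>Graphs with a large induced matching\<close>

text \<open>Connectivity is assumed in cut form; it shows that every clique of \<open>W\<close> has
  a neighbour in \<open>F\<close>.\<close>

locale legs = fin_graph +
  fixes k :: nat and L :: "('a \<times> 'a) set"
  assumes fr: "free k" and finL: "finite L" and im: "imatch L" and bigL: "9*k+10 \<le> card L"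
    and conn: "\<And>K. K \<subset> V \<Longrightarrow> K \<noteq> {} \<Longrightarrow> \<exists>u\<in>K. \<exists>w\<in>V-K. u \<sim> w"
begin

text \<open>\<open>F\<close>: vertices touching almost all edges of \<open>L\<close>; \<open>KK\<close>: the cliques forming \<open>W\<close>;
  \<open>domd R\<close>: the cliques every vertex of which has a neighbour in \<open>R\<close>.\<close>

definition "F = {f\<in>V. card {p\<in>L. \<not> touch f p} < k}"
definition "W = V - F"
definition "cls u = {w\<in>W. u \<simeq> w}"
definition "KK = cls ` W"
definition "domd R = {K\<in>KK. \<forall>u\<in>K. \<exists>f\<in>R. u \<sim> f}"
text \<open>Such a clique contains an edge that a vertex \<open>f\<close> of \<open>F\<close> does
  not touch; many of them would supply the matching of a forbidden P3 + kP2.\<close>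

definition "miss2 f = {K\<in>KK. \<exists>c\<in>K. \<exists>d\<in>K. c \<noteq> d \<and> \<not> c \<sim> f \<and> \<not> d \<sim> f}"
definition "legK p = cls (fst p)"
definition "good \<longleftrightarrow> (\<forall>R. R \<subseteq> F \<and> R \<noteq> {} \<and> card R \<le> 5*k+2 \<longrightarrow> card (domd R) < card R)"

lemma sep: "p \<in> L \<Longrightarrow> q \<in> L \<Longrightarrow> p \<noteq> q \<Longrightarrow> c = fst p \<or> c = snd p \<Longrightarrow> \<not> touch c q"
  using im unfolding imatch_def by blast

lemma leg_nb: "p \<in> L \<Longrightarrow> fst p \<sim> snd p" using im unfolding imatch_def by blast

lemma touchE: assumes "touch w p" obtains c where "c = fst p \<or> c = snd p" "w \<simeq> c"
  using assms unfolding touch_def by blast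

lemma touchI: "c = fst p \<or> c = snd p \<Longrightarrow> w \<simeq> c \<Longrightarrow> touch w p"
  unfolding touch_def by blast

lemma W_V: "w \<in> W \<Longrightarrow> w \<in> V" by (simp add: W_def)
lemma W_F: "w \<in> W \<Longrightarrow> f \<in> F \<Longrightarrow> w \<noteq> f" by (auto simp: W_def)
lemma F_V: "f \<in> F \<Longrightarrow> f \<in> V" by (simp add: F_def)
lemma finW: "finite W" and finF: "finite F" using finV by (auto simp: W_def F_def)

lemma W_un: "w \<in> W \<Longrightarrow> k \<le> card {p\<in>L. \<not> touch w p}" unfolding W_def F_def by auto

text \<open>An end of one edge touches no other edge, so a vertex touching two edges lies on neither
  and is the middle of a P3 with one end of each.\<close>

lemma two_touched:
  assumes p: "p \<in> L" "q \<in> L" "p \<noteq> q" "touch w p" "touch w q"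
  obtains c c' where "c = fst p \<or> c = snd p" "c' = fst q \<or> c' = snd q" "P3 c w c'"
proof -
  obtain c where c: "c = fst p \<or> c = snd p" "w \<simeq> c" using touchE[OF p(4)] by blast
  obtain c' where c': "c' = fst q \<or> c' = snd q" "w \<simeq> c'" using touchE[OF p(5)] by blast
  have n: "\<not> touch c q" "\<not> touch c' p" using sep p c c' by blast+
  have "w \<noteq> c" using n(1) p(5) by blast
  moreover have "w \<noteq> c'" using n(2) p(4) by blast
  moreover have "\<not> c \<simeq> c'" using n(1) touchI[OF c'(1)] by blast
  ultimately have "P3 c w c'" using c(2) c'(2) unfolding P3_def tch_def by (simp add: nb_comm)
  then show ?thesis using that c(1) c'(1) by blast
qed

text \<open>The P3 through two touched edges is apart from every edge that \<open>w\<close> does not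
  touch, and a vertex of \<open>W\<close> leaves at least \<open>k\<close> edges untouched.\<close>

lemma W_touch1:
  assumes w: "w \<in> W" and p: "p \<in> L" "q \<in> L" "touch w p" "touch w q"
  shows "p = q"
proof (rule ccontr)
  assume pq: "p \<noteq> q"
  obtain c c' where c: "c = fst p \<or> c = snd p" "c' = fst q \<or> c' = snd q" "P3 c w c'"
    using two_touched[OF p(1,2) pq p(3,4)] by metis
  define L' where "L' = {r\<in>L. \<not> touch w r}"
  have "card L' < k"
  proof (rule freeD[OF fr _ _ c(3)])
    show "finite L'" "imatch L'" using finL imatch_subset[OF im] unfolding L'_def by auto
    fix r assume r: "r \<in> L'"
    then have r': "r \<in> L" "\<not> touch w r" unfolding L'_def by auto
    then have "p \<noteq> r" "q \<noteq> r" using p by auto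
    then show "\<not> touch c r \<and> \<not> touch w r \<and> \<not> touch c' r"
      using sep[OF p(1) r'(1) _ c(1)] sep[OF p(2) r'(1) _ c(2)] r'(2) by blast
  qed
  then show False using W_un[OF w] unfolding L'_def by simp
qed

lemma card_touched: assumes "w \<in> W" shows "card {p\<in>L. touch w p} \<le> 1"
proof -
  have "\<forall>p\<in>{p\<in>L. touch w p}. \<forall>q\<in>{p\<in>L. touch w p}. p = q" using W_touch1[OF assms] by blast
  then show ?thesis using card_le_Suc0_iff_eq[of "{p\<in>L. touch w p}"] finL by simp
qed

text \<open>A P3 inside \<open>W\<close> would touch at most three edges of \<open>L\<close> and
  leave more than \<open>k\<close>.\<close>

lemma W_tr: assumes w: "x \<in> W" "y \<in> W" "z \<in> W" and xy: "x \<simeq> y" "y \<simeq> z" shows "x \<simeq> z"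
proof (rule ccontr)
  assume n: "\<not> x \<simeq> z"
  then have "x \<noteq> y" "y \<noteq> z" using xy by auto
  then have p3: "P3 x y z" using n xy unfolding P3_def by (simp add: tch_def)
  define T where "T w = {p\<in>L. touch w p}" for w
  have fT: "finite (T w)" for w using finL unfolding T_def by simp
  define L' where "L' = L - (T x \<union> T y \<union> T z)"
  have "card L' < k"
  proof (rule freeD[OF fr _ _ p3])
    show "finite L'" "imatch L'" using finL imatch_subset[OF im] unfolding L'_def by auto
  qed (auto simp: L'_def T_def)
  moreover have "card (T x \<union> T y \<union> T z) \<le> 3"
    using card_Un_le[of "T x \<union> T y" "T z"] card_Un_le[of "T x" "T y"]
      card_touched[OF w(1)] card_touched[OF w(2)] card_touched[OF w(3)] unfolding T_def by linarith
  moreover have "card L - card (T x \<union> T y \<union> T z) \<le> card L'" unfolding L'_def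
    by (rule diff_card_le_card_Diff) (simp add: fT)
  ultimately show False using bigL by linarith
qed

lemma leg_W: assumes p: "p \<in> L" "c = fst p \<or> c = snd p" shows "c \<in> W"
proof -
  have cV: "c \<in> V" using leg_nb[OF p(1)] p(2) nb_V nb_V2 by blast
  have "L - {p} \<subseteq> {q\<in>L. \<not> touch c q}" using sep[OF p(1) _ _ p(2)] by blast
  then have "card (L - {p}) \<le> card {q\<in>L. \<not> touch c q}" using finL by (intro card_mono) auto
  then have "k \<le> card {q\<in>L. \<not> touch c q}" using bigL p(1) by simp
  then show ?thesis using cV unfolding W_def F_def by simp
qed

lemma KK_W: "K \<in> KK \<Longrightarrow> u \<in> K \<Longrightarrow> u \<in> W" unfolding KK_def cls_def by auto
lemma KK_tch: "K \<in> KK \<Longrightarrow> u \<in> K \<Longrightarrow> w \<in> K \<Longrightarrow> u \<simeq> w"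
  unfolding KK_def cls_def using W_tr tch_sym by blast
lemma KK_closed: "K \<in> KK \<Longrightarrow> u \<in> K \<Longrightarrow> w \<in> W \<Longrightarrow> u \<simeq> w \<Longrightarrow> w \<in> K"
  unfolding KK_def cls_def using W_tr by blast
lemma KK_eq: assumes "K \<in> KK" "K' \<in> KK" "u \<in> K" "w \<in> K'" "u \<simeq> w" shows "K = K'"
proof -
  have *: "A \<subseteq> B" if AB: "A \<in> KK" "B \<in> KK" "a \<in> A" "b \<in> B" "a \<simeq> b" for A B a b
  proof
    fix x assume x: "x \<in> A"
    have "x \<simeq> a" by (rule KK_tch[OF AB(1) x AB(3)])
    then have "x \<simeq> b" by (rule W_tr[OF KK_W[OF AB(1) x] KK_W[OF AB(1,3)] KK_W[OF AB(2,4)] _ AB(5)])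
    then show "x \<in> B" using KK_closed[OF AB(2,4) KK_W[OF AB(1) x]] tch_sym by blast
  qed
  show ?thesis using *[OF assms] *[OF assms(2,1,4,3) tch_sym[OF assms(5)]] by blast
qed
lemma KK_ne: "K \<in> KK \<Longrightarrow> K \<noteq> {}" unfolding KK_def cls_def by auto
lemma cls_KK: "u \<in> W \<Longrightarrow> cls u \<in> KK \<and> u \<in> cls u" unfolding KK_def cls_def by auto
lemma finKK: "finite KK" unfolding KK_def using finW by simp
lemma fin_domd: "finite (domd R)" unfolding domd_def using finKK by simp
lemma domd_KK: "domd R \<subseteq> KK" unfolding domd_def by auto

lemma legK: assumes p: "p \<in> L" shows "legK p \<in> KK" "fst p \<in> legK p" "snd p \<in> legK p" "fst p \<noteq> snd p"
proof -
  show 1: "legK p \<in> KK" "fst p \<in> legK p" using cls_KK[OF leg_W[OF p]] unfolding legK_def by blast+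
  show "snd p \<in> legK p" by (rule KK_closed[OF 1 leg_W[OF p] nb_tch[OF leg_nb[OF p]]]) simp
  show "fst p \<noteq> snd p" using nb_neq[OF leg_nb[OF p]] .
qed

lemma legK_inj: "inj_on legK L"
proof (rule inj_onI, rule ccontr)
  fix p q assume pq: "p \<in> L" "q \<in> L" "legK p = legK q" "p \<noteq> q"
  have "fst p \<simeq> fst q" using KK_tch[OF legK(1)[OF pq(1)] legK(2)[OF pq(1)]] legK(2)[OF pq(2)] pq(3) by simp
  then show False using sep[OF pq(1,2,4)] touchI by blast
qed

lemma F_touch_big: assumes f: "f \<in> F" shows "card L < k + card {p\<in>L. touch f p}"
proof -
  have "card L = card {p\<in>L. touch f p} + card {p\<in>L. \<not> touch f p}"
    using finL by (subst card_Un_disjoint[symmetric]) (auto intro: arg_cong[where f=card])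
  then show ?thesis using f unfolding F_def by simp
qed

text \<open>From \<open>k\<close> such cliques take a matching that \<open>f\<close> avoids. As
  \<open>f\<close> touches more than \<open>card L - k\<close> edges of \<open>L\<close>, two of
  these lie in other cliques and give a P3 with middle \<open>f\<close> apart from that
  matching.\<close>

lemma miss2_lt: assumes f: "f \<in> F" shows "card (miss2 f) < k"
proof (rule ccontr)
  assume "\<not> ?thesis"
  then have "k \<le> card (miss2 f)" by simp
  then obtain B where B: "B \<subseteq> miss2 f" "card B = k" "finite B" by (rule obtain_subset_with_card_n)
  have "\<exists>c d. c \<in> K \<and> d \<in> K \<and> c \<noteq> d \<and> \<not> c \<sim> f \<and> \<not> d \<sim> f" if "K \<in> B" for K
    using that B(1) unfolding miss2_def by blast
  then obtain c d where cd: "\<And>K. K \<in> B \<Longrightarrow> c K \<in> K \<and> d K \<in> K \<and> c K \<noteq> d K \<and> \<not> c K \<sim> f \<and> \<not> d K \<sim> f"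
    by metis
  have BK: "K \<in> KK" if "K \<in> B" for K using that B(1) unfolding miss2_def by blast
  have "imatch ((\<lambda>K. (c K, d K)) ` B) \<and> card ((\<lambda>K. (c K, d K)) ` B) = card B"
  proof (rule imatchI)
    fix K assume K: "K \<in> B"
    then show "c K \<sim> d K" using KK_tch[OF BK[OF K], of "c K" "d K"] cd[OF K] unfolding tch_def by blast
  next
    fix K K' assume K: "K \<in> B" "K' \<in> B" "K \<noteq> K'"
    note eq = KK_eq[OF BK[OF K(1)] BK[OF K(2)]]
    show "\<not> c K \<simeq> c K'" "\<not> c K \<simeq> d K'" "\<not> d K \<simeq> d K'"
      using eq cd[OF K(1)] cd[OF K(2)] K(3) by blast+
  qed
  then have im': "imatch ((\<lambda>K. (c K, d K)) ` B)" and c': "card ((\<lambda>K. (c K, d K)) ` B) = k" using B(2) by auto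
  define T where "T = {p\<in>L. touch f p}"
  define T' where "T' = {p\<in>T. legK p \<in> B}"
  have "card T' \<le> card B"
    by (rule card_inj_on_le[OF inj_on_subset[OF legK_inj]]) (use B(3) in \<open>auto simp: T'_def T_def\<close>)
  moreover have "card T - card T' \<le> card (T - T')"
    by (rule diff_card_le_card_Diff) (use finL in \<open>auto simp: T'_def T_def\<close>)
  moreover have "card L < k + card T" using F_touch_big[OF f] unfolding T_def .
  ultimately have "2 \<le> card (T - T')" using bigL B(2) by linarith
  then obtain S where "S \<subseteq> T - T'" "card S = 2" by (rule obtain_subset_with_card_n) auto
  then obtain p q where pq: "p \<in> T - T'" "q \<in> T - T'" "p \<noteq> q" by (auto simp: card_2_iff)
  then have pq': "p \<in> L" "q \<in> L" "touch f p" "touch f q" "legK p \<notin> B" "legK q \<notin> B"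
    unfolding T_def T'_def by auto
  obtain x y where xy: "x = fst p \<or> x = snd p" "y = fst q \<or> y = snd q" "P3 x f y"
    using two_touched[OF pq'(1,2) pq(3) pq'(3,4)] by metis
  have xK: "x \<in> legK p" "y \<in> legK q" using xy(1,2) legK(2,3)[OF pq'(1)] legK(2,3)[OF pq'(2)] by blast+
  have "card ((\<lambda>K. (c K, d K)) ` B) < k"
  proof (rule freeD[OF fr _ im' xy(3)])
    show "finite ((\<lambda>K. (c K, d K)) ` B)" using B(3) by simp
    fix r assume "r \<in> (\<lambda>K. (c K, d K)) ` B"
    then obtain K where K: "K \<in> B" "r = (c K, d K)" by blast
    have a: "\<not> u \<simeq> e" if "u \<in> legK s" "s \<in> L" "legK s \<notin> B" "e \<in> K" for u s e
      using KK_eq[OF legK(1)[OF that(2)] BK[OF K(1)] that(1,4)] K(1) that(3) by blast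
    have "f \<noteq> e" if "e \<in> K" for e using KK_W[OF BK[OF K(1)] that] f W_F by blast
    then have "\<not> touch f r" using cd[OF K(1)] K(2) unfolding touch_def tch_def by (simp add: nb_comm)
    moreover have "\<not> touch x r" "\<not> touch y r"
      using a[OF xK(1) pq'(1,5)] a[OF xK(2) pq'(2,6)] cd[OF K(1)] K(2) unfolding touch_def by auto
    ultimately show "\<not> touch x r \<and> \<not> touch f r \<and> \<not> touch y r" by blast
  qed
  then show False using c' by simp
qed

lemma two_legs: obtains p q where "p \<in> L" "q \<in> L" "p \<noteq> q"
proof -
  have "2 \<le> card L" using bigL by simp
  then obtain S where "S \<subseteq> L" "card S = 2" by (rule obtain_subset_with_card_n) auto
  then show ?thesis using that by (auto simp: card_2_iff)
qed

text \<open>No clique is the whole graph, because the edges of \<open>L\<close> lie in different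
  cliques. An edge leaving \<open>K\<close> cannot end in \<open>W\<close>, where \<open>K\<close>
  is closed under adjacency.\<close>

lemma F_nb: assumes K: "K \<in> KK" shows "\<exists>u\<in>K. \<exists>f\<in>F. u \<sim> f"
proof -
  obtain p q where pq: "p \<in> L" "q \<in> L" "p \<noteq> q" by (rule two_legs)
  have KV: "K \<subseteq> V" using KK_W[OF K] W_V by blast
  have "K \<noteq> V"
  proof
    assume "K = V"
    then have "fst p \<in> K" "fst q \<in> K" using leg_W[OF pq(1)] leg_W[OF pq(2)] W_V by auto
    then have "K = legK p" "K = legK q"
      using KK_eq[OF K legK(1)[OF pq(1)] _ legK(2)[OF pq(1)]] KK_eq[OF K legK(1)[OF pq(2)] _ legK(2)[OF pq(2)]] by auto
    then show False using legK_inj pq unfolding inj_on_def by blast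
  qed
  then obtain u w where uw: "u \<in> K" "w \<in> V - K" "u \<sim> w" using conn[of K] KV KK_ne[OF K] by blast
  have "w \<notin> W" using KK_closed[OF K uw(1) _ nb_tch[OF uw(3)]] uw(2) by blast
  then show ?thesis using uw unfolding W_def by blast
qed

section \<open>Trading transversal vertices for vertices of \<open>F\<close>\<close>

definition transv :: "('a set \<Rightarrow> 'a) \<Rightarrow> bool" where
  "transv t \<longleftrightarrow> (\<forall>K\<in>KK. t K \<in> K \<and> (\<exists>f\<in>F. t K \<sim> f))"

text \<open>\<open>C\<close> is the set of cliques handed over to \<open>R\<close>. Since each
  vertex of \<open>F\<close> sees two remaining transversal vertices, \<open>F\<close> is dominated,
  every transversal vertex finds a companion through its neighbour in \<open>F\<close>, and each
  element of \<open>R\<close> is the middle of a triple.\<close>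

lemma transv_STD:
  assumes t: "transv t" and R: "R \<subseteq> F" and C: "C \<subseteq> domd R"
    and two': "\<forall>f\<in>F. \<exists>a\<in>t ` (KK - C). \<exists>b\<in>t ` (KK - C). a \<noteq> b \<and> f \<sim> a \<and> f \<sim> b"
  shows "STD (R \<union> t ` (KK - C))" "R \<noteq> {} \<Longrightarrow> triple (R \<union> t ` (KK - C))"
    "card (R \<union> t ` (KK - C)) \<le> card R + (card KK - card C)"
proof -
  let ?D = "R \<union> t ` (KK - C)"
  note two = bspec[OF two']
  have tK: "t K \<in> K" "t K \<in> W" "\<exists>f\<in>F. t K \<sim> f" if "K \<in> KK" for K
    using t that KK_W unfolding transv_def by blast+
  show "STD ?D"
  proof (rule STDI)
    show "?D \<subseteq> V" using R F_V tK(2) W_V by blast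
    fix x assume x: "x \<in> V"
    show "\<exists>y\<in>?D. x \<simeq> y"
    proof (cases "x \<in> F")
      case True then show ?thesis using two[OF True] nb_tch by blast
    next
      case False
      then have xK: "cls x \<in> KK" "x \<in> cls x" using x cls_KK unfolding W_def by auto
      show ?thesis
      proof (cases "cls x \<in> C")
        case True
        then have "\<exists>f\<in>R. x \<sim> f" using C xK unfolding domd_def by blast
        then show ?thesis using nb_tch by blast
      next
        case False
        have "x \<simeq> t (cls x)" by (rule KK_tch[OF xK tK(1)[OF xK(1)]])
        then show ?thesis using xK(1) False by blast
      qed
    qed
  next
    fix x assume "x \<in> ?D"
    then consider "x \<in> R" | K where "K \<in> KK - C" "x = t K" by blast
    then show "\<exists>y\<in>?D. near x y"
    proof cases
      case 1 then show ?thesis using two[of x] R nearI1 by blast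
    next
      case 2
      then obtain f where f: "f \<in> F" "x \<sim> f" using tK(3)[of K] by blast
      obtain b where b: "b \<in> t ` (KK - C)" "b \<noteq> x" "f \<sim> b" using two[OF f(1)] by metis
      have "near x b" using nearI2[OF f(2) b(3)] b(2) by blast
      then show ?thesis using b(1) by blast
    qed
  qed
  show "triple ?D" if Rne: "R \<noteq> {}"
  proof -
    obtain f where f: "f \<in> R" using Rne by blast
    obtain a b where ab: "a \<in> t ` (KK - C)" "b \<in> t ` (KK - C)" "a \<noteq> b" "f \<sim> a" "f \<sim> b"
      using two[of f] f R by blast
    have "a \<in> ?D" "f \<in> ?D" "b \<in> ?D" using ab f by auto
    then show ?thesis by (rule tripleI) (use ab nb_sym nearI1 in auto)
  qed
  have "card (t ` (KK - C)) \<le> card (KK - C)" using finKK by (intro card_image_le) auto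
  also have "\<dots> = card KK - card C"
    using finite_subset[OF C fin_domd] C domd_KK by (intro card_Diff_subset) auto
  finally show "card ?D \<le> card R + (card KK - card C)" using card_Un_le[of R "t ` (KK - C)"] by linarith
qed

text \<open>Two vertices of \<open>F\<close> that jointly dominate few cliques miss the same single vertex in almost all cliques, so
  a transversal chosen inside the neighbourhood of one \<open>f0\<close> is adjacent almost everywhere to all of \<open>F\<close>.\<close>

lemma transv_exists:
  assumes pair: "\<forall>f\<in>F. \<forall>f'\<in>F. card (domd {f,f'}) \<le> e"
  shows "\<exists>t. transv t \<and> (\<forall>C. finite C \<longrightarrow> card C + 2*k + e + 2 \<le> card L \<longrightarrow>
     (\<forall>f\<in>F. \<exists>a\<in>t ` (KK - C). \<exists>b\<in>t ` (KK - C). a \<noteq> b \<and> f \<sim> a \<and> f \<sim> b))"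
proof -
  obtain p0 q0 where "p0 \<in> L" "q0 \<in> L" "p0 \<noteq> q0" by (rule two_legs)
  then obtain f0 where f0: "f0 \<in> F" using F_nb[OF legK(1)] by blast
  have "\<exists>u. u \<in> K \<and> (\<exists>f\<in>F. u \<sim> f) \<and> ((\<exists>w\<in>K. w \<sim> f0) \<longrightarrow> u \<sim> f0)" if "K \<in> KK" for K
    using F_nb[OF that] f0 by blast
  then obtain t where t: "\<And>K. K \<in> KK \<Longrightarrow> t K \<in> K \<and> (\<exists>f\<in>F. t K \<sim> f) \<and> ((\<exists>w\<in>K. w \<sim> f0) \<longrightarrow> t K \<sim> f0)"
    by metis
  have tr: "transv t" using t unfolding transv_def by blast
  have "\<exists>a\<in>t ` (KK - C). \<exists>b\<in>t ` (KK - C). a \<noteq> b \<and> f \<sim> a \<and> f \<sim> b"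
    if C: "finite C" "card C + 2*k + e + 2 \<le> card L" and f: "f \<in> F" for C f
  proof -
    \<comment> \<open>Outside \<open>Z\<close> some vertex of the clique is missed by both
      \<open>f\<close> and \<open>f0\<close>, and each of them misses at most one, so they miss the
      same vertex. The two \<open>miss2\<close> sets cost at most \<open>2*k\<close> cliques, the
      pair at most \<open>e\<close>, and two legs must remain: this is the bound required of
      \<open>card L\<close>.\<close>
    define Z where "Z = C \<union> miss2 f \<union> miss2 f0 \<union> domd {f,f0}"
    have "card Z \<le> card C + card (miss2 f) + card (miss2 f0) + card (domd {f,f0})"
      unfolding Z_def by (meson add_le_mono1 card_Un_le le_trans)
    then have cZ: "card Z + 2 \<le> card L"
      using C(2) miss2_lt[OF f] miss2_lt[OF f0] bspec[OF bspec[OF pair f] f0] by linarith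
    have finZ: "finite Z" unfolding Z_def miss2_def using C(1) finKK fin_domd by auto
    define T where "T = {p\<in>L. legK p \<in> Z}"
    have "card T \<le> card Z"
      by (rule card_inj_on_le[OF inj_on_subset[OF legK_inj]]) (use finZ in \<open>auto simp: T_def\<close>)
    moreover have "card L - card T \<le> card (L - T)"
      by (rule diff_card_le_card_Diff) (use finL in \<open>auto simp: T_def\<close>)
    ultimately have "2 \<le> card (L - T)" using cZ by linarith
    then obtain S where "S \<subseteq> L - T" "card S = 2" by (rule obtain_subset_with_card_n) auto
    then obtain p q where pq: "p \<in> L - T" "q \<in> L - T" "p \<noteq> q" by (auto simp: card_2_iff)
    have adj: "f \<sim> t (legK r) \<and> legK r \<in> KK - C" if r: "r \<in> L - T" for r
    proof -
      have rL: "r \<in> L" and rZ: "legK r \<notin> Z" using r unfolding T_def by auto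
      note K = legK[OF rL]
      have "legK r \<notin> domd {f,f0}" using rZ unfolding Z_def by blast
      then obtain z where z: "z \<in> legK r" "\<not> z \<sim> f" "\<not> z \<sim> f0" using K(1) unfolding domd_def by blast
      have m: "c \<sim> f" "c \<sim> f0" if "c \<in> legK r" "c \<noteq> z" for c
        using rZ K(1) z that unfolding Z_def miss2_def by blast+
      obtain c where "c \<in> legK r" "c \<noteq> z" using K(2-4) by blast
      then have "t (legK r) \<sim> f0" using t[OF K(1)] m(2) by blast
      then have "t (legK r) \<noteq> z" using z(3) by blast
      then have "t (legK r) \<sim> f" using m(1) t[OF K(1)] by blast
      then show ?thesis using nb_sym rZ K(1) unfolding Z_def by blast
    qed
    have "t (legK p) \<noteq> t (legK q)"
    proof
      assume e: "t (legK p) = t (legK q)"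
      have pL: "p \<in> L" "q \<in> L" using pq by auto
      have "t (legK p) \<in> legK p" "t (legK q) \<in> legK q" using t[OF legK(1)[OF pL(1)]] t[OF legK(1)[OF pL(2)]] by auto
      then have "legK p = legK q"
        using KK_eq[OF legK(1)[OF pL(1)] legK(1)[OF pL(2)]] e tch_refl by metis
      then show False using legK_inj pq unfolding inj_on_def by blast
    qed
    then show ?thesis using adj[OF pq(1)] adj[OF pq(2)] by blast
  qed
  then show ?thesis using tr by blast
qed

text \<open>\<open>transv_exists\<close> presupposes such a bound, so an exchange not relying on it
  comes first. Both ends of \<open>k\<close> edges of \<open>L\<close> serve in place of a careful
  transversal: every vertex of \<open>F\<close> touches one of these edges. Together with the pair
  this costs \<open>2*k+2\<close> vertices and saves one for each clique the pair dominates.\<close>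

lemma pair_bound:
  assumes rg: "rigid g" and g: "card KK \<le> g" and f: "f \<in> F" "f' \<in> F"
  shows "card (domd {f,f'}) \<le> 2*k+2"
proof (rule ccontr)
  assume n: "\<not> ?thesis"
  have "k \<le> card L" using bigL by simp
  then obtain Lk where Lk: "Lk \<subseteq> L" "card Lk = k" "finite Lk" by (rule obtain_subset_with_card_n)
  have "\<exists>u. u \<in> K \<and> (\<exists>f\<in>F. u \<sim> f)" if "K \<in> KK" for K using F_nb[OF that] by blast
  then obtain t where t: "\<And>K. K \<in> KK \<Longrightarrow> t K \<in> K \<and> (\<exists>f\<in>F. t K \<sim> f)" by metis
  define D where "D = {f,f'} \<union> (fst ` Lk \<union> snd ` Lk) \<union> t ` (KK - domd {f,f'})"
  have ends: "c \<in> D" if "p \<in> Lk" "c = fst p \<or> c = snd p" for p c using that unfolding D_def by blast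
  have Ft: "\<exists>p\<in>Lk. touch h p" if h: "h \<in> F" for h
  proof (rule ccontr)
    assume "\<not> ?thesis"
    then have "Lk \<subseteq> {p\<in>L. \<not> touch h p}" using Lk(1) by blast
    then have "card Lk \<le> card {p\<in>L. \<not> touch h p}" using finL by (intro card_mono) auto
    then show False using h Lk(2) unfolding F_def by simp
  qed
  have Fn: "\<exists>c\<in>D. h \<sim> c \<and> (\<exists>p\<in>Lk. c = fst p \<or> c = snd p)" if h: "h \<in> F" for h
  proof -
    obtain p where p: "p \<in> Lk" "touch h p" using Ft[OF h] by blast
    obtain c where c: "c = fst p \<or> c = snd p" "h \<simeq> c" using touchE[OF p(2)] by blast
    have "c \<in> W" using leg_W c(1) p(1) Lk(1) by blast
    then have "h \<sim> c" using c(2) W_F[OF _ h] unfolding tch_def by blast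
    then show ?thesis using ends[OF p(1) c(1)] p(1) c(1) by blast
  qed
  have partner: "\<exists>d\<in>D. near c d" if p: "p \<in> Lk" "c = fst p \<or> c = snd p" for p c
  proof -
    have "fst p \<sim> snd p" using leg_nb p(1) Lk(1) by blast
    then show ?thesis using p ends[OF p(1)] nearI1 nb_sym by blast
  qed
  have "STD D"
  proof (rule STDI)
    have "fst ` Lk \<union> snd ` Lk \<subseteq> V" using leg_W W_V Lk(1) by blast
    moreover have "t ` KK \<subseteq> V" using t KK_W W_V by blast
    ultimately show "D \<subseteq> V" unfolding D_def using f F_V by blast
    fix x assume x: "x \<in> V"
    show "\<exists>y\<in>D. x \<simeq> y"
    proof (cases "x \<in> F")
      case True then show ?thesis using Fn[OF True] nb_tch by blast
    next
      case False
      then have xK: "cls x \<in> KK" "x \<in> cls x" using x cls_KK unfolding W_def by auto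
      show ?thesis
      proof (cases "cls x \<in> domd {f,f'}")
        case True
        then have "x \<sim> f \<or> x \<sim> f'" using xK unfolding domd_def by blast
        then show ?thesis using nb_tch unfolding D_def by blast
      next
        case False
        have "x \<simeq> t (cls x)" using KK_tch[OF xK] t[OF xK(1)] by blast
        then show ?thesis using xK(1) False unfolding D_def by blast
      qed
    qed
  next
    fix x assume "x \<in> D"
    then consider "x \<in> F" | p where "p \<in> Lk" "x = fst p \<or> x = snd p" | K where "K \<in> KK" "x = t K"
      using f unfolding D_def by blast
    then show "\<exists>y\<in>D. near x y"
    proof cases
      case 1 then show ?thesis using Fn[OF 1] nearI1 by blast
    next
      case 2 then show ?thesis by (rule partner)
    next
      case 3
      then obtain h where h: "h \<in> F" "x \<sim> h" using t by blast
      obtain c p where c: "c \<in> D" "h \<sim> c" "p \<in> Lk" "c = fst p \<or> c = snd p" using Fn[OF h(1)] by blast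
      show ?thesis
      proof (cases "x = c")
        case True then show ?thesis using partner[OF c(3,4)] by simp
      next
        case False then show ?thesis using nearI2[OF h(2) c(2)] c(1) by blast
      qed
    qed
  qed
  have "card D \<le> card {f,f'} + card (fst ` Lk \<union> snd ` Lk) + card (t ` (KK - domd {f,f'}))"
    unfolding D_def by (meson add_le_mono1 card_Un_le le_trans)
  moreover have "card {f,f'} \<le> 2" by (simp add: card_insert_if)
  moreover have "card (fst ` Lk \<union> snd ` Lk) \<le> 2*k"
    using card_Un_le[of "fst ` Lk" "snd ` Lk"] card_image_le[OF Lk(3), of fst] card_image_le[OF Lk(3), of snd] Lk(2) by linarith
  moreover have "card (t ` (KK - domd {f,f'})) \<le> card (KK - domd {f,f'})"
    using finKK by (intro card_image_le) auto
  moreover have "card (KK - domd {f,f'}) = card KK - card (domd {f,f'})"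
    by (rule card_Diff_subset[OF fin_domd domd_KK])
  moreover have "card (domd {f,f'}) \<le> card KK" by (rule card_mono[OF finKK domd_KK])
  ultimately have "card D < card KK" using n by linarith
  then show False using rigidD(2)[OF rg \<open>STD D\<close>] g by simp
qed

text \<open>If \<open>R\<close> dominates at least \<open>card R\<close> cliques, putting
  \<open>R\<close> in place of the transversal vertices of exactly \<open>card R\<close> of them
  does not enlarge the set, but creates a triple.\<close>

lemma rigid_good:
  assumes rg: "rigid g" and g: "card KK \<le> g"
  shows good
  unfolding good_def
proof (intro allI impI, elim conjE, rule ccontr)
  fix R assume R: "R \<subseteq> F" "R \<noteq> {}" "card R \<le> 5*k+2" and n: "\<not> card (domd R) < card R"
  then have "card R \<le> card (domd R)" by simp
  then obtain C where C: "C \<subseteq> domd R" "card C = card R" "finite C" by (rule obtain_subset_with_card_n)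
  have "\<forall>f\<in>F. \<forall>f'\<in>F. card (domd {f,f'}) \<le> 2*k+2" using pair_bound[OF rg g] by simp
  from transv_exists[OF this] obtain t where t: "transv t"
    "\<forall>C. finite C \<longrightarrow> card C + 2*k + (2*k+2) + 2 \<le> card L \<longrightarrow>
     (\<forall>f\<in>F. \<exists>a\<in>t ` (KK - C). \<exists>b\<in>t ` (KK - C). a \<noteq> b \<and> f \<sim> a \<and> f \<sim> b)"
    by (elim exE conjE)
  have "card C + 2*k + (2*k+2) + 2 \<le> card L" using C(2) R(3) bigL by linarith
  note S = transv_STD[OF t(1) R(1) C(1) t(2)[THEN spec, THEN mp, THEN mp, OF C(3) this]]
  have "card C \<le> card KK" using C(1) domd_KK finKK by (meson card_mono subset_trans)
  then have "card (R \<union> t ` (KK - C)) \<le> g" using S(3) C(2) g by linarith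
  then show False using rigidD(1)[OF rg S(1)] S(2)[OF R(2)] by blast
qed

text \<open>This is why testing sets of bounded size suffices.  A clique dominated by \<open>R\<close> is either missed twice by every element of \<open>R\<close>, or
  dominated by two elements of \<open>R\<close>; among many cliques of the second kind, some two are dominated
  by one common pair.\<close>

lemma good_domd_le:
  assumes gd: good and R: "R \<subseteq> F"
  shows "card (domd R) \<le> 5*k+1"
proof (cases "R = {}")
  case True
  then have "domd R = {}" using KK_ne unfolding domd_def by blast
  then show ?thesis by simp
next
  case False
  then obtain h where h: "h \<in> R" by blast
  define N where "N = {K\<in>domd R. \<exists>f\<in>R. \<exists>g\<in>R. K \<in> domd {f,g}}"
  have "domd R - N \<subseteq> miss2 h"
  proof
    fix K assume K: "K \<in> domd R - N"
    then have KK: "K \<in> KK" and Kd: "\<And>u. u \<in> K \<Longrightarrow> \<exists>f\<in>R. u \<sim> f" unfolding domd_def by auto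
    have no: "\<exists>u\<in>K. \<not> u \<sim> h \<and> \<not> u \<sim> f" if "f \<in> R" for f
      using K h that KK unfolding N_def domd_def by blast
    obtain u where u: "u \<in> K" "\<not> u \<sim> h" using no[OF h] by blast
    obtain f where f: "f \<in> R" "u \<sim> f" using Kd[OF u(1)] by blast
    obtain w where w: "w \<in> K" "\<not> w \<sim> h" "\<not> w \<sim> f" using no[OF f(1)] by blast
    have "u \<noteq> w" using f w by blast
    then show "K \<in> miss2 h" using KK u w unfolding miss2_def by blast
  qed
  then have 1: "card (domd R - N) < k"
    using card_mono[of "miss2 h" "domd R - N"] finKK miss2_lt[of h] h R unfolding miss2_def by fastforce
  have finN: "finite N" unfolding N_def using fin_domd by simp
  have "\<exists>f g. f \<in> R \<and> g \<in> R \<and> K \<in> domd {f,g}" if "K \<in> N" for K using that unfolding N_def by blast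
  then obtain f g where fg: "\<And>K. K \<in> N \<Longrightarrow> f K \<in> R \<and> g K \<in> R \<and> K \<in> domd {f K, g K}" by metis
  have NK: "K \<in> KK" if "K \<in> N" for K using that unfolding N_def domd_def by blast
  \<comment> \<open>\<open>A\<close> relates \<open>K\<close> to the at most \<open>2*k\<close>
    cliques missed twice by an element of the pair chosen for \<open>K\<close>. By
    \<open>conf\<close> any two members of \<open>N\<close> are related in some direction, so the
    square of \<open>card N\<close> is at most \<open>card N * (4*k+1)\<close>.\<close>
  define A where "A = (SIGMA K:N. miss2 (f K) \<union> miss2 (g K))"
  have conf: "(K,K') \<in> A \<or> (K',K) \<in> A" if K: "K \<in> N" "K' \<in> N" "K \<noteq> K'" for K K'
  proof (rule ccontr)
    assume na: "\<not> ?thesis"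
    define ff where "ff = {f K, g K}"
    define ff' where "ff' = {f K', g K'}"
    have one: "u = w" if "h \<in> ff" "u \<in> K'" "w \<in> K'" "\<not> u \<sim> h" "\<not> w \<sim> h" for h u w
      using na K that NK[OF K(2)] unfolding A_def ff_def miss2_def by blast
    have one': "u = w" if "h \<in> ff'" "u \<in> K" "w \<in> K" "\<not> u \<sim> h" "\<not> w \<sim> h" for h u w
      using na K that NK[OF K(1)] unfolding A_def ff'_def miss2_def by blast
    have d: "\<exists>h\<in>ff. u \<sim> h" if "u \<in> K" for u using fg[OF K(1)] that unfolding ff_def domd_def by blast
    have d': "\<exists>h\<in>ff'. u \<sim> h" if "u \<in> K'" for u using fg[OF K(2)] that unfolding ff'_def domd_def by blast
    have R2: "ff \<subseteq> R" "ff' \<subseteq> R" using fg[OF K(1)] fg[OF K(2)] unfolding ff_def ff'_def by auto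
    have pair: False if "K \<in> domd {e,e'}" "K' \<in> domd {e,e'}" "e \<in> R" "e' \<in> R" for e e'
    proof -
      have c2: "card {e,e'} \<le> 2" by (simp add: card_insert_if)
      have "{e,e'} \<subseteq> F" "card {e,e'} \<le> 5*k+2" using that R c2 by auto
      then have "card (domd {e,e'}) < card {e,e'}" using gd unfolding good_def by blast
      moreover have "card {K,K'} \<le> card (domd {e,e'})" using that by (intro card_mono[OF fin_domd]) auto
      ultimately show False using K(3) c2 by simp
    qed
    have "K \<notin> domd ff'"
      using pair[of "f K'" "g K'"] fg[OF K(2)] unfolding ff'_def by blast
    then obtain u where u: "u \<in> K" "\<And>h. h \<in> ff' \<Longrightarrow> \<not> u \<sim> h" using NK[OF K(1)] unfolding domd_def by blast
    have "K' \<notin> domd ff"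
      using pair[of "f K" "g K"] fg[OF K(1)] unfolding ff_def by blast
    then obtain u' where u': "u' \<in> K'" "\<And>h. h \<in> ff \<Longrightarrow> \<not> u' \<sim> h" using NK[OF K(2)] unfolding domd_def by blast
    obtain e where e: "e \<in> ff" "u \<sim> e" using d[OF u(1)] by blast
    obtain e' where e': "e' \<in> ff'" "u' \<sim> e'" using d'[OF u'(1)] by blast
    \<comment> \<open>\<open>e'\<close> comes from the pair of \<open>K'\<close> and misses no
      vertex of \<open>K\<close> except \<open>u\<close>, which \<open>e\<close> sees. By symmetry
      \<open>e\<close> misses only \<open>u'\<close> in \<open>K'\<close>; so the mixed pair
      dominates both cliques, against \<open>good\<close>.\<close>
    have "x \<sim> e \<or> x \<sim> e'" if "x \<in> K" for x
      using one'[OF e'(1) that u(1) _ u(2)[OF e'(1)]] e(2) by blast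
    then have "K \<in> domd {e,e'}" using NK[OF K(1)] unfolding domd_def by blast
    moreover have "x \<sim> e \<or> x \<sim> e'" if "x \<in> K'" for x
      using one[OF e(1) that u'(1) _ u'(2)[OF e(1)]] e'(2) by blast
    then have "K' \<in> domd {e,e'}" using NK[OF K(2)] unfolding domd_def by blast
    ultimately show False using pair e(1) e'(1) R2 by blast
  qed
  have finA: "finite A" unfolding A_def miss2_def using finN finKK by auto
  have "card A = (\<Sum>K\<in>N. card (miss2 (f K) \<union> miss2 (g K)))"
    unfolding A_def miss2_def using finN finKK by (intro card_SigmaI) auto
  also have "\<dots> \<le> (\<Sum>K\<in>N. 2*k)"
  proof (rule sum_mono)
    fix K assume K: "K \<in> N"
    have "f K \<in> F" "g K \<in> F" using fg[OF K] R by auto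
    then show "card (miss2 (f K) \<union> miss2 (g K)) \<le> 2*k"
      using card_Un_le[of "miss2 (f K)" "miss2 (g K)"] miss2_lt[of "f K"] miss2_lt[of "g K"] by linarith
  qed
  finally have cA: "card A \<le> card N * (2*k)" by simp
  have "N \<times> N \<subseteq> A \<union> prod.swap ` A \<union> (\<lambda>K. (K,K)) ` N"
  proof
    fix x assume "x \<in> N \<times> N"
    then obtain K K' where x: "x = (K,K')" "K \<in> N" "K' \<in> N" by blast
    show "x \<in> A \<union> prod.swap ` A \<union> (\<lambda>K. (K,K)) ` N"
    proof (cases "K = K'")
      case True then show ?thesis using x by blast
    next
      case False
      show ?thesis
      proof (cases "(K,K') \<in> A")
        case True then show ?thesis using x(1) by blast
      next
        case nA: False
        then have "(K',K) \<in> A" using conf[OF x(2,3) False] by blast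
        then have "prod.swap (K',K) \<in> prod.swap ` A" by (rule imageI)
        then show ?thesis using x(1) by simp
      qed
    qed
  qed
  then have "card (N \<times> N) \<le> card (A \<union> prod.swap ` A \<union> (\<lambda>K. (K,K)) ` N)"
    using finA finN by (intro card_mono) auto
  also have "\<dots> \<le> card A + card (prod.swap ` A) + card ((\<lambda>K. (K,K)) ` N)"
    by (meson add_le_mono1 card_Un_le le_trans)
  also have "\<dots> \<le> card A + card A + card N"
    using card_image_le[OF finA, of prod.swap] card_image_le[OF finN, of "\<lambda>K. (K,K)"] by linarith
  finally have "card N * card N \<le> card N * (4*k+1)" using cA by (simp add: card_cartesian_product algebra_simps)
  then have "card N \<le> 4*k+1" by (metis mult_le_cancel1 not_gr_zero zero_le)
  moreover have "card (domd R) = card N + card (domd R - N)"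
    using fin_domd finN card_Un_disjoint[of N "domd R - N"] by (simp add: N_def Un_absorb1)
  ultimately show ?thesis using 1 by linarith
qed

text \<open>Sets beyond the tested size have more elements than the \<open>5*k+1\<close> cliques
  they can dominate.\<close>

lemma good_domd:
  assumes gd: good and R: "R \<subseteq> F" "R \<noteq> {}"
  shows "card (domd R) < card R"
  using gd R good_domd_le[OF gd R(1)] unfolding good_def by (cases "card R \<le> 5*k+2") auto

section \<open>The lower bound given by the cliques\<close>

lemma STD_hits:
  assumes D: "STD D" and K: "K \<in> KK" "K \<notin> domd (D \<inter> F)"
  shows "\<exists>x. x \<in> D \<and> x \<in> K"
proof -
  obtain u where u: "u \<in> K" "\<And>f. f \<in> D \<inter> F \<Longrightarrow> \<not> u \<sim> f" using K unfolding domd_def by blast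
  have uW: "u \<in> W" by (rule KK_W[OF K(1) u(1)])
  obtain d where d: "d \<in> D" "u \<simeq> d" using D W_V[OF uW] unfolding STD_def by blast
  have "d \<notin> F" using u(2)[of d] d W_F[OF uW] unfolding tch_def by blast
  then have "d \<in> W" using d(1) STD_V[OF D] unfolding W_def by blast
  then show ?thesis using KK_closed[OF K(1) u(1) _ d(2)] d(1) by blast
qed

text \<open>A clique not dominated by \<open>D \<inter> F\<close> must contain an element of
  \<open>D\<close>, and the cliques are disjoint. The inequality is written additively to avoid
  truncated subtraction.\<close>

lemma STD_card:
  assumes D: "STD D"
  shows "\<exists>sel. inj_on sel (KK - domd (D \<inter> F)) \<and> sel ` (KK - domd (D \<inter> F)) \<subseteq> D \<inter> W \<and>
     (\<forall>K\<in>KK - domd (D \<inter> F). sel K \<in> K)"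
    "card KK + card (D \<inter> F) \<le> card D + card (domd (D \<inter> F))"
proof -
  let ?C = "KK - domd (D \<inter> F)"
  have "\<exists>x. x \<in> D \<and> x \<in> K" if "K \<in> ?C" for K using STD_hits[OF D] that by blast
  then obtain sel where sel: "\<And>K. K \<in> ?C \<Longrightarrow> sel K \<in> D \<and> sel K \<in> K" by metis
  have inj: "inj_on sel ?C"
  proof (rule inj_onI)
    fix K K' assume KK': "K \<in> ?C" "K' \<in> ?C" "sel K = sel K'"
    have "K \<in> KK" "K' \<in> KK" "sel K \<in> K" "sel K \<in> K'" using KK' sel[OF KK'(1)] sel[OF KK'(2)] by auto
    then show "K = K'" using KK_eq[of K K' "sel K" "sel K"] by simp
  qed
  have sub: "sel ` ?C \<subseteq> D \<inter> W" using sel KK_W by blast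
  show "\<exists>sel. inj_on sel ?C \<and> sel ` ?C \<subseteq> D \<inter> W \<and> (\<forall>K\<in>?C. sel K \<in> K)"
    using inj sub sel by blast
  have finD: "finite D" by (rule STD_fin[OF D])
  have "card ?C \<le> card (D \<inter> W)" by (rule card_inj_on_le[OF inj sub]) (simp add: finD)
  moreover have "card ?C = card KK - card (domd (D \<inter> F))" by (rule card_Diff_subset[OF fin_domd domd_KK])
  moreover have "card D = card (D \<inter> F) + card (D \<inter> W)"
  proof -
    have "D = (D \<inter> F) \<union> (D \<inter> W)" using STD_V[OF D] unfolding W_def by blast
    then show ?thesis using card_Un_disjoint[of "D \<inter> F" "D \<inter> W"] finD unfolding W_def by auto
  qed
  ultimately show "card KK + card (D \<inter> F) \<le> card D + card (domd (D \<inter> F))" by linarith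
qed

text \<open>By \<open>STD_card\<close> and \<open>good_domd\<close> a set meeting \<open>F\<close>
  has more than \<open>card KK\<close> elements. One avoiding \<open>F\<close> has an element in
  each clique, so if it is of size \<open>card KK\<close> it is a transversal, and no edge joins
  different cliques. As \<open>good\<close> lets a pair dominate at most one clique,
  \<open>transv_exists\<close> applies with \<open>e = 1\<close> and shows that the bound is
  attained.\<close>

lemma good_rigid:
  assumes gd: good
  shows "rigid (card KK)" "\<exists>D. STD D \<and> card D \<le> card KK"
proof -
  have e: "domd {} = {}" using KK_ne unfolding domd_def by blast
  have inF: "card KK < card D" if D: "STD D" "D \<inter> F \<noteq> {}" for D
    using STD_card(2)[OF D(1)] good_domd[OF gd _ D(2)] by auto
  have outF: "card KK \<le> card D" if D: "STD D" "D \<inter> F = {}" for D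
    using STD_card(2)[OF D(1)] D(2) e by simp
  have nt: "\<not> triple D" if D: "STD D" "card D \<le> card KK" for D
  proof
    assume "triple D"
    then obtain a b where ab: "a \<in> D" "b \<in> D" "a \<sim> b" unfolding triple_def by blast
    have DF: "D \<inter> F = {}" using inF[OF D(1)] D(2) by linarith
    obtain sel where sel: "inj_on sel KK" "sel ` KK \<subseteq> D \<inter> W" "\<And>K. K \<in> KK \<Longrightarrow> sel K \<in> K"
      using STD_card(1)[OF D(1)] unfolding DF e by auto
    have "sel ` KK = D"
    proof (rule card_seteq[OF STD_fin[OF D(1)]])
      show "sel ` KK \<subseteq> D" using sel(2) by blast
      show "card D \<le> card (sel ` KK)" using card_image[OF sel(1)] D(2) by simp
    qed
    then obtain K K' where K: "K \<in> KK" "a = sel K" "K' \<in> KK" "b = sel K'" using ab by blast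
    have "a \<in> K" "b \<in> K'" using sel(3) K by auto
    then have "K = K'" using KK_eq[OF K(1,3)] nb_tch[OF ab(3)] by blast
    then show False using K ab(3) nb_irrefl by blast
  qed
  show "rigid (card KK)" unfolding rigid_def
    using nt inF outF by (metis less_imp_le)
  have pair: "card (domd {f,f'}) \<le> 1" if "f \<in> F" "f' \<in> F" for f f'
  proof -
    have "card {f,f'} \<le> 2" by (simp add: card_insert_if)
    moreover have "card (domd {f,f'}) < card {f,f'}" by (rule good_domd[OF gd]) (use that in auto)
    ultimately show ?thesis by linarith
  qed
  then have "\<forall>f\<in>F. \<forall>f'\<in>F. card (domd {f,f'}) \<le> 1" by simp
  from transv_exists[OF this] obtain t where t: "transv t"
    "\<forall>C. finite C \<longrightarrow> card C + 2*k + 1 + 2 \<le> card L \<longrightarrow>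
     (\<forall>f\<in>F. \<exists>a\<in>t ` (KK - C). \<exists>b\<in>t ` (KK - C). a \<noteq> b \<and> f \<sim> a \<and> f \<sim> b)"
    by (elim exE conjE)
  have "card ({} :: 'a set set) + 2*k + 1 + 2 \<le> card L" using bigL by simp
  note S = transv_STD[OF t(1) empty_subsetI empty_subsetI t(2)[THEN spec, THEN mp, THEN mp, OF finite.emptyI this]]
  have "STD ({} \<union> t ` (KK - {}))" "card ({} \<union> t ` (KK - {})) \<le> card ({}::'a set) + (card KK - card ({} :: 'a set set))"
    using S(1,3) by auto
  then show "\<exists>D. STD D \<and> card D \<le> card KK" by auto
qed

end

section \<open>Finding such a vertex\<close>

text \<open>\<open>a\<close> bounds a core, and \<open>r\<close> a set adjacent to the core in which
  no core vertex has more than \<open>N\<close> neighbours. The 3 rules out complete graphs,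
  \<open>a + a*N\<close> counts the elements of the STD set touching the core, \<open>2*a\<close>
  those discarded to make neighbourhoods disjoint, and the last bracket is what
  \<open>stabilise\<close> needs for \<open>r\<close>.\<close>

definition size_bound :: "nat \<Rightarrow> nat \<Rightarrow> nat" where
  "size_bound k N = (let a = 2*k+1; r = a*N in 3 + a + a*N + 2*a + (r*r + 2*r + 1))"

context fin_graph begin

text \<open>\<open>P\<close> dominates \<open>Z\<close> and all its neighbours. So whatever was
  dominated by an element of \<open>Z\<close>, or had its companion there, finds an element of
  \<open>P\<close> instead, in the second case through the same intermediate vertex.\<close>

lemma swap_STD:
  assumes D: "STD D" and Z: "Z \<subseteq> D" and P: "P \<subseteq> V" "card P \<le> card Z"
    and hit: "\<forall>z\<in>Z. \<exists>p\<in>P. z \<sim> p" and dn: "\<forall>z\<in>Z. \<forall>u. u \<sim> z \<longrightarrow> (\<exists>p\<in>P. u \<simeq> p)"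
    and Pn: "\<forall>p\<in>P. \<exists>q\<in>P. near p q"
  shows "STD ((D - Z) \<union> P)" "card ((D - Z) \<union> P) \<le> card D"
proof -
  have finD: "finite D" using STD_fin[OF D] .
  have "card ((D - Z) \<union> P) \<le> card (D - Z) + card P" by (rule card_Un_le)
  also have "card (D - Z) = card D - card Z" using finite_subset[OF Z finD] Z by (rule card_Diff_subset)
  finally show "card ((D - Z) \<union> P) \<le> card D" using P(2) card_mono[OF finD Z] by linarith
  show "STD ((D - Z) \<union> P)"
  proof (rule STDI)
    show "(D - Z) \<union> P \<subseteq> V" using STD_V[OF D] P(1) by blast
    fix x assume x: "x \<in> V"
    obtain d where d: "d \<in> D" "x \<simeq> d" using D x unfolding STD_def by blast
    show "\<exists>y\<in>(D - Z) \<union> P. x \<simeq> y"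
    proof (cases "x \<in> Z")
      case True then show ?thesis using bspec[OF hit True] nb_tch by blast
    next
      case xZ: False
      show ?thesis
      proof (cases "d \<in> Z")
        case True
        then have "x \<sim> d" using d(2) xZ unfolding tch_def by blast
        then show ?thesis using bspec[OF dn True] by blast
      next
        case False then show ?thesis using d by blast
      qed
    qed
  next
    fix y assume "y \<in> (D - Z) \<union> P"
    show "\<exists>y'\<in>(D - Z) \<union> P. near y y'"
    proof (cases "y \<in> P")
      case True then show ?thesis using bspec[OF Pn True] by blast
    next
      case False
      then have y: "y \<in> D" "y \<notin> Z" using \<open>y \<in> (D - Z) \<union> P\<close> by auto
      have np: "y \<noteq> p" if "p \<in> P" for p using False that by blast
      obtain d where d: "d \<in> D" "near y d" using D y(1) unfolding STD_def by blast
      show ?thesis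
      proof (cases "d \<in> Z")
        case dZ: True
        show ?thesis
        proof (cases "y \<sim> d")
          case True
          obtain p where p: "p \<in> P" "y \<simeq> p" using bspec[OF dn dZ] True by blast
          then have "y \<sim> p" using np unfolding tch_def by blast
          then show ?thesis using p(1) nearI1 by blast
        next
          case False
          then obtain w where w: "y \<sim> w" "w \<sim> d" using d(2) unfolding near_def by blast
          obtain p where p: "p \<in> P" "w \<simeq> p" using bspec[OF dn dZ] w(2) by blast
          then show ?thesis using near_tch[OF w(1) p(2) np[OF p(1)]] by blast
        qed
      next
        case False then show ?thesis using d by blast
      qed
    qed
  qed
qed

section \<open>Disjoint neighbourhoods and independent partial transversals\<close>

definition djn :: "'a set \<Rightarrow> bool" where
  "djn Z \<longleftrightarrow> (\<forall>y\<in>Z. \<forall>y'\<in>Z. \<forall>b. y \<sim> b \<and> y' \<sim> b \<longrightarrow> y = y')"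

lemma djnD: "djn Z \<Longrightarrow> y \<in> Z \<Longrightarrow> y' \<in> Z \<Longrightarrow> y \<sim> b \<Longrightarrow> y' \<sim> b \<Longrightarrow> y = y'"
  unfolding djn_def by blast

text \<open>Take out pairs with a common neighbour: each is covered by one vertex and saves one.
  Either \<open>j\<close> pairs are found, or the process stops after losing at most
  \<open>2*j\<close> vertices.\<close>

lemma small_cover_or_disjoint:
  "finite Y \<Longrightarrow> \<forall>y\<in>Y. \<exists>b. y \<sim> b \<Longrightarrow>
   (\<exists>S. finite S \<and> (\<forall>y\<in>Y. \<exists>s\<in>S. y \<sim> s) \<and> (\<forall>s\<in>S. \<exists>y\<in>Y. y \<sim> s) \<and> card S + j \<le> card Y) \<or>
   (\<exists>Y1\<subseteq>Y. card Y \<le> card Y1 + 2*j \<and> djn Y1)"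
proof (induction j arbitrary: Y)
  case 0
  from bchoice[OF 0(2)] obtain b where b: "\<forall>y\<in>Y. y \<sim> b y" ..
  have "finite (b ` Y) \<and> (\<forall>y\<in>Y. \<exists>s\<in>b ` Y. y \<sim> s) \<and> (\<forall>s\<in>b ` Y. \<exists>y\<in>Y. y \<sim> s) \<and> card (b ` Y) + 0 \<le> card Y"
    using b 0(1) card_image_le[OF 0(1), of b] by auto
  then show ?case by blast
next
  case (Suc j)
  show ?case
  proof (cases "djn Y")
    case True then show ?thesis by (intro disjI2 exI[of _ Y]) simp
  next
    case False
    then obtain y y' b where y: "y \<in> Y" "y' \<in> Y" "y \<sim> b" "y' \<sim> b" "y \<noteq> y'" unfolding djn_def by blast
    define Y' where "Y' = Y - {y,y'}"
    have cY': "card Y' + 2 = card Y"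
    proof -
      have "card {y,y'} \<le> card Y" using y Suc.prems(1) by (intro card_mono) auto
      then show ?thesis unfolding Y'_def using y Suc.prems(1) by (subst card_Diff_subset) auto
    qed
    have "finite Y'" "\<forall>y\<in>Y'. \<exists>b. y \<sim> b" using Suc.prems unfolding Y'_def by auto
    from Suc.IH[OF this] show ?thesis
    proof (elim disjE exE conjE)
      fix S assume S: "finite S" "\<forall>y\<in>Y'. \<exists>s\<in>S. y \<sim> s" "\<forall>s\<in>S. \<exists>y\<in>Y'. y \<sim> s" "card S + j \<le> card Y'"
      have "card (insert b S) + Suc j \<le> card Y" using S(1,4) cY' by (simp add: card_insert_if)
      moreover have "\<forall>y\<in>Y. \<exists>s\<in>insert b S. y \<sim> s" using S(2) y unfolding Y'_def by blast
      moreover have "\<forall>s\<in>insert b S. \<exists>y\<in>Y. y \<sim> s" using S(3) y unfolding Y'_def by blast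
      ultimately show ?thesis using S(1) by (intro disjI1 exI[of _ "insert b S"]) simp
    next
      fix Y1 assume Y1: "Y1 \<subseteq> Y'" "card Y' \<le> card Y1 + 2*j" "djn Y1"
      then show ?thesis using cY' unfolding Y'_def by (intro disjI2 exI[of _ Y1]) auto
    qed
  qed
qed

text \<open>\<open>pit Z Q\<close>: \<open>Q\<close> is an independent partial transversal of the neighbourhoods of the elements of \<open>Z\<close>.\<close>

definition pit :: "'a set \<Rightarrow> 'a set \<Rightarrow> bool" where
  "pit Z Q \<longleftrightarrow> indep Q \<and> (\<forall>q\<in>Q. \<exists>z\<in>Z. z \<sim> q) \<and> (\<forall>q\<in>Q. \<forall>q'\<in>Q. \<forall>z\<in>Z. z \<sim> q \<and> z \<sim> q' \<longrightarrow> q = q')"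

definition own :: "'a set \<Rightarrow> 'a set \<Rightarrow> 'a set" where "own Z Q = {z\<in>Z. \<exists>q\<in>Q. z \<sim> q}"

lemma pit_V: "pit Z Q \<Longrightarrow> Q \<subseteq> V" unfolding pit_def using nb_V2 by blast
lemma pit_fin: "pit Z Q \<Longrightarrow> finite Q" using pit_V finV finite_subset by blast
lemma pit_sub: "pit Z Q \<Longrightarrow> Q' \<subseteq> Q \<Longrightarrow> pit Z Q'" unfolding pit_def indep_def by blast

text \<open>Disjointness gives each element of \<open>Q\<close> a unique owner, and
  \<open>pit\<close> lets a vertex own at most one element.\<close>

lemma card_own: assumes Z: "djn Z" and Q: "pit Z Q" shows "card (own Z Q) = card Q"
proof -
  have "\<forall>q\<in>Q. \<exists>z. z \<in> Z \<and> z \<sim> q" using Q unfolding pit_def by blast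
  from bchoice[OF this] obtain ow where ow: "\<forall>q\<in>Q. ow q \<in> Z \<and> ow q \<sim> q" ..
  have "inj_on ow Q"
  proof (rule inj_onI)
    fix q q' assume q: "q \<in> Q" "q' \<in> Q" "ow q = ow q'"
    have "ow q \<in> Z" "ow q \<sim> q" "ow q \<sim> q'" using ow q by auto
    then show "q = q'" using Q q(1,2) unfolding pit_def by blast
  qed
  moreover have "ow ` Q = own Z Q"
  proof
    show "ow ` Q \<subseteq> own Z Q" unfolding own_def using ow by blast
    show "own Z Q \<subseteq> ow ` Q"
    proof
      fix z assume "z \<in> own Z Q"
      then obtain q where q: "z \<in> Z" "q \<in> Q" "z \<sim> q" unfolding own_def by blast
      then have "z = ow q" using djnD[OF Z q(1) _ q(3)] ow by blast
      then show "z \<in> ow ` Q" using q(2) by blast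
    qed
  qed
  ultimately show ?thesis using card_image by metis
qed

text \<open>Used in contrapositive form: if \<open>Q\<close> is maximum, every neighbour of a vertex
  that owns nothing is adjacent to \<open>Q\<close>.\<close>

lemma pit_insert:
  assumes Z: "djn Z" and Q: "pit Z Q" and u: "z \<in> Z" "u \<sim> z" "z \<notin> own Z Q" and n: "\<And>q. q \<in> Q \<Longrightarrow> \<not> u \<sim> q"
  shows "pit Z (insert u Q)" "card (insert u Q) = Suc (card Q)"
proof -
  have zu: "z \<sim> u" using nb_sym[OF u(2)] .
  have sep: "\<not> z' \<sim> u \<or> \<not> z' \<sim> q" if "z' \<in> Z" "q \<in> Q" for z' q
    using djnD[OF Z that(1) u(1) _ zu] that u(3) unfolding own_def by blast
  have "indep (insert u Q)" using Q n nb_irrefl unfolding pit_def indep_def by (simp add: nb_comm)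
  moreover have "\<forall>q\<in>insert u Q. \<exists>z\<in>Z. z \<sim> q" using Q zu u(1) unfolding pit_def by blast
  moreover have "\<forall>q\<in>insert u Q. \<forall>q'\<in>insert u Q. \<forall>z\<in>Z. z \<sim> q \<and> z \<sim> q' \<longrightarrow> q = q'"
    using Q sep unfolding pit_def by (metis insert_iff)
  ultimately show "pit Z (insert u Q)" unfolding pit_def by blast
  have "u \<notin> Q" using u(1,3) zu unfolding own_def by blast
  then show "card (insert u Q) = Suc (card Q)" using pit_fin[OF Q] by simp
qed

text \<open>Removing the owners of a maximum partial transversal eventually does not decrease the maximum any more.  Two
  successive maximum transversals then dominate each other and all neighbourhoods, so swapping them in yields a triple.\<close>

lemma stabilise:
  "djn Z \<Longrightarrow> finite Z \<Longrightarrow> \<forall>z\<in>Z. \<exists>b. z \<sim> b \<Longrightarrow> \<forall>Q. pit Z Q \<longrightarrow> card Q \<le> j \<Longrightarrow>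
   j*j + 2*j + 1 \<le> card Z \<Longrightarrow>
   \<exists>Z'\<subseteq>Z. \<exists>P. card P \<le> card Z' \<and> (\<forall>z\<in>Z'. \<exists>p\<in>P. z \<sim> p) \<and> (\<forall>p\<in>P. \<exists>z\<in>Z'. z \<sim> p) \<and>
     (\<forall>z\<in>Z'. \<forall>u. u \<sim> z \<longrightarrow> (\<exists>p\<in>P. u \<sim> p)) \<and> triple P"
proof (induction j arbitrary: Z)
  case 0
  then have "Z \<noteq> {}" by auto
  then obtain z u where z: "z \<in> Z" "z \<sim> u" using 0(3) by blast
  have "pit Z {}" unfolding pit_def indep_def by blast
  from pit_insert[OF 0(1) this z(1) nb_sym[OF z(2)]] have "pit Z {u}" by (simp add: own_def)
  then show ?case using 0(4) by fastforce
next
  case (Suc j)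
  note Z = Suc.prems(1)
  have "pit Z {}" unfolding pit_def indep_def by blast
  then obtain Q where Q: "pit Z Q" and mx: "\<And>Q'. pit Z Q' \<Longrightarrow> card Q' \<le> card Q"
    using ex_has_greatest_nat[of "pit Z" "{}" card "Suc (Suc j)"] Suc.prems(4) by (meson le_imp_less_Suc)
  define Y0 where "Y0 = own Z Q"
  define Z1 where "Z1 = Z - Y0"
  have Y0Z: "Y0 \<subseteq> Z" "Z1 \<subseteq> Z" unfolding Y0_def own_def Z1_def by auto
  have cY0: "card Y0 = card Q" "card Q \<le> Suc j" using card_own[OF Z Q] Suc.prems(4) Q unfolding Y0_def by auto
  have Z1d: "djn Z1" using Z Y0Z(2) unfolding djn_def by blast
  have cZ1: "card Z1 + card Y0 = card Z"
    unfolding Z1_def using Y0Z(1) Suc.prems(2) by (metis card_Diff_subset card_mono finite_subset le_add_diff_inverse2)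
  show ?case
  proof (cases "\<exists>Q'. pit Z1 Q' \<and> card Q \<le> card Q'")
    case True
    then obtain Q' where Q': "pit Z1 Q'" "card Q \<le> card Q'" by blast
    define Y1 where "Y1 = own Z1 Q'"
    have Y1Z: "Y1 \<subseteq> Z1" unfolding Y1_def own_def by auto
    have cY1: "card Y1 = card Q'" unfolding Y1_def by (rule card_own[OF Z1d Q'(1)])
    have pitQ': "pit Z Q'" unfolding pit_def
    proof (intro conjI ballI allI impI)
      show "indep Q'" using Q'(1) unfolding pit_def by blast
      fix q assume q: "q \<in> Q'"
      obtain z1 where z1: "z1 \<in> Z1" "z1 \<sim> q" using Q'(1) q unfolding pit_def by blast
      then show "\<exists>z\<in>Z. z \<sim> q" using Y0Z(2) by blast
      fix q' z assume q': "q' \<in> Q'" and z: "z \<in> Z" "z \<sim> q \<and> z \<sim> q'"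
      have "z = z1" using djnD[OF Z z(1) _ _ z1(2)] z1(1) Y0Z(2) z(2) by blast
      then show "q = q'" using Q'(1) q q' z(2) z1(1) unfolding pit_def by blast
    qed
    have cQ': "card Q' = card Q" using mx[OF pitQ'] Q'(2) by simp
    have ownQ': "own Z Q' \<subseteq> Z1"
    proof
      fix z assume "z \<in> own Z Q'"
      then obtain q where q: "z \<in> Z" "q \<in> Q'" "z \<sim> q" unfolding own_def by blast
      obtain z1 where z1: "z1 \<in> Z1" "z1 \<sim> q" using Q'(1) q(2) unfolding pit_def by blast
      have "z = z1" using djnD[OF Z q(1) _ q(3) z1(2)] z1(1) Y0Z(2) by blast
      then show "z \<in> Z1" using z1(1) by simp
    qed
    \<comment> \<open>\<open>Q\<close> is maximum, which settles the neighbours of vertices outside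
      \<open>Y0\<close>. \<open>Q'\<close> is maximum in \<open>Z\<close> too and its owners avoid
      \<open>Y0\<close>, so \<open>t2\<close> settles the neighbours of \<open>Y0\<close> in the
      same way.\<close>
    have t1: "\<exists>q\<in>Q. u \<sim> q" if uz: "z \<in> Z" "z \<notin> Y0" "u \<sim> z" for u z
    proof (rule ccontr)
      assume "\<not> ?thesis"
      then have n: "\<And>q. q \<in> Q \<Longrightarrow> \<not> u \<sim> q" by blast
      show False using mx[OF pit_insert(1)[OF Z Q uz(1,3) _ n]] pit_insert(2)[OF Z Q uz(1,3) _ n] uz(2)
        unfolding Y0_def by simp
    qed
    have t2: "\<exists>q\<in>Q'. u \<sim> q" if uz: "z \<in> Y0" "u \<sim> z" for u z
    proof (rule ccontr)
      assume "\<not> ?thesis"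
      then have n: "\<And>q. q \<in> Q' \<Longrightarrow> \<not> u \<sim> q" by blast
      have z: "z \<in> Z" "z \<notin> own Z Q'" using uz(1) Y0Z ownQ' unfolding Z1_def by auto
      show False using mx[OF pit_insert(1)[OF Z pitQ' z(1) uz(2) z(2) n]] pit_insert(2)[OF Z pitQ' z(1) uz(2) z(2) n] cQ'
        by simp
    qed
    \<comment> \<open>Vertices owned by neither transversal contribute one arbitrary neighbour each;
      thus \<open>P\<close> hits all of \<open>Z\<close> without exceeding \<open>card Z\<close>.
      Such a vertex exists by the size of \<open>Z\<close> and starts the triple \<open>s z\<close>,
      \<open>q\<close>, \<open>q'\<close> below.\<close>
    define Zr where "Zr = Z1 - Y1"
    have "\<forall>z\<in>Zr. \<exists>b. z \<sim> b" using Suc.prems(3) Y0Z(2) unfolding Zr_def by blast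
    from bchoice[OF this] obtain s where s: "\<forall>z\<in>Zr. z \<sim> s z" ..
    define P where "P = Q \<union> Q' \<union> s ` Zr"
    have finZr: "finite Zr" "finite Z1" unfolding Zr_def Z1_def using Suc.prems(2) by auto
    have cZr: "card Zr + card Y1 = card Z1"
      unfolding Zr_def using Y1Z finZr by (metis card_Diff_subset card_mono finite_subset le_add_diff_inverse2)
    have "card P \<le> card Q + card Q' + card (s ` Zr)"
      unfolding P_def by (meson add_le_mono1 card_Un_le le_trans)
    also have "\<dots> \<le> card Z" using card_image_le[OF finZr(1), of s] cZr cZ1 cY0(1) cY1 by linarith
    finally have cP: "card P \<le> card Z" .
    have hit: "\<exists>p\<in>P. z \<sim> p" if z: "z \<in> Z" for z
    proof -
      consider "z \<in> Y0" | "z \<in> Y1" | "z \<in> Zr" using z unfolding Zr_def Z1_def by blast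
      then show ?thesis
      proof cases
        case 1 then show ?thesis unfolding Y0_def own_def P_def by blast
      next
        case 2 then show ?thesis unfolding Y1_def own_def P_def by blast
      next
        case 3 then show ?thesis using s unfolding P_def by blast
      qed
    qed
    have sub: "\<exists>z\<in>Z. z \<sim> p" if "p \<in> P" for p
    proof -
      have "(\<exists>z\<in>Z. z \<sim> p)" if "p \<in> Q \<or> p \<in> Q'" using that Q pitQ' unfolding pit_def by blast
      moreover have "(\<exists>z\<in>Z. z \<sim> p)" if "p \<in> s ` Zr" using that s Y0Z(2) unfolding Zr_def by blast
      ultimately show ?thesis using that unfolding P_def by blast
    qed
    have td: "\<exists>p\<in>P. u \<sim> p" if "z \<in> Z" "u \<sim> z" for z u
      using t1[OF that(1) _ that(2)] t2[OF _ that(2)] unfolding P_def by blast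
    have "2 * Suc j < card Z" using Suc.prems(5) by simp
    moreover have "card Z = card Zr + card Q + card Q" using cZr cZ1 cY0(1) cY1 cQ' by simp
    ultimately have "0 < card Zr" using cY0(2) by simp
    then obtain z where z: "z \<in> Zr" by (auto simp: card_gt_0_iff)
    have zz: "z \<in> Z" "z \<notin> Y0" "z \<sim> s z" "z \<notin> Y1" "z \<in> Z1" using z s Y0Z(2) unfolding Zr_def Z1_def by auto
    obtain q where q: "q \<in> Q" "s z \<sim> q" using t1[OF zz(1,2) nb_sym[OF zz(3)]] by blast
    obtain z0 where z0: "z0 \<in> Z" "z0 \<sim> q" using Q q(1) unfolding pit_def by blast
    then have "z0 \<in> Y0" using q(1) unfolding Y0_def own_def by blast
    then obtain q' where q': "q' \<in> Q'" "q \<sim> q'" using t2[OF _ nb_sym[OF z0(2)]] by blast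
    have "q' \<noteq> s z" using q'(1) zz(3-5) unfolding Y1_def own_def by blast
    have "s z \<in> P" "q \<in> P" "q' \<in> P" using z q(1) q'(1) unfolding P_def by auto
    then have "triple P" by (rule tripleI[OF _ _ _ q(2) nearI1[OF q'(2)] \<open>q' \<noteq> s z\<close>])
    then show ?thesis
      using cP hit sub td by (intro exI[of _ Z] exI[of _ P] conjI subset_refl ballI allI impI) auto
  next
    case False
    \<comment> \<open>Removing at most \<open>j + 1\<close> owners has lowered the maximum; the
      quadratic bound on \<open>card Z\<close> pays for all rounds.\<close>
    then have "\<forall>Q'. pit Z1 Q' \<longrightarrow> card Q' \<le> j" using cY0(2) by fastforce
    moreover have "j*j + 2*j + 1 \<le> card Z1" using Suc.prems(5) cZ1 cY0 by simp
    moreover have "finite Z1" "\<forall>z\<in>Z1. \<exists>b. z \<sim> b" using Suc.prems(2,3) Y0Z(2) finite_subset by blast+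
    moreover define G where "G Z' \<longleftrightarrow> (\<exists>P. card P \<le> card Z' \<and> (\<forall>z\<in>Z'. \<exists>p\<in>P. z \<sim> p) \<and> (\<forall>p\<in>P. \<exists>z\<in>Z'. z \<sim> p) \<and>
     (\<forall>z\<in>Z'. \<forall>u. u \<sim> z \<longrightarrow> (\<exists>p\<in>P. u \<sim> p)) \<and> triple P)" for Z'
    ultimately have "\<exists>Z'\<subseteq>Z1. G Z'" unfolding G_def using Suc.IH[OF Z1d] by simp
    then have "\<exists>Z'\<subseteq>Z. G Z'" using Y0Z(2) by blast
    then show ?thesis unfolding G_def .
  qed
qed

text \<open>A connected graph without induced P3 is complete, and there any two vertices form an STD
  set, too small for \<open>g \<ge> 3\<close>.\<close>

lemma P3_exists:
  assumes conn: "\<And>K. K \<subset> V \<Longrightarrow> K \<noteq> {} \<Longrightarrow> \<exists>u\<in>K. \<exists>w\<in>V-K. u \<sim> w"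
    and rg: "rigid g" and D: "STD D" and g: "3 \<le> g"
  shows "\<exists>x\<in>V. \<exists>y\<in>V. \<exists>z\<in>V. P3 x y z"
proof (rule ccontr)
  assume n: "\<not> ?thesis"
  have all: "x \<simeq> y" if x: "x \<in> V" and y: "y \<in> V" for x y
  proof -
    define K where "K = {y\<in>V. x \<simeq> y}"
    have "K = V"
    proof (rule ccontr)
      assume "K \<noteq> V"
      moreover have "K \<subseteq> V" "K \<noteq> {}" using x unfolding K_def by auto
      ultimately obtain u w where uw: "u \<in> K" "w \<in> V - K" "u \<sim> w" using conn[of K] by blast
      then have u: "u \<in> V" "x \<simeq> u" "\<not> x \<simeq> w" "w \<in> V" unfolding K_def by auto
      then have "x \<noteq> u" using uw(3) nb_tch by blast
      then have "P3 x u w" using u uw(3) unfolding P3_def by (simp add: tch_def)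
      then show False using n x u by blast
    qed
    then show ?thesis using y unfolding K_def by blast
  qed
  have "3 \<le> card D" using rigidD(2)[OF rg D] g by simp
  then obtain S where "S \<subseteq> D" "card S = 2" using obtain_subset_with_card_n[of 2 D] by auto
  then obtain x y where xy: "x \<in> D" "y \<in> D" "x \<noteq> y" by (auto simp: card_2_iff)
  have V: "x \<in> V" "y \<in> V" using xy STD_V[OF D] by auto
  have "x \<sim> y" using all[OF V] xy(3) unfolding tch_def by blast
  then have "STD {x,y}" using V all nearI1 nb_sym by (intro STDI) auto
  then have "g \<le> card {x,y}" by (rule rigidD(2)[OF rg])
  then show False using g xy(3) by simp
qed

text \<open>A neighbour \<open>u\<close> of \<open>z\<close> missed by \<open>Q\<close> would give
  the P3 \<open>u\<close>, \<open>z\<close>, \<open>q0\<close> with the element \<open>q0\<close>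
  owned by \<open>z\<close>. Disjointness of neighbourhoods keeps it apart from the edges joining
  the other elements of \<open>Q\<close>, at least \<open>k\<close>, to their owners.\<close>

lemma pit_swap_dominates:
  assumes fr: "free k" and Y: "djn Y" "indep Y" and Q: "pit Y Q" and big: "k + 1 \<le> card Q"
    and z: "z \<in> own Y Q" and u: "u \<sim> z"
  shows "\<exists>q\<in>Q. u \<simeq> q"
proof (rule ccontr)
  assume n: "\<not> ?thesis"
  obtain q0 where q0: "q0 \<in> Q" "z \<sim> q0" and zY: "z \<in> Y" using z unfolding own_def by blast
  have "\<forall>q\<in>Q. \<exists>y. y \<in> Y \<and> y \<sim> q" using Q unfolding pit_def by blast
  from bchoice[OF this] obtain ow where ow: "\<forall>q\<in>Q. ow q \<in> Y \<and> ow q \<sim> q" ..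
  have own1: "y = ow q" if "q \<in> Q" "y \<in> Y" "y \<sim> q" for q y using djnD[OF Y(1) that(2) _ that(3)] ow that(1) by blast
  have inj: "q = q'" if "q \<in> Q" "q' \<in> Q" "ow q = ow q'" for q q'
    using Q that ow unfolding pit_def by metis
  have iQ: "indep Q" using Q unfolding pit_def by blast
  have QY: "q \<noteq> y" if "q \<in> Q" "y \<in> Y" for q y
    using indepD[OF Y(2), of "ow q" y] ow that by metis
  define P where "P = Q - {q0}"
  have PQ: "q \<in> Q" "q \<noteq> q0" if "q \<in> P" for q using that unfolding P_def by auto
  have im: "imatch ((\<lambda>q. (q, ow q)) ` P) \<and> card ((\<lambda>q. (q, ow q)) ` P) = card P"
  proof (rule imatchI)
    fix q assume "q \<in> P" then show "q \<sim> ow q" using PQ ow nb_sym by blast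
  next
    fix q q' assume q: "q \<in> P" "q' \<in> P" "q \<noteq> q'"
    note qq = PQ(1)[OF q(1)] PQ(1)[OF q(2)]
    show "\<not> q \<simeq> q'" by (rule indepD2[OF iQ qq q(3)])
    have ne: "ow q \<noteq> ow q'" using inj[OF qq] q(3) by blast
    then show "\<not> ow q \<simeq> ow q'" using indepD2[OF Y(2)] ow qq by blast
    have oY: "ow q' \<in> Y" using ow qq(2) by blast
    have "\<not> ow q' \<sim> q" using own1[OF qq(1) oY] ne by metis
    then show "\<not> q \<simeq> ow q'" using QY[OF qq(1) oY] by (simp add: tch_def nb_comm)
  qed
  have uq0: "\<not> u \<simeq> q0" using n q0(1) by blast
  have p3: "P3 u z q0" unfolding P3_def using u q0(2) uq0 by blast
  have zow: "z = ow q0" by (rule own1[OF q0(1) zY q0(2)])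
  have "card ((\<lambda>q. (q, ow q)) ` P) < k"
  proof (rule freeD[OF fr _ conjunct1[OF im] p3])
    show "finite ((\<lambda>q. (q, ow q)) ` P)" unfolding P_def using pit_fin[OF Q] by simp
    fix r assume "r \<in> (\<lambda>q. (q, ow q)) ` P"
    then obtain q where q: "q \<in> P" "r = (q, ow q)" by blast
    note qQ = PQ[OF q(1)]
    have owq: "ow q \<in> Y" "ow q \<sim> q" using ow qQ(1) by auto
    have ne: "z \<noteq> ow q" using zow inj[OF q0(1) qQ(1)] qQ(2) by metis
    have "\<not> u \<simeq> q" using n qQ(1) by blast
    moreover have "\<not> u \<sim> ow q" using djnD[OF Y(1) zY owq(1) nb_sym[OF u]] ne nb_sym by blast
    moreover have "u \<noteq> ow q" using indepD[OF Y(2) owq(1) zY] u by blast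
    moreover have "\<not> z \<simeq> q" using own1[OF qQ(1) zY] ne QY[OF qQ(1) zY] unfolding tch_def by metis
    moreover have "\<not> z \<simeq> ow q" by (rule indepD2[OF Y(2) zY owq(1) ne])
    moreover have "\<not> q0 \<simeq> q" using indepD2[OF iQ q0(1) qQ(1)] qQ(2) by blast
    moreover have "\<not> ow q \<sim> q0" using own1[OF q0(1) owq(1)] ne zow by metis
    moreover have "q0 \<noteq> ow q" by (rule QY[OF q0(1) owq(1)])
    ultimately show "\<not> touch u r \<and> \<not> touch z r \<and> \<not> touch q0 r"
      unfolding touch_def q(2) tch_def by (simp add: nb_comm)
  qed
  moreover have "card P = card Q - 1" unfolding P_def using q0(1) by simp
  ultimately show False using im big by simp
qed

text \<open>\<open>Y\<close> is the part of \<open>D\<close> not dominated by a core \<open>A\<close>.  Neighbours of \<open>Y\<close> are dominated by \<open>A\<close>, so a cover of \<open>Y\<close>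
  saving \<open>card A\<close> vertices would give a triple inside \<open>A\<close>; hence nearly all neighbourhoods of
  elements of \<open>Y\<close> are disjoint.\<close>

lemma many_common_neighbours:
  assumes fr: "free k" and rg: "rigid g" and D: "STD D" "card D \<le> g"
    and conn: "\<And>K. K \<subset> V \<Longrightarrow> K \<noteq> {} \<Longrightarrow> \<exists>u\<in>K. \<exists>w\<in>V-K. u \<sim> w"
    and N: "k + 2 \<le> N" and g: "size_bound k N \<le> g"
  shows "\<exists>D' v. STD D' \<and> card D' \<le> g \<and> N \<le> card {x\<in>D'. x \<sim> v}"
proof (rule ccontr)
  assume "\<not> ?thesis"
  then have few: "card {x\<in>D'. x \<sim> v} < N" if "STD D'" "card D' \<le> g" for D' v
    using that not_less by blast
  have nt: "\<not> triple D'" if "STD D'" "card D' \<le> g" for D' using rigidD(1)[OF rg] that by blast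
  define a where "a = 2*k+1"
  define r where "r = a*N"
  have g': "3 + a + a*N + 2*a + (r*r + 2*r + 1) \<le> g"
    using g unfolding size_bound_def Let_def a_def r_def by simp
  have finD: "finite D" and DV: "D \<subseteq> V" using STD_fin STD_V D by auto
  have gD: "g \<le> card D" by (rule rigidD(2)[OF rg D(1)])
  have g3: "3 \<le> g" using g' by linarith
  obtain x y z where xyz: "P3 x y z" "x \<in> V" "y \<in> V" "z \<in> V"
    using P3_exists[OF conn rg D(1) g3] by metis
  obtain A where A: "A \<subseteq> V" "card A \<le> a" and Ap: "\<exists>x\<in>A. \<exists>y\<in>A. \<exists>z\<in>A. P3 x y z"
    and An: "\<forall>x\<in>A. \<exists>b\<in>A. x \<sim> b"
    and Ac: "\<forall>u\<in>V. \<forall>w\<in>V. u \<sim> w \<longrightarrow> (\<exists>x\<in>A. u \<simeq> x \<or> w \<simeq> x)"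
    using core[OF fr subset_refl xyz] unfolding a_def by (elim exE conjE)
  have finA: "finite A" using A(1) finV finite_subset by blast
  define Y where "Y = {u\<in>D. \<forall>x\<in>A. \<not> u \<simeq> x}"
  have YD: "Y \<subseteq> D" unfolding Y_def by blast
  have finY: "finite Y" using YD finD finite_subset by blast
  have indY: "indep Y" unfolding indep_def Y_def using Ac DV by blast
  have nbY: "\<exists>x\<in>A. b \<sim> x" if y: "y \<in> Y" "y \<sim> b" for y b
  proof -
    obtain x where x: "x \<in> A" "y \<simeq> x \<or> b \<simeq> x" using Ac nb_V[OF y(2)] nb_V2[OF y(2)] y(2) by blast
    have "\<not> y \<simeq> x" using y(1) x(1) unfolding Y_def by blast
    then have "b \<simeq> x" "b \<noteq> x" using x(2) y(2) nb_tch by auto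
    then show ?thesis using x(1) unfolding tch_def by blast
  qed
  have "D - Y \<subseteq> A \<union> (\<Union>x\<in>A. {u\<in>D. u \<sim> x})" unfolding Y_def tch_def by blast
  then have "card (D - Y) \<le> card (A \<union> (\<Union>x\<in>A. {u\<in>D. u \<sim> x}))" using finA finD by (intro card_mono) auto
  also have "\<dots> \<le> card A + card (\<Union>x\<in>A. {u\<in>D. u \<sim> x})" by (rule card_Un_le)
  also have "card (\<Union>x\<in>A. {u\<in>D. u \<sim> x}) \<le> (\<Sum>x\<in>A. card {u\<in>D. u \<sim> x})" by (rule card_UN_le[OF finA])
  also have "\<dots> \<le> (\<Sum>x\<in>A. N)" using few[OF D] by (intro sum_mono) (simp add: less_imp_le)
  also have "\<dots> \<le> a * N" using A(2) by simp
  finally have "card (D - Y) \<le> a + a*N" using A(2) by linarith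
  then have cY: "g \<le> card Y + a + a*N"
    using gD card_Diff_subset[OF finY YD] card_mono[OF finD YD] by linarith
  have Ynb: "\<forall>y\<in>Y. \<exists>b. y \<sim> b"
  proof
    fix y assume y: "y \<in> Y"
    obtain x where "x \<in> A" using Ap by blast
    then have "x \<in> V" "x \<noteq> y" using A(1) y unfolding Y_def by auto
    then have "{y} \<subset> V" using y YD DV by blast
    then show "\<exists>b. y \<sim> b" using conn[of "{y}"] by blast
  qed
  show False
  proof (rule disjE[OF small_cover_or_disjoint[OF finY Ynb, of "card A"]])
    assume "\<exists>S. finite S \<and> (\<forall>y\<in>Y. \<exists>s\<in>S. y \<sim> s) \<and> (\<forall>s\<in>S. \<exists>y\<in>Y. y \<sim> s) \<and> card S + card A \<le> card Y"
    then obtain S where S: "finite S" "\<forall>y\<in>Y. \<exists>s\<in>S. y \<sim> s" "\<forall>s\<in>S. \<exists>y\<in>Y. y \<sim> s" "card S + card A \<le> card Y" by (elim exE conjE)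
    \<comment> \<open>Everything in \<open>D1\<close> touches \<open>A\<close>: elements of
      \<open>D - Y\<close> by definition, those of \<open>S\<close> through \<open>nbY\<close>.
      Hence companions can be taken in \<open>A\<close>, whose P3 provides the triple.\<close>
    define D1 where "D1 = (D - Y) \<union> (A \<union> S)"
    have nA: "\<exists>x\<in>A. u \<simeq> x" if u: "u \<in> D1" for u
    proof -
      consider "u \<in> D - Y" | "u \<in> A" | "u \<in> S" using u unfolding D1_def by blast
      then show ?thesis
      proof cases
        case 1 then show ?thesis unfolding Y_def by blast
      next
        case 2 then show ?thesis using tch_refl by blast
      next
        case 3
        then obtain y where "y \<in> Y" "y \<sim> u" using S(3) by blast
        then obtain x where "x \<in> A" "u \<sim> x" using nbY by blast
        then show ?thesis using nb_tch by blast
      qed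
    qed
    have "STD D1"
    proof (rule STDI)
      show "D1 \<subseteq> V" unfolding D1_def using DV A(1) S(3) nb_V2 by blast
      fix u assume u: "u \<in> V"
      show "\<exists>y\<in>D1. u \<simeq> y"
      proof (cases "u \<in> Y \<or> (\<exists>x\<in>A. u \<simeq> x)")
        case True
        then show ?thesis
        proof
          assume "u \<in> Y"
          then obtain s where "s \<in> S" "u \<sim> s" using S(2) by blast
          then show ?thesis using nb_tch unfolding D1_def by blast
        next
          assume "\<exists>x\<in>A. u \<simeq> x" then show ?thesis unfolding D1_def by blast
        qed
      next
        case False
        obtain d where d: "d \<in> D" "u \<simeq> d" using D(1) u unfolding STD_def by blast
        have "d \<notin> Y"
        proof
          assume dY: "d \<in> Y"
          then have "u \<sim> d" using d(2) False unfolding tch_def by blast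
          then obtain x where "x \<in> A" "u \<sim> x" using nbY[OF dY nb_sym] by blast
          then show False using False nb_tch by blast
        qed
        then show ?thesis using d unfolding D1_def by blast
      qed
    next
      fix u assume u: "u \<in> D1"
      obtain x where x: "x \<in> A" "u \<simeq> x" using nA[OF u] by blast
      show "\<exists>y\<in>D1. near u y"
      proof (cases "u = x")
        case True then show ?thesis using An x(1) nearI1 unfolding D1_def by blast
      next
        case False
        then have "near u x" using x(2) nearI1 unfolding tch_def by blast
        then show ?thesis using x(1) unfolding D1_def by blast
      qed
    qed
    moreover have "card D1 \<le> card D"
    proof -
      have "card D1 \<le> card (D - Y) + card (A \<union> S)" unfolding D1_def by (rule card_Un_le)
      also have "card (A \<union> S) \<le> card A + card S" by (rule card_Un_le)
      finally show ?thesis using S(4) card_Diff_subset[OF finY YD] card_mono[OF finD YD] by linarith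
    qed
    moreover have "triple D1"
    proof -
      obtain x y z where p: "x \<in> A" "y \<in> A" "z \<in> A" "P3 x y z" using Ap by blast
      then have "x \<in> D1" "y \<in> D1" "z \<in> D1" "x \<sim> y" "near y z" "z \<noteq> x"
        using nearI1 unfolding D1_def P3_def by auto
      then show ?thesis by (rule tripleI)
    qed
    ultimately show False using nt D(2) by (meson le_trans)
  next
    assume "\<exists>Y1\<subseteq>Y. card Y \<le> card Y1 + 2 * card A \<and> djn Y1"
    then obtain Y1 where Y1: "Y1 \<subseteq> Y" "card Y \<le> card Y1 + 2 * card A" "djn Y1" by (elim exE conjE)
    have finY1: "finite Y1" using Y1(1) finY finite_subset by blast
    have Y1D: "Y1 \<subseteq> D" using Y1(1) YD by blast
    have indY1: "indep Y1" using indY Y1(1) unfolding indep_def by blast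
    have Y1nb: "\<forall>z\<in>Y1. \<exists>b. z \<sim> b" using Ynb Y1(1) by blast
    have cY1: "r*r + 2*r + 1 \<le> card Y1" using Y1(2) A(2) cY g' by linarith
    show False
    proof (cases "\<exists>Q. pit Y1 Q \<and> r < card Q")
      case True
      then obtain Q where Q: "pit Y1 Q" "r < card Q" by blast
      have finQ: "finite Q" by (rule pit_fin[OF Q(1)])
      \<comment> \<open>Every element of \<open>Q\<close> has a neighbour in the core, so by
        pigeonhole some \<open>x\<close> sees \<open>N\<close> of them. Swapping these in for their
        owners yields an STD set with \<open>N\<close> neighbours of \<open>x\<close>.\<close>
      have "\<exists>x\<in>A. N \<le> card {q\<in>Q. q \<sim> x}"
      proof (rule ccontr)
        assume n: "\<not> ?thesis"
        have "Q \<subseteq> (\<Union>x\<in>A. {q\<in>Q. q \<sim> x})"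
        proof
          fix q assume q: "q \<in> Q"
          then obtain y where "y \<in> Y1" "y \<sim> q" using Q(1) unfolding pit_def by blast
          then obtain x where "x \<in> A" "q \<sim> x" using nbY Y1(1) by blast
          then show "q \<in> (\<Union>x\<in>A. {q\<in>Q. q \<sim> x})" using q by blast
        qed
        then have "card Q \<le> card (\<Union>x\<in>A. {q\<in>Q. q \<sim> x})" using finA finQ by (intro card_mono) auto
        also have "\<dots> \<le> (\<Sum>x\<in>A. card {q\<in>Q. q \<sim> x})" by (rule card_UN_le[OF finA])
        also have "\<dots> \<le> (\<Sum>x\<in>A. N)" using n by (intro sum_mono) (meson nat_le_linear)
        also have "\<dots> \<le> r" using A(2) unfolding r_def by simp
        finally show False using Q(2) by simp
      qed
      then obtain x where x: "x \<in> A" "N \<le> card {q\<in>Q. q \<sim> x}" by (elim bexE)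
      define Qx where "Qx = {q\<in>Q. q \<sim> x}"
      have "Qx \<subseteq> Q" unfolding Qx_def by blast
      then have Qx: "pit Y1 Qx" by (rule pit_sub[OF Q(1)])
      have finQx: "finite Qx" by (rule pit_fin[OF Qx])
      have kQ: "k + 1 \<le> card Qx" "2 \<le> card Qx" using x(2) N unfolding Qx_def by linarith+
      define Z where "Z = own Y1 Qx"
      have ZD: "Z \<subseteq> D" using Y1D unfolding Z_def own_def by blast
      have cQx: "card Qx \<le> card Z" using card_own[OF Y1(3) Qx] unfolding Z_def by simp
      have hit: "\<forall>z\<in>Z. \<exists>p\<in>Qx. z \<sim> p" unfolding Z_def own_def by blast
      have dn: "\<forall>z\<in>Z. \<forall>u. u \<sim> z \<longrightarrow> (\<exists>p\<in>Qx. u \<simeq> p)"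
        using pit_swap_dominates[OF fr Y1(3) indY1 Qx kQ(1)] unfolding Z_def by simp
      have Pn: "\<forall>p\<in>Qx. \<exists>q\<in>Qx. near p q"
      proof
        fix p assume p: "p \<in> Qx"
        have "0 < card (Qx - {p})" using kQ(2) p by simp
        then obtain q where q: "q \<in> Qx" "q \<noteq> p" by (auto simp: card_gt_0_iff)
        have "p \<sim> x" "x \<sim> q" using p q(1) nb_sym unfolding Qx_def by auto
        then show "\<exists>q\<in>Qx. near p q" using nearI2 q by metis
      qed
      note sw = swap_STD[OF D(1) ZD pit_V[OF Qx] cQx hit dn Pn]
      have "card {u\<in>(D - Z) \<union> Qx. u \<sim> x} < N"
        by (rule few) (use sw D(2) in auto)
      moreover have "card Qx \<le> card {u\<in>(D - Z) \<union> Qx. u \<sim> x}"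
        using finD finQx unfolding Qx_def by (intro card_mono) auto
      ultimately show False using x(2) unfolding Qx_def by simp
    next
      case False
      then have bd: "\<forall>Q. pit Y1 Q \<longrightarrow> card Q \<le> r" using not_less by blast
      obtain Z P where Z: "Z \<subseteq> Y1" "card P \<le> card Z" "\<forall>z\<in>Z. \<exists>p\<in>P. z \<sim> p" "\<forall>p\<in>P. \<exists>z\<in>Z. z \<sim> p"
        "\<forall>z\<in>Z. \<forall>u. u \<sim> z \<longrightarrow> (\<exists>p\<in>P. u \<sim> p)" "triple P"
        using stabilise[OF Y1(3) finY1 Y1nb bd cY1] by (elim exE conjE)
      have PV: "P \<subseteq> V" using Z(4) nb_V2 by blast
      have ZD: "Z \<subseteq> D" using Z(1) Y1D by blast
      have dn: "\<forall>z\<in>Z. \<forall>u. u \<sim> z \<longrightarrow> (\<exists>p\<in>P. u \<simeq> p)" using Z(5) nb_tch by blast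
      have Pn: "\<forall>p\<in>P. \<exists>q\<in>P. near p q"
      proof
        fix p assume p: "p \<in> P"
        obtain z where z: "z \<in> Z" "z \<sim> p" using Z(4) p by blast
        then show "\<exists>q\<in>P. near p q" using Z(5) nb_sym[OF z(2)] nearI1 by blast
      qed
      note sw = swap_STD[OF D(1) ZD PV Z(2,3) dn Pn]
      have "\<not> triple ((D - Z) \<union> P)" by (rule nt) (use sw D(2) in auto)
      then show False using Z(6) unfolding triple_def by blast
    qed
  qed
qed

abbreviation "legs_good k L \<equiv> legs.good V nb k L"

text \<open>In the rigid case the set \<open>D\<close> belonging to \<open>L\<close> avoids
  \<open>F\<close>, so it has an element in each clique; this gives \<open>card KK \<le> g\<close>,
  and \<open>rigid_good\<close> applies. Conversely \<open>good_rigid\<close> makes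
  \<open>card KK\<close> rigid and attained, hence equal to \<open>g\<close>. The number of
  neighbours requested is what \<open>many_common_neighbours_matching\<close> consumes for
  \<open>m = 9*k+10\<close>.\<close>

theorem large_characterisation:
  assumes fr: "free k"
    and conn: "\<And>K. K \<subset> V \<Longrightarrow> K \<noteq> {} \<Longrightarrow> \<exists>u\<in>K. \<exists>w\<in>V-K. u \<sim> w"
    and D0: "STD D0" "card D0 = g" and mn: "\<And>D. STD D \<Longrightarrow> g \<le> card D"
    and g: "size_bound k ((k+2)*(9*k+10) + 2*k + 4) \<le> g"
  shows "(\<exists>D. STD D \<and> card D \<le> g \<and> triple D) \<longleftrightarrow>
    \<not> (\<exists>L. finite L \<and> imatch L \<and> card L = 9*k+10 \<and> legs_good k L)"
proof -
  have rI: "rigid g" if "\<not> (\<exists>D. STD D \<and> card D \<le> g \<and> triple D)" using that mn unfolding rigid_def by blast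
  have "\<exists>L. finite L \<and> imatch L \<and> card L = 9*k+10 \<and> legs_good k L" if rg: "rigid g"
  proof -
    let ?N = "(k+2)*(9*k+10) + 2*k + 4"
    have N: "k + 2 \<le> ?N" by simp
    obtain D v where D: "STD D" "card D \<le> g" "?N \<le> card {x\<in>D. x \<sim> v}"
      using many_common_neighbours[OF fr rg D0(1) _ conn N g] D0(2) by auto
    have "k + 3 \<le> 9*k+10" by simp
    then obtain L where L: "finite L" "imatch L" "card L = 9*k+10" "\<forall>f\<in>D. k \<le> card {p\<in>L. \<not> touch f p}"
      using many_common_neighbours_matching[OF fr rg D] by blast
    interpret legs V nb k L by unfold_locales (use fr L conn in auto)
    have "D \<inter> F = {}" using L(4) unfolding F_def by force
    moreover have "domd {} = {}" using KK_ne unfolding domd_def by blast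
    ultimately have "card KK \<le> g" using STD_card(2)[OF D(1)] D(2) by simp
    then have good by (rule rigid_good[OF rg])
    then show ?thesis using L by blast
  qed
  moreover have "rigid g" if L: "finite L" "imatch L" "card L = 9*k+10" "legs_good k L" for L
  proof -
    interpret legs V nb k L by unfold_locales (use fr L conn in auto)
    have rg: "rigid (card KK)" "\<exists>D. STD D \<and> card D \<le> card KK" using good_rigid[OF L(4)] by auto
    then have "g \<le> card KK" using mn le_trans by blast
    moreover have "card KK \<le> g" using rigidD(2)[OF rg(1) D0(1)] D0(2) by simp
    ultimately show ?thesis using rg(1) by simp
  qed
  ultimately show ?thesis using rI rigidD(1) by blast
qed

end

section \<open>Edge contractions\<close>

lemma adj_sym: "adj G x y \<Longrightarrow> adj G y x" unfolding adj_def by (simp add: insert_commute)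

lemma fin_graph_adj: assumes "simple_graph G" shows "fin_graph (verts G) (adj G)"
proof
  show "finite (verts G)" using assms unfolding simple_graph_def by blast
  show "adj G y x" if "adj G x y" for x y using that by (rule adj_sym)
  show "\<not> adj G x x" for x unfolding adj_def by blast
  show "x \<in> verts G" if "adj G x y" for x y
  proof -
    have "{x,y} \<in> edges G" using that unfolding adj_def by blast
    then obtain u v where "{x,y} = {u,v}" "u \<in> verts G" "v \<in> verts G"
      using assms unfolding simple_graph_def by blast
    then show ?thesis by (auto simp: doubleton_eq_iff)
  qed
qed

lemma adj_contract:
  "adj (contract G u v) x y \<longleftrightarrow> x \<noteq> y \<and> x \<noteq> v \<and> y \<noteq> v \<and>
     (adj G x y \<or> (x = u \<and> adj G v y) \<or> (y = u \<and> adj G v x))"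
  if "u \<noteq> v"
  unfolding adj_def contract_def edges_def[of "(_,_)"] using that
  by (auto simp: doubleton_eq_iff insert_commute)

lemma verts_contract: "verts (contract G u v) = verts G - {v}"
  unfolding contract_def verts_def by simp

locale conn_graph =
  fixes G :: graph
  assumes simp: "simple_graph G" and con: "connected_graph G"
begin

sublocale fin_graph "verts G" "adj G" by (rule fin_graph_adj[OF simp])

lemma conn: assumes K: "K \<subset> verts G" "K \<noteq> {}" shows "\<exists>u\<in>K. \<exists>w\<in>verts G - K. adj G u w"
proof -
  obtain u w where uw: "u \<in> K" "w \<in> verts G" "w \<notin> K" using K by blast
  then have "(adj G)\<^sup>*\<^sup>* u w" using con K unfolding connected_graph_def by blast
  then have "w \<in> K \<or> (\<exists>u\<in>K. \<exists>w\<in>verts G - K. adj G u w)"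
  proof (induction rule: rtranclp_induct)
    case base then show ?case using uw by blast
  next
    case (step y z) then show ?case using nb_V2 by blast
  qed
  then show ?thesis using uw by blast
qed

lemma near_within2: "near x y \<longleftrightarrow> within2 G x y" unfolding near_def within2_def by blast

lemma semitotal_iff: "semitotal_dom G D \<longleftrightarrow> STD D"
proof -
  have 1: "(\<forall>x\<in>verts G - D. \<exists>y\<in>D. adj G x y) \<longleftrightarrow> (\<forall>x\<in>verts G. \<exists>y\<in>D. tch x y)"
    unfolding tch_def by blast
  have 2: "(\<forall>x\<in>D. \<exists>y\<in>D. y \<noteq> x \<and> within2 G x y) \<longleftrightarrow> (\<forall>x\<in>D. \<exists>y\<in>D. near x y)"
    unfolding near_within2 by (intro ball_cong bex_cong refl) (auto simp: within2_def)
  show ?thesis unfolding semitotal_dom_def STD_def 1 2 by blast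
qed

lemma gamma_le: "STD D \<Longrightarrow> gamma_t2 G \<le> card D"
  unfolding gamma_t2_def semitotal_iff by (rule Least_le) blast

lemma gamma_attained: "STD D \<Longrightarrow> \<exists>D. STD D \<and> card D = gamma_t2 G"
  unfolding gamma_t2_def semitotal_iff by (rule LeastI_ex) blast

lemma STD_verts: assumes "x \<in> verts G" "y \<in> verts G" "x \<noteq> y" shows "STD (verts G)"
proof (rule STDI)
  fix u assume u: "u \<in> verts G"
  then show "\<exists>y\<in>verts G. tch u y" using tch_refl by blast
  have "{u} \<noteq> verts G" using assms by (metis singletonD)
  then have "{u} \<subset> verts G" using u by auto
  then obtain w where "adj G u w" using conn[of "{u}"] by auto
  then show "\<exists>y\<in>verts G. near u y" using nb_V2 nearI1 by blast
qed simp

text \<open>The merged vertex keeps the name \<open>b\<close>. Contraction does not increase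
  distances, so only companions equal to \<open>a\<close> are at risk; their role passes to
  \<open>b\<close>, while \<open>b\<close> itself is left with \<open>c\<close>.\<close>

lemma contract_triple:
  assumes D: "STD D" and abc: "a \<in> D" "b \<in> D" "c \<in> D" "adj G a b" "near b c" "c \<noteq> a"
  shows "semitotal_dom (contract G b a) (D - {a})"
proof -
  let ?H = "contract G b a"
  have ba: "b \<noteq> a" using nb_neq[OF abc(4)] by simp
  note H = adj_contract[OF ba, of G]
  have m: "adj ?H x y" if "adj G x y" "x \<noteq> a" "y \<noteq> a" for x y
    unfolding H using that nb_neq by blast
  have m1: "adj ?H x b" if "adj G x a" "x \<noteq> b" for x
    unfolding H using that ba nb_neq[OF that(1)] nb_sym[OF that(1)] by blast
  have m2: "adj ?H b x" if "adj G a x" "x \<noteq> b" for x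
    using m1[OF nb_sym[OF that(1)] that(2)] by (rule adj_sym)
  have w2: "within2 ?H x y" if xy: "near x y" "x \<noteq> a" "y \<noteq> a" for x y
  proof (cases "adj G x y")
    case True then show ?thesis using m[OF True] xy nb_neq[OF True] unfolding within2_def by blast
  next
    case False
    then obtain w where w: "adj G x w" "adj G w y" "x \<noteq> y" using xy(1) unfolding near_def by blast
    show ?thesis
    proof (cases "w = a")
      case False then show ?thesis using m w xy unfolding within2_def by blast
    next
      case wa: True
      have "x = b \<or> adj ?H x b" "y = b \<or> adj ?H b y" using m1 m2 w wa by blast+
      then show ?thesis using w(3) unfolding within2_def by blast
    qed
  qed
  have wb: "within2 ?H x b" if x: "near x a" "x \<noteq> b" for x
  proof (cases "adj G x a")
    case True then show ?thesis using m1 x unfolding within2_def by blast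
  next
    case False
    then obtain w where w: "adj G x w" "adj G w a" using x(1) unfolding near_def by blast
    have ne: "x \<noteq> a" "w \<noteq> a" using x(1) near_neq w(2) nb_neq by blast+
    show ?thesis
    proof (cases "w = b")
      case True then show ?thesis using m[OF w(1) ne(1)] ba x(2) unfolding within2_def by blast
    next
      case False then show ?thesis using m[OF w(1) ne] m1[OF w(2) False] x(2) unfolding within2_def by blast
    qed
  qed
  show ?thesis unfolding semitotal_dom_def verts_contract
  proof (intro conjI ballI)
    show "D - {a} \<subseteq> verts G - {a}" using STD_V[OF D] by blast
    fix x assume x: "x \<in> verts G - {a} - (D - {a})"
    then obtain y where y: "y \<in> D" "tch x y" using D unfolding STD_def by blast
    then have xy: "adj G x y" using x unfolding tch_def by blast
    show "\<exists>y\<in>D - {a}. adj ?H x y"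
    proof (cases "y = a")
      case True
      then have "adj ?H x b" using m1 xy x abc(2) by blast
      then show ?thesis using abc(2) ba by blast
    next
      case False then show ?thesis using m[OF xy] x y(1) by blast
    qed
  next
    fix x assume x: "x \<in> D - {a}"
    show "\<exists>y\<in>D - {a}. y \<noteq> x \<and> within2 ?H x y"
    proof (cases "x = b")
      case True
      have "within2 ?H b c" by (rule w2[OF abc(5) ba abc(6)])
      then show ?thesis using True abc(3,6) near_neq[OF abc(5)] by (intro bexI[of _ c]) auto
    next
      case False
      obtain y where y: "y \<in> D" "near x y" using D x unfolding STD_def by blast
      show ?thesis
      proof (cases "y = a")
        case True
        then have "within2 ?H x b" using wb y(2) False by blast
        then show ?thesis using abc(2) ba False by (intro bexI[of _ b]) auto
      next
        case ya: False
        then have "within2 ?H x y" using w2 y(2) x by blast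
        then show ?thesis using y(1) ya near_neq[OF y(2)] by (intro bexI[of _ y]) auto
      qed
    qed
  qed
qed

text \<open>If \<open>D\<close> contains the merged vertex, add \<open>v\<close>: its companion in
  the contracted graph is near \<open>u\<close> or \<open>v\<close>, which gives the triple.
  Otherwise add the end \<open>p\<close> of the edge that is adjacent to some \<open>y0\<close> in
  \<open>D\<close>. A companion \<open>y1\<close> of \<open>y0\<close> is either near
  \<open>y0\<close> in \<open>G\<close>, giving \<open>p\<close>, \<open>y0\<close>,
  \<open>y1\<close>, or was reached through the merged vertex and is near \<open>p\<close>, giving
  \<open>y0\<close>, \<open>p\<close>, \<open>y1\<close>.\<close>

lemma lift_contract:
  assumes uv: "adj G u v" and D: "semitotal_dom (contract G u v) D"
  shows "\<exists>D1. STD D1 \<and> card D1 \<le> card D + 1 \<and> triple D1"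
proof -
  let ?H = "contract G u v"
  have ne: "u \<noteq> v" by (rule nb_neq[OF uv])
  note H = adj_contract[OF ne, of G]
  have uV: "u \<in> verts G" "v \<in> verts G" using nb_V[OF uv] nb_V2[OF uv] by auto
  have D1: "D \<subseteq> verts G" "v \<notin> D" and D2: "\<And>x. x \<in> verts G \<Longrightarrow> x \<noteq> v \<Longrightarrow> x \<notin> D \<Longrightarrow> \<exists>y\<in>D. adj ?H x y"
    and D3: "\<And>x. x \<in> D \<Longrightarrow> \<exists>y\<in>D. y \<noteq> x \<and> within2 ?H x y"
    using D unfolding semitotal_dom_def verts_contract by blast+
  have c1: "card (insert x D) \<le> card D + 1" for x
    using D1(1) finV finite_subset by (metis Suc_eq_plus1 card_insert_if le_Suc_eq order_refl)
  have a0: "adj G x y" if "adj ?H x y" "x \<noteq> u" "y \<noteq> u" for x y using that unfolding H by blast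
  have a1: "adj G u y \<or> adj G v y" if "adj ?H u y" for y using that nb_sym unfolding H by blast
  have a2: "adj G x u \<or> adj G x v" if "adj ?H x u" for x using that nb_sym unfolding H by blast
  have vu: "adj G v u" by (rule nb_sym[OF uv])
  show ?thesis
  proof (cases "u \<in> D")
    case uD: True
    have fr: "near x y \<or> near x u \<or> near x v" if xy: "within2 ?H x y" "x \<noteq> u" "x \<noteq> v" for x y
    proof (cases "adj ?H x y")
      case True then show ?thesis using a0 a2 xy(2) nearI1 by metis
    next
      case False
      then obtain w where w: "adj ?H x w" "adj ?H w y" "x \<noteq> y" using xy(1) unfolding within2_def by blast
      show ?thesis
      proof (cases "w = u")
        case True then show ?thesis using a2 w(1) nearI1 by blast
      next
        case wu: False
        then have xw: "adj G x w" using a0 w(1) xy(2) by blast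
        show ?thesis
        proof (cases "y = u")
          case True
          then have "adj G w u \<or> adj G w v" using a2 w(2) by blast
          then show ?thesis using nearI2[OF xw] xy(2,3) by blast
        next
          case False
          then have "adj G w y" using a0 wu w(2) by blast
          then show ?thesis using nearI2[OF xw] w(3) by blast
        qed
      qed
    qed
    obtain y where y: "y \<in> D" "y \<noteq> u" "within2 ?H u y" using D3[OF uD] by blast
    have yv: "y \<noteq> v" using y(1) D1(2) by blast
    have uy: "near u y \<or> near v y"
    proof (cases "adj ?H u y")
      case True then show ?thesis using a1 nearI1 by blast
    next
      case False
      then obtain w where w: "adj ?H u w" "adj ?H w y" using y(3) unfolding within2_def by blast
      have "w \<noteq> u" using w(1) unfolding H by blast
      then have "adj G w y" using a0 w(2) y(2) by blast
      then show ?thesis using a1[OF w(1)] nearI2 y(2) yv by blast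
    qed
    have "STD (insert v D)"
    proof (rule STDI)
      show "insert v D \<subseteq> verts G" using D1 uV by blast
      fix x assume x: "x \<in> verts G"
      show "\<exists>y\<in>insert v D. tch x y"
      proof (cases "x = v \<or> x \<in> D")
        case True then show ?thesis using tch_refl by blast
      next
        case False
        then obtain y where y: "y \<in> D" "adj ?H x y" using D2 x by blast
        have xu: "x \<noteq> u" using False uD by blast
        then show ?thesis using a0[OF y(2)] a2 y nb_tch by (cases "y = u") blast+
      qed
    next
      fix x assume x: "x \<in> insert v D"
      show "\<exists>y\<in>insert v D. near x y"
      proof (cases "x = u \<or> x = v")
        case True then show ?thesis using uD nearI1[OF uv] nearI1[OF vu] by blast
      next
        case False
        then obtain y where "y \<in> D" "within2 ?H x y" using D3 x by blast
        then show ?thesis using fr False uD by blast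
      qed
    qed
    moreover have "triple (insert v D)"
      using uy
    proof
      assume "near u y" then show ?thesis by (rule tripleI[of v _ u y, rotated 4]) (use y yv uD vu in auto)
    next
      assume "near v y" then show ?thesis by (rule tripleI[of u _ v y, rotated 4]) (use y yv uD uv in auto)
    qed
    ultimately show ?thesis using c1 by blast
  next
    case uD: False
    obtain y0 where y0: "y0 \<in> D" "adj ?H u y0" using D2[OF uV(1) ne uD] by blast
    obtain p p' where p: "p = u \<and> p' = v \<or> p = v \<and> p' = u" "adj G p y0" using a1[OF y0(2)] by blast
    have pp: "adj G p' p" "p \<notin> D" "p' \<notin> D" "p \<in> verts G" using p uv vu uD D1 uV by auto
    have nu: "x \<noteq> u" "x \<noteq> v" "x \<noteq> p" "x \<noteq> p'" if "x \<in> D" for x using that uD D1 p by auto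
    have pu: "adj G x p \<or> adj G x p'" if "adj ?H x u" for x using a2[OF that] p(1) by blast
    have np: "near x p" if "adj ?H x u" "x \<in> D" for x
    proof (cases "adj G x p")
      case True then show ?thesis by (rule nearI1)
    next
      case False
      then have "adj G x p'" using pu that by blast
      then show ?thesis using nearI2[OF _ pp(1)] nu(3)[OF that(2)] by blast
    qed
    have frd: "near x y \<or> (adj ?H x u \<and> adj ?H u y)" if xy: "within2 ?H x y" "x \<in> D" "y \<in> D" for x y
    proof (cases "adj ?H x y")
      case True then show ?thesis using a0 nu xy nearI1 by blast
    next
      case False
      then obtain w where w: "adj ?H x w" "adj ?H w y" "x \<noteq> y" using xy(1) unfolding within2_def by blast
      show ?thesis
      proof (cases "w = u")
        case True then show ?thesis using w by blast
      next
        case False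
        then have "adj G x w" "adj G w y" using a0 w nu xy by blast+
        then show ?thesis using nearI2 w(3) by blast
      qed
    qed
    have "STD (insert p D)"
    proof (rule STDI)
      show "insert p D \<subseteq> verts G" using D1 pp by blast
      fix x assume x: "x \<in> verts G"
      show "\<exists>y\<in>insert p D. tch x y"
      proof (cases "x = p \<or> x = p' \<or> x \<in> D")
        case True then show ?thesis using tch_refl nb_tch[OF pp(1)] by blast
      next
        case False
        then have xx: "x \<noteq> u" "x \<noteq> v" "x \<notin> D" using p(1) by blast+
        then obtain y where y: "y \<in> D" "adj ?H x y" using D2 x by blast
        then have "adj G x y" using a0 xx(1) nu by blast
        then show ?thesis using y nb_tch by blast
      qed
    next
      fix x assume x: "x \<in> insert p D"
      show "\<exists>y\<in>insert p D. near x y"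
      proof (cases "x = p")
        case True then show ?thesis using nearI1[OF p(2)] y0 by blast
      next
        case False
        then obtain y where "x \<in> D" "y \<in> D" "within2 ?H x y" using D3 x by blast
        then show ?thesis using frd np by blast
      qed
    qed
    moreover have "triple (insert p D)"
    proof -
      obtain y1 where y1: "y1 \<in> D" "y1 \<noteq> y0" "within2 ?H y0 y1" using D3[OF y0(1)] by blast
      show ?thesis
        using frd[OF y1(3) y0(1) y1(1)]
      proof
        assume n: "near y0 y1"
        show ?thesis by (rule tripleI[of p _ y0 y1]) (use y0 y1 p n nu in auto)
      next
        assume n: "adj ?H y0 u \<and> adj ?H u y1"
        then have "near y1 p" using np adj_sym y1(1) by blast
        then have "near p y1" by (rule near_sym)
        then show ?thesis by (rule tripleI[of y0 _ p y1, rotated 4]) (use y0 y1 nb_sym[OF p(2)] in auto)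
      qed
    qed
    ultimately show ?thesis using c1 by blast
  qed
qed

text \<open>Contracting inside a triple saves one vertex, and lifting a set of the contracted graph
  costs at most one, so a strictly smaller set lifts to one of at most the minimum size.\<close>

theorem one_edge_iff:
  "one_edge_contraction G \<longleftrightarrow> (\<exists>D. STD D \<and> card D \<le> gamma_t2 G \<and> triple D)"
proof
  assume "one_edge_contraction G"
  then obtain u v where uv: "adj G u v" "gamma_t2 (contract G u v) < gamma_t2 G"
    "\<exists>D. semitotal_dom (contract G u v) D" unfolding one_edge_contraction_def by blast
  have "\<exists>n D. semitotal_dom (contract G u v) D \<and> card D = n" using uv(3) by blast
  from LeastI_ex[OF this] obtain D where D: "semitotal_dom (contract G u v) D" "card D = gamma_t2 (contract G u v)"
    unfolding gamma_t2_def by blast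
  from lift_contract[OF uv(1) D(1)] obtain D1 where "STD D1" "card D1 \<le> card D + 1" "triple D1" by blast
  then show "\<exists>D. STD D \<and> card D \<le> gamma_t2 G \<and> triple D" using D(2) uv(2) by (intro exI[of _ D1]) simp
next
  assume "\<exists>D. STD D \<and> card D \<le> gamma_t2 G \<and> triple D"
  then obtain D a b c where D: "STD D" "card D \<le> gamma_t2 G"
    and abc: "a \<in> D" "b \<in> D" "c \<in> D" "adj G a b" "near b c" "c \<noteq> a" unfolding triple_def by blast
  note S = contract_triple[OF D(1) abc]
  have "gamma_t2 (contract G b a) \<le> card (D - {a})" unfolding gamma_t2_def
    by (rule Least_le) (use S in blast)
  also have "\<dots> < card D" using card_Diff1_less[OF STD_fin[OF D(1)] abc(1)] .
  finally show "one_edge_contraction G" unfolding one_edge_contraction_def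
    using D(2) S nb_sym[OF abc(4)] by (intro exI[of _ b] exI[of _ a]) auto
qed

section \<open>Reduction to conditions on boundedly many vertices\<close>

lemma P3_kP2_free_free: assumes fr: "P3_kP2_free k G" shows "free k"
proof (rule ccontr)
  assume "\<not> ?thesis"
  then obtain L x y z where L: "finite L" "imatch L" "P3 x y z" "k \<le> card L"
    and un: "\<And>p. p \<in> L \<Longrightarrow> \<not> touch x p \<and> \<not> touch y p \<and> \<not> touch z p" unfolding free_def using not_less by blast
  obtain L' where L': "L' \<subseteq> L" "card L' = k" "finite L'" using obtain_subset_with_card_n[OF L(4)] by metis
  obtain h where h: "bij_betw h {0..<k} L'" using ex_bij_betw_nat_finite[OF L'(3)] L'(2) by auto
  have hL: "h t \<in> L" if "t < k" for t using bij_betwE[OF h] that L'(1) by auto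
  have hi: "t = t'" if "t < k" "t' < k" "h t = h t'" for t t'
    using bij_betw_imp_inj_on[OF h] that unfolding inj_on_def by simp
  define f where "f i = (if i = 0 then x else if i = 1 then y else if i = 2 then z else
      if odd i then fst (h ((i-3) div 2)) else snd (h ((i-3) div 2)))" for i :: nat
  have f012: "f 0 = x" "f (Suc 0) = y" "f 2 = z" unfolding f_def by auto
  have fl: "f (3 + 2*t) = fst (h t)" "f (4 + 2*t) = snd (h t)" for t unfolding f_def by auto
  have cases: "i = 0 \<or> i = Suc 0 \<or> i = 2 \<or> (\<exists>t<k. i = 3 + 2*t \<or> i = 4 + 2*t)" if "i < 2*k+3" for i :: nat
    using that by presburger
  have Ps: "P3_kP2_adj k i j = P3_kP2_adj k j i" for i j unfolding P3_kP2_adj_def by (simp add: insert_commute)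
  have PE: "(i = 0 \<and> j = Suc 0 \<or> i = Suc 0 \<and> j = 2) \<or> (\<exists>t. i = 3 + 2*t \<and> j = 4 + 2*t)"
    if "P3_kP2_adj k i j" "i < j" for i j
    using that unfolding P3_kP2_adj_def doubleton_eq_iff by auto
  have xyz: "adj G x y" "adj G y z" "\<not> adj G x z" "x \<noteq> z" "x \<noteq> y" "y \<noteq> z"
    using L(3) nb_neq unfolding P3_def tch_def by blast+
  have leg: "adj G (fst (h t)) (snd (h t))" "fst (h t) \<noteq> snd (h t)" if "t < k" for t
    using L(2) hL[OF that] nb_neq unfolding imatch_def by blast+
  have main: "f i \<noteq> f j \<and> (adj G (f i) (f j) \<longleftrightarrow> P3_kP2_adj k i j)" if ij: "i < j" "j < 2*k+3" for i j
  proof -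
    have i: "i < 2*k+3" using ij by simp
    consider (a) "i \<le> 2" "j \<le> 2" | (b) t where "i \<le> 2" "t < k" "j = 3 + 2*t \<or> j = 4 + 2*t"
      | (c) s t where "s < k" "t < k" "i = 3 + 2*s \<or> i = 4 + 2*s" "j = 3 + 2*t \<or> j = 4 + 2*t"
    proof -
      have "i \<le> 2 \<and> j \<le> 2 \<or> i \<le> 2 \<and> (\<exists>t<k. j = 3 + 2*t \<or> j = 4 + 2*t) \<or>
        (\<exists>s<k. \<exists>t<k. (i = 3 + 2*s \<or> i = 4 + 2*s) \<and> (j = 3 + 2*t \<or> j = 4 + 2*t))"
      proof (cases "j \<le> 2")
        case True then show ?thesis using ij(1) by simp
      next
        case False
        then have "\<exists>t<k. j = 3 + 2*t \<or> j = 4 + 2*t" using cases[OF ij(2)] by auto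
        moreover have "i \<le> 2 \<or> (\<exists>t<k. i = 3 + 2*t \<or> i = 4 + 2*t)" using cases[OF i] by auto
        ultimately show ?thesis by blast
      qed
      then show ?thesis using that by blast
    qed
    then show ?thesis
    proof cases
      case a
      then consider "i = 0" "j = Suc 0" | "i = 0" "j = 2" | "i = Suc 0" "j = 2" using ij(1) by linarith
      then show ?thesis
        by cases (use xyz f012 in \<open>auto simp: P3_kP2_adj_def doubleton_eq_iff\<close>)
    next
      case b
      have fi: "f i \<in> {x,y,z}" using b(1) f012 by (auto simp: le_Suc_eq numeral_2_eq_2)
      then have "\<not> touch (f i) (h t)" using un[OF hL[OF b(2)]] by auto
      then have "\<not> tch (f i) (f j)" using b(3) fl unfolding touch_def by auto
      moreover have "\<not> P3_kP2_adj k i j" using PE[OF _ ij(1)] b(1,3) by fastforce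
      ultimately show ?thesis unfolding tch_def by blast
    next
      case c
      show ?thesis
      proof (cases "s = t")
        case True
        then have "i = 3 + 2*t" "j = 4 + 2*t" using c(3,4) ij(1) by auto
        then show ?thesis using leg[OF c(2)] c(2) fl unfolding P3_kP2_adj_def by auto
      next
        case False
        then have "h s \<noteq> h t" using hi c(1,2) by blast
        then have "\<not> touch (fst (h s)) (h t) \<and> \<not> touch (snd (h s)) (h t)"
          using L(2) hL[OF c(1)] hL[OF c(2)] unfolding imatch_def by blast
        then have "\<not> tch (f i) (f j)" using c(3,4) fl unfolding touch_def by auto
        moreover have "\<not> P3_kP2_adj k i j"
        proof
          assume "P3_kP2_adj k i j"
          from PE[OF this ij(1)] have "\<exists>t. i = 3 + 2*t \<and> j = 4 + 2*t" using c(3,4) by auto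
          then obtain t' where "i = 3 + 2*t'" "j = 4 + 2*t'" by blast
          then have "s = t'" "t = t'" using c(3,4) by presburger+
          then show False using False by simp
        qed
        ultimately show ?thesis unfolding tch_def by blast
      qed
    qed
  qed
  have main': "f i \<noteq> f j \<and> (adj G (f i) (f j) \<longleftrightarrow> P3_kP2_adj k i j)" if "i \<noteq> j" "i < 2*k+3" "j < 2*k+3" for i j
  proof (cases "i < j")
    case True then show ?thesis using main that by blast
  next
    case False
    then have "j < i" using that by simp
    from main[OF this that(2)] show ?thesis using Ps[of i j] nb_comm[of "f i" "f j"] by metis
  qed
  have "inj_on f {0..<2*k+3}" unfolding inj_on_def using main' by fastforce
  moreover have "f ` {0..<2*k+3} \<subseteq> verts G"
  proof
    fix v assume "v \<in> f ` {0..<2*k+3}"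
    then obtain i where i: "v = f i" "i < 2*k+3" by auto
    show "v \<in> verts G"
      using cases[OF i(2)] f012 fl xyz leg nb_V nb_V2 i(1) by metis
  qed
  ultimately show False using fr main' unfolding P3_kP2_free_def by blast
qed

text \<open>A numeric bound replaces the unknown minimum, so that for fixed \<open>s\<close> only
  \<open>s\<close> vertices need to be quantified.\<close>

definition Agood :: "nat \<Rightarrow> bool" where "Agood s \<longleftrightarrow> (\<exists>D. STD D \<and> card D \<le> s)"
definition Tgood :: "nat \<Rightarrow> bool" where "Tgood s \<longleftrightarrow> (\<exists>D. STD D \<and> card D \<le> s \<and> triple D)"
definition Mgood :: "nat \<Rightarrow> bool" where
  "Mgood k \<longleftrightarrow> (\<exists>L. finite L \<and> imatch L \<and> card L = 9*k+10 \<and> legs_good k L)"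

text \<open>Below \<open>C\<close> the minimum is recognised as the only \<open>s\<close> that can
  satisfy the first alternative; from \<open>C\<close> on \<open>large_characterisation\<close>
  takes over. Two distinct vertices are demanded because a single vertex has no STD set at all and
  would pass as having a large minimum.\<close>

theorem local_characterisation:
  assumes fr: "P3_kP2_free k G" and C: "C = size_bound k ((k+2)*(9*k+10) + 2*k + 4)"
  shows "one_edge_contraction G \<longleftrightarrow>
    (\<exists>s<C. Tgood s \<and> \<not> Agood (s - 1)) \<or>
    (\<not> Agood (C - 1) \<and> \<not> Mgood k \<and> (\<exists>x\<in>verts G. \<exists>y\<in>verts G. x \<noteq> y))"
proof (cases "\<exists>x\<in>verts G. \<exists>y\<in>verts G. x \<noteq> y")
  case False
  have "\<not> triple D" if "STD D" for D
    using that False STD_V[OF that] nb_neq unfolding triple_def by blast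
  then show ?thesis using False unfolding one_edge_iff Tgood_def by blast
next
  case True
  then have V: "STD (verts G)" using STD_verts by blast
  obtain D0 where D0: "STD D0" "card D0 = gamma_t2 G" using gamma_attained[OF V] by blast
  have C0: "0 < C" unfolding C size_bound_def by (simp add: Let_def)
  have A: "Agood s \<longleftrightarrow> gamma_t2 G \<le> s" for s unfolding Agood_def using D0 gamma_le le_trans by metis
  have T: "Tgood s \<longrightarrow> gamma_t2 G \<le> s \<and> 0 < s" for s
  proof
    assume "Tgood s"
    then obtain D where D: "STD D" "card D \<le> s" "triple D" unfolding Tgood_def by blast
    then have "D \<noteq> {}" unfolding triple_def by blast
    then have "0 < card D" using STD_fin[OF D(1)] by (simp add: card_gt_0_iff)
    then show "gamma_t2 G \<le> s \<and> 0 < s" using gamma_le[OF D(1)] D(2) by simp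
  qed
  have oT: "one_edge_contraction G \<longleftrightarrow> Tgood (gamma_t2 G)" unfolding one_edge_iff Tgood_def ..
  \<comment> \<open>\<open>Tgood 0\<close> is false, so the truncated \<open>s - 1\<close> does no
    harm at \<open>s = 0\<close>.\<close>
  have Ts: "Tgood s \<and> \<not> Agood (s - 1) \<longleftrightarrow> s = gamma_t2 G \<and> Tgood s" for s
    using T[of s] A[of "s - 1"] by auto
  show ?thesis
  proof (cases "gamma_t2 G < C")
    case True
    then have "Agood (C - 1)" unfolding A by simp
    then show ?thesis using oT Ts True by metis
  next
    case False
    then have "\<not> Agood (C - 1)" unfolding A using C0 by simp
    moreover have "one_edge_contraction G \<longleftrightarrow> \<not> Mgood k" unfolding one_edge_iff Mgood_def
      by (rule large_characterisation[OF P3_kP2_free_free[OF fr] conn D0 gamma_le]) (use False C in auto)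
    ultimately show ?thesis using Ts False True by auto
  qed
qed

end

section \<open>Counter programs on Turing machines\<close>

text \<open>\<open>Rd i\<close> branches on the input symbol at the position held by counter
  \<open>i\<close>: blank, bit False, bit True. Programs are shown countable so that control states
  containing them can be numbered.\<close>

datatype com = Inc nat | Dec nat | Seq com com | IfZ nat com com | While nat com | Rd nat com com com

instance com :: countable by countable_datatype

inductive ex :: "(nat \<Rightarrow> nat) \<Rightarrow> com \<Rightarrow> (nat \<Rightarrow> nat) \<Rightarrow> nat \<Rightarrow> (nat \<Rightarrow> nat) \<Rightarrow> bool" for rd where
  ex_Inc: "ex rd (Inc i) s 1 (s(i := s i + 1))"
| ex_Dec: "ex rd (Dec i) s 1 (s(i := s i - 1))"
| ex_Seq: "ex rd a s t1 s1 \<Longrightarrow> ex rd b s1 t2 s2 \<Longrightarrow> ex rd (Seq a b) s (t1 + t2 + 1) s2"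
| ex_IfZ: "s i = 0 \<Longrightarrow> ex rd a s t s1 \<Longrightarrow> ex rd (IfZ i a b) s (t + 1) s1"
| ex_IfN: "s i \<noteq> 0 \<Longrightarrow> ex rd b s t s1 \<Longrightarrow> ex rd (IfZ i a b) s (t + 1) s1"
| ex_WhZ: "s i = 0 \<Longrightarrow> ex rd (While i a) s 1 s"
| ex_WhN: "s i \<noteq> 0 \<Longrightarrow> ex rd a s t1 s1 \<Longrightarrow> ex rd (While i a) s1 t2 s2 \<Longrightarrow> ex rd (While i a) s (t1 + t2 + 1) s2"
| ex_Rd0: "rd (s i) = 0 \<Longrightarrow> ex rd a s t s1 \<Longrightarrow> ex rd (Rd i a b d) s (t + 1) s1"
| ex_Rd1: "rd (s i) = 1 \<Longrightarrow> ex rd b s t s1 \<Longrightarrow> ex rd (Rd i a b d) s (t + 1) s1"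
| ex_Rd2: "rd (s i) \<noteq> 0 \<Longrightarrow> rd (s i) \<noteq> 1 \<Longrightarrow> ex rd d s t s1 \<Longrightarrow> ex rd (Rd i a b d) s (t + 1) s1"

text \<open>A machine with a stack of pending programs, arranged to take exactly one step for each
  unit of time charged by \<open>ex\<close>.\<close>

fun sstep :: "(nat \<Rightarrow> nat) \<Rightarrow> com list \<times> (nat \<Rightarrow> nat) \<Rightarrow> com list \<times> (nat \<Rightarrow> nat)" where
  "sstep rd ([], s) = ([], s)"
| "sstep rd (Inc i # K, s) = (K, s(i := s i + 1))"
| "sstep rd (Dec i # K, s) = (K, s(i := s i - 1))"
| "sstep rd (Seq a b # K, s) = (a # b # K, s)"
| "sstep rd (IfZ i a b # K, s) = ((if s i = 0 then a else b) # K, s)"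
| "sstep rd (While i a # K, s) = (if s i = 0 then K else a # While i a # K, s)"
| "sstep rd (Rd i a b d # K, s) = ((if rd (s i) = 0 then a else if rd (s i) = 1 then b else d) # K, s)"

lemma funpow_plus: "(f ^^ (a + b)) x = (f ^^ b) ((f ^^ a) x)"
  by (metis add.commute comp_apply funpow_add)

lemma ex_sstep: "ex rd c s t s' \<Longrightarrow> (sstep rd ^^ t) (c # K, s) = (K, s')"
proof (induction arbitrary: K rule: ex.induct)
  case (ex_Seq a s t1 s1 b t2 s2)
  have "(sstep rd ^^ (1 + (t1 + t2))) (Seq a b # K, s) = (K, s2)"
    unfolding funpow_plus using ex_Seq by simp
  then show ?case by (simp add: add.commute)
next
  case (ex_WhN s i a t1 s1 t2 s2)
  have "(sstep rd ^^ (1 + (t1 + t2))) (While i a # K, s) = (K, s2)"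
    unfolding funpow_plus using ex_WhN by simp
  then show ?case by (simp add: add.commute)
qed (simp_all add: funpow_swap1)

text \<open>\<open>At K ph\<close> executes the top of the stack \<open>K\<close>, with
  \<open>ph = 1\<close> while a lifted mark is to be set down on the next cell;
  \<open>Back K\<close> returns the head to cell 0.\<close>

datatype ast = Init | Acc | Rej | At "com list" nat | Back "com list"

instance ast :: countable by countable_datatype

text \<open>With no marks this is the raw symbol, so the initial tape is already encoded except at
  cell 0.\<close>

definition enc :: "nat \<Rightarrow> nat \<Rightarrow> nat set \<Rightarrow> nat" where "enc c b M = b + 3 * set_encode (M \<inter> {..c})"
definition msk :: "nat \<Rightarrow> nat set" where "msk x = set_decode (x div 3)"
definition bas :: "nat \<Rightarrow> nat" where "bas x = x mod 3"

lemma enc_simps [simp]: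
  "b < 3 \<Longrightarrow> bas (enc c b M) = b" "b < 3 \<Longrightarrow> msk (enc c b M) = M \<inter> {..c}"
  unfolding bas_def msk_def enc_def by auto

lemma enc_empty: "enc c b {} = b" unfolding enc_def by simp

lemma enc_less: assumes "b < 3" shows "enc c b M < 3 * 2 ^ Suc c"
proof -
  have "set_encode (M \<inter> {..c}) \<le> sum ((^) 2) {..c}"
    unfolding set_encode_def by (simp add: sum_mono2)
  also have "\<dots> < 2 ^ Suc c" using sum_power2[of "Suc c"] by (simp add: lessThan_Suc_atMost[symmetric] atLeast0LessThan del: sum.lessThan_Suc)
  finally have "set_encode (M \<inter> {..c}) + 1 \<le> 2 ^ Suc c" by simp
  then have "3 * (set_encode (M \<inter> {..c}) + 1) \<le> 3 * 2 ^ Suc c" by (rule mult_le_mono2)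
  then show ?thesis unfolding enc_def using assms by simp
qed

text \<open>Counter \<open>i\<close> is stored as a mark of colour \<open>i\<close> on the cell of that number, and colour \<open>c\<close> marks
  cell 0.  A cell contains its original symbol together with the set of colours on it.\<close>

fun dstep :: "nat \<Rightarrow> com \<Rightarrow> ast \<Rightarrow> nat \<Rightarrow> ast \<times> nat \<times> int" where
  "dstep c m Init x = (At [m] 0, enc c (bas x) {..c}, 0)"
| "dstep c m Acc x = (Acc, x, 0)"
| "dstep c m Rej x = (Rej, x, 0)"
| "dstep c m (Back K) x = (if c \<in> msk x then (At K 0, x, 0) else (Back K, x, -1))"
| "dstep c m (At [] ph) x = (if 0 \<in> msk x then Rej else Acc, x, 0)"
| "dstep c m (At (Inc i # K) ph) x =
    (if ph = 0 then if i \<in> msk x then (At (Inc i # K) 1, enc c (bas x) (msk x - {i}), 1) else (At (Inc i # K) 0, x, 1)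
     else (Back K, enc c (bas x) (insert i (msk x)), 0))"
| "dstep c m (At (Dec i # K) ph) x =
    (if ph = 0 then
       if i \<in> msk x then if c \<in> msk x then (Back K, x, 0) else (At (Dec i # K) 1, enc c (bas x) (msk x - {i}), -1)
       else (At (Dec i # K) 0, x, 1)
     else (Back K, enc c (bas x) (insert i (msk x)), 0))"
| "dstep c m (At (Seq a b # K) ph) x = (At (a # b # K) 0, x, 0)"
| "dstep c m (At (IfZ i a b # K) ph) x = (At ((if i \<in> msk x then a else b) # K) 0, x, 0)"
| "dstep c m (At (While i a # K) ph) x = (At (if i \<in> msk x then K else a # While i a # K) 0, x, 0)"
| "dstep c m (At (Rd i a b d # K) ph) x =
    (if i \<in> msk x then (Back ((if bas x = 0 then a else if bas x = 1 then b else d) # K), x, 0)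
     else (At (Rd i a b d # K) 0, x, 1))"

text \<open>All stacks that can arise while \<open>c\<close> runs above \<open>K\<close>. They are
  finitely many because \<open>While\<close> pushes back the same stack after each round; this makes
  the control of the machine finite.\<close>

fun cl :: "com \<Rightarrow> com list \<Rightarrow> com list set" where
  "cl (Inc i) K = {Inc i # K}"
| "cl (Dec i) K = {Dec i # K}"
| "cl (Seq a b) K = insert (Seq a b # K) (cl a (b # K) \<union> cl b K)"
| "cl (IfZ i a b) K = insert (IfZ i a b # K) (cl a K \<union> cl b K)"
| "cl (While i a) K = insert (While i a # K) (cl a (While i a # K))"
| "cl (Rd i a b d) K = insert (Rd i a b d # K) (cl a K \<union> cl b K \<union> cl d K)"

lemma cl_self: "c # K \<in> cl c K" by (cases c) auto
lemma finite_cl: "finite (cl c K)" by (induction c arbitrary: K) auto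

lemma cl_step: "x \<in> cl c K \<Longrightarrow> fst (sstep rd (x, s)) \<in> insert K (cl c K)"
proof (induction c arbitrary: K)
  case (Seq a b)
  then consider "x = Seq a b # K" | "x \<in> cl a (b # K)" | "x \<in> cl b K" by auto
  then show ?case
  proof cases
    case 1 then show ?thesis using cl_self[of a "b # K"] by simp
  next
    case 2 then show ?thesis using Seq.IH(1)[OF 2] cl_self[of b K] by auto
  next
    case 3 then show ?thesis using Seq.IH(2)[OF 3] by auto
  qed
next
  case (IfZ i a b)
  then consider "x = IfZ i a b # K" | "x \<in> cl a K" | "x \<in> cl b K" by auto
  then show ?case
  proof cases
    case 1 then show ?thesis using cl_self[of a K] cl_self[of b K] by simp
  next
    case 2 then show ?thesis using IfZ.IH(1)[OF 2] by auto
  next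
    case 3 then show ?thesis using IfZ.IH(2)[OF 3] by auto
  qed
next
  case (While i a)
  then consider "x = While i a # K" | "x \<in> cl a (While i a # K)" by auto
  then show ?case
  proof cases
    case 1 then show ?thesis using cl_self[of a "While i a # K"] by simp
  next
    case 2 then show ?thesis using While.IH[OF 2] by auto
  qed
next
  case (Rd i a b d)
  then consider "x = Rd i a b d # K" | "x \<in> cl a K" | "x \<in> cl b K" | "x \<in> cl d K" by auto
  then show ?case
  proof cases
    case 1 then show ?thesis using cl_self[of a K] cl_self[of b K] cl_self[of d K] by simp
  next
    case 2 then show ?thesis using Rd.IH(1)[OF 2] by auto
  next
    case 3 then show ?thesis using Rd.IH(2)[OF 3] by auto
  next
    case 4 then show ?thesis using Rd.IH(3)[OF 4] by auto
  qed
qed auto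

definition ST :: "com \<Rightarrow> com list set" where "ST m = insert [] (cl m [])"

lemma ST_step: assumes "x \<in> ST m" shows "fst (sstep rd (x, s)) \<in> ST m"
  using assms cl_step[of x m "[]" rd s] unfolding ST_def by auto

definition QS :: "com \<Rightarrow> ast set" where
  "QS m = {Init, Acc, Rej} \<union> (\<lambda>(K, ph). At K ph) ` (ST m \<times> {0, 1}) \<union> Back ` ST m"

lemma finite_QS: "finite (QS m)" unfolding QS_def ST_def using finite_cl by simp

lemma QS_At [simp]: "At K ph \<in> QS m \<longleftrightarrow> K \<in> ST m \<and> ph \<in> {0,1}" unfolding QS_def by auto
lemma QS_Back [simp]: "Back K \<in> QS m \<longleftrightarrow> K \<in> ST m" unfolding QS_def by auto
lemma QS_base [simp]: "Init \<in> QS m" "Acc \<in> QS m" "Rej \<in> QS m" unfolding QS_def by auto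
lemma ST_m: "[m] \<in> ST m" unfolding ST_def using cl_self by blast

lemma dstep_ok:
  assumes q: "q \<in> QS m" and x: "x < 3 * 2 ^ Suc c" and st: "dstep c m q x = (q', y, d)"
  shows "q' \<in> QS m \<and> y < 3 * 2 ^ Suc c \<and> d \<in> {-1, 0, 1}"
proof -
  have b: "bas x < 3" unfolding bas_def by simp
  note E = enc_less[OF b]
  show ?thesis
  proof (cases q)
    case (At K ph)
    then have K: "K \<in> ST m" using q by simp
    note S = ST_step[OF K]
    \<comment> \<open>Constant counters and constant inputs force both outcomes of the zero test and
      all three symbols, so \<open>S'\<close> covers every successor stack.\<close>
    define one where "one = (\<lambda>_::nat. 1::nat)"
    define zero where "zero = (\<lambda>_::nat. 0::nat)"
    define two where "two = (\<lambda>_::nat. 2::nat)"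
    note S' = S[of zero zero] S[of zero one] S[of one zero] S[of two zero]
    show ?thesis
    proof (cases K)
      case Nil then show ?thesis using st At x by (auto split: if_splits)
    next
      case (Cons a K')
      then show ?thesis using st At x E K S'
        by (cases a) (auto split: if_splits simp: zero_def one_def two_def)
    qed
  next
    case (Back K) then show ?thesis using st x q by (auto split: if_splits)
  qed (use st x E ST_m in auto)
qed

text \<open>The numbers 0, 1, 2 are prescribed for the start, accepting and rejecting state.\<close>

definition cd :: "ast \<Rightarrow> nat" where
  "cd q = (case q of Init \<Rightarrow> 0 | Acc \<Rightarrow> 1 | Rej \<Rightarrow> 2 | _ \<Rightarrow> 3 + to_nat q)"

lemma cd_inj: "cd q = cd q' \<Longrightarrow> q = q'"
  unfolding cd_def by (auto split: ast.splits)

lemma cd_simps: "cd Init = 0" "cd Acc = 1" "cd Rej = 2" unfolding cd_def by auto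

lemma cd_halt: "cd q = 1 \<or> cd q = 2 \<longleftrightarrow> q = Acc \<or> q = Rej"
  using cd_inj[of q Acc] cd_inj[of q Rej] cd_simps by auto

definition ctm :: "nat \<Rightarrow> com \<Rightarrow> tm" where
  "ctm c m q x = (if q \<in> cd ` QS m \<and> x < 3 * 2 ^ Suc c
     then (case dstep c m (inv_into (QS m) cd q) x of (q', y, d) \<Rightarrow> (cd q', y, d)) else (2, 0, 0))"

lemma inv_cd: "q \<in> QS m \<Longrightarrow> inv_into (QS m) cd (cd q) = q"
  by (rule inv_into_f_f) (auto intro: inj_onI cd_inj)

lemma ctm_valid: "valid_tm (Suc (Max (cd ` QS m))) (3 * 2 ^ Suc c) (ctm c m)"
proof -
  have le: "cd q < Suc (Max (cd ` QS m))" if "q \<in> QS m" for q using finite_QS that by (simp add: less_Suc_eq_le)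
  have 2: "2 < Suc (Max (cd ` QS m))" using le[of Rej] cd_simps by simp
  show ?thesis unfolding valid_tm_def
  proof (intro conjI allI impI)
    show "3 \<le> Suc (Max (cd ` QS m))" using 2 by simp
    show "3 \<le> (3::nat) * 2 ^ Suc c" by simp
    fix q x assume x: "x < (3::nat) * 2 ^ Suc c"
    show "case ctm c m q x of (q', s', d) \<Rightarrow> q' < Suc (Max (cd ` QS m)) \<and> s' < 3 * 2 ^ Suc c \<and> d \<in> {-1, 0, 1}"
    proof (cases "q \<in> cd ` QS m")
      case False then show ?thesis using 2 unfolding ctm_def by simp
    next
      case True
      then obtain q0 where q0: "q0 \<in> QS m" "q = cd q0" by blast
      obtain q' y d where st: "dstep c m q0 x = (q', y, d)" by (cases "dstep c m q0 x") auto
      have "ctm c m q x = (cd q', y, d)" unfolding ctm_def using q0 x st inv_cd[OF q0(1)] by simp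
      then show ?thesis using dstep_ok[OF q0(1) x st] le by simp
    qed
  qed
qed

definition astep :: "nat \<Rightarrow> com \<Rightarrow> ast \<times> (int \<Rightarrow> nat) \<times> int \<Rightarrow> ast \<times> (int \<Rightarrow> nat) \<times> int" where
  "astep c m g = (case g of (q, tp, h) \<Rightarrow> if q = Acc \<or> q = Rej then (q, tp, h)
     else (case dstep c m q (tp h) of (q', y, d) \<Rightarrow> (q', tp(h := y), h + d)))"

lemma ctm_astep:
  assumes "q \<in> QS m" "\<forall>p. tp p < 3 * 2 ^ Suc c" "(astep c m ^^ T) (q, tp, h) = (q', tp', h')"
  shows "(tm_step (ctm c m) ^^ T) (cd q, tp, h) = (cd q', tp', h') \<and> q' \<in> QS m \<and> (\<forall>p. tp' p < 3 * 2 ^ Suc c)"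
  using assms
proof (induction T arbitrary: q' tp' h')
  case 0 then show ?case by simp
next
  case (Suc T)
  obtain q1 tp1 h1 where 1: "(astep c m ^^ T) (q, tp, h) = (q1, tp1, h1)" by (cases "(astep c m ^^ T) (q, tp, h)") auto
  note IH = Suc.IH[OF Suc.prems(1,2) 1]
  have 2: "astep c m (q1, tp1, h1) = (q', tp', h')" using Suc.prems(3) 1 by simp
  show ?case
  proof (cases "q1 = Acc \<or> q1 = Rej")
    case True
    then show ?thesis using IH 2 cd_halt[of q1] unfolding astep_def tm_step_def by auto
  next
    case False
    obtain q2 y d where st: "dstep c m q1 (tp1 h1) = (q2, y, d)" by (cases "dstep c m q1 (tp1 h1)") auto
    have q1: "q1 \<in> QS m" and t1: "tp1 h1 < 3 * 2 ^ Suc c" using IH by auto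
    have e: "q' = q2" "tp' = tp1(h1 := y)" "h' = h1 + d" using 2 False st unfolding astep_def by auto
    have "ctm c m (cd q1) (tp1 h1) = (cd q2, y, d)" unfolding ctm_def using q1 t1 st inv_cd[OF q1] by simp
    then show ?thesis using IH e False cd_halt[of q1] dstep_ok[OF q1 t1 st] unfolding tm_step_def by auto
  qed
qed

definition tape :: "nat \<Rightarrow> (int \<Rightarrow> nat) \<Rightarrow> (nat \<Rightarrow> nat) \<Rightarrow> int \<Rightarrow> nat" where
  "tape c base s p = enc c (base p) ({i. i < c \<and> int (s i) = p} \<union> (if p = 0 then {c} else {}))"

fun tops :: "com list \<Rightarrow> nat set" where
  "tops [] = {}" | "tops (Inc i # K) = {i}" | "tops (Dec i # K) = {i}" | "tops (Seq a b # K) = {}"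
| "tops (IfZ i a b # K) = {i}" | "tops (While i a # K) = {i}" | "tops (Rd i a b d # K) = {i}"

locale sim =
  fixes c :: nat and m :: com and base :: "int \<Rightarrow> nat"
  assumes base: "base p < 3"
begin

abbreviation "tp s \<equiv> tape c base s"
abbreviation "go t \<equiv> (astep c m ^^ t)"

lemma bas_tp [simp]: "bas (tp s p) = base p" unfolding tape_def using base by simp
lemma msk_i: "i < c \<Longrightarrow> i \<in> msk (tp s p) \<longleftrightarrow> int (s i) = p" unfolding tape_def using base by auto
lemma msk_c: "c \<in> msk (tp s p) \<longleftrightarrow> p = 0" unfolding tape_def using base by auto
lemma msk_tp: "msk (tp s p) = {i. i < c \<and> int (s i) = p} \<union> (if p = 0 then {c} else {})"
  unfolding tape_def using base by auto

lemma seek: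
  assumes "q \<noteq> Acc" "q \<noteq> Rej" "\<And>h. h < j \<Longrightarrow> dstep c m q (t (int h)) = (q, t (int h), 1)"
  shows "go j (q, t, 0) = (q, t, int j)"
  using assms(3)
proof (induction j)
  case (Suc j) then show ?case using assms(1,2) by (simp add: astep_def)
qed simp

lemma rewind: "go (Suc j) (Back K, tp s, int j) = (At K 0, tp s, 0)"
proof (induction j)
  case 0 then show ?case by (simp add: astep_def msk_c)
next
  case (Suc j)
  have "go (Suc (Suc j)) (Back K, tp s, int (Suc j)) = go (Suc j) (astep c m (Back K, tp s, int (Suc j)))"
    by (metis funpow_Suc_right comp_apply)
  also have "astep c m (Back K, tp s, int (Suc j)) = (Back K, tp s, int j)" by (simp add: astep_def msk_c)
  finally show ?case using Suc by simp
qed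

lemma go_plus: "go a x = y \<Longrightarrow> go b y = z \<Longrightarrow> go (a + b) x = z" by (simp add: funpow_plus)

lemma move_mark:
  assumes i: "i < c" and p: "int (s i) = p" and p': "p' = int j" "p' \<noteq> p"
  shows "(tp s)(p := enc c (base p) (msk (tp s p) - {i}), p' := enc c (base p') (insert i (msk (tp s p')))) = tp (s(i := j))"
proof
  fix x
  consider "x = p'" | "x = p" "x \<noteq> p'" | "x \<noteq> p" "x \<noteq> p'" by blast
  then show "((tp s)(p := enc c (base p) (msk (tp s p) - {i}), p' := enc c (base p') (insert i (msk (tp s p'))))) x = tp (s(i := j)) x"
  proof cases
    case 1
    have "insert i (msk (tp s p')) = {l. l < c \<and> int ((s(i := j)) l) = p'} \<union> (if p' = 0 then {c} else {})"
      using i p p' unfolding msk_tp by auto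
    then show ?thesis using 1 by (simp add: tape_def)
  next
    case 2
    have "msk (tp s p) - {i} = {l. l < c \<and> int ((s(i := j)) l) = p} \<union> (if p = 0 then {c} else {})"
      using i p p' unfolding msk_tp by auto
    then show ?thesis using 2 by (simp add: tape_def)
  next
    case 3
    have "{l. l < c \<and> int (s l) = x} = {l. l < c \<and> int ((s(i := j)) l) = x}"
      using 3 p p' by auto
    then show ?thesis using 3 by (simp add: tape_def)
  qed
qed

text \<open>The head goes from cell 0 to the mark, at distance at most \<open>B\<close>, possibly
  shifts it by one cell, and returns.\<close>

lemma sim_step:
  assumes K: "K \<noteq> []" "tops K \<subseteq> {..<c}" and B: "\<And>i. s i \<le> B"
    and st: "sstep (\<lambda>j. base (int j)) (K, s) = (K', s')"
  shows "\<exists>t\<le>2*B+6. go t (At K 0, tp s, 0) = (At K' 0, tp s', 0)"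
proof -
  obtain a K0 where KK: "K = a # K0" using K(1) by (cases K) auto
  have one: "go 1 (At K 0, tp s, 0) = (At K' 0, tp s', 0) \<Longrightarrow> ?thesis" by (intro exI[of _ 1]) simp
  show ?thesis
  proof (cases a)
    case (Inc i)
    have i: "i < c" using K(2) unfolding KK Inc by simp
    have e: "K' = K0" "s' = s(i := s i + 1)" using st unfolding KK Inc by auto
    let ?p = "int (s i)"
    have 1: "go (s i) (At K 0, tp s, 0) = (At K 0, tp s, ?p)"
      by (rule seek) (use i in \<open>auto simp: KK Inc msk_i\<close>)
    have 2: "go 1 (At K 0, tp s, ?p) = (At K 1, (tp s)(?p := enc c (base ?p) (msk (tp s ?p) - {i})), ?p + 1)"
      using i by (simp add: astep_def KK Inc msk_i)
    have 3: "go 1 (At K 1, (tp s)(?p := enc c (base ?p) (msk (tp s ?p) - {i})), ?p + 1) = (Back K0, tp s', int (s i + 1))"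
      using move_mark[OF i refl, of "?p + 1" "s i + 1" s] by (simp add: astep_def KK Inc e add.commute)
    note G = go_plus[OF go_plus[OF go_plus[OF 1 2] 3] rewind]
    show ?thesis
      by (rule exI[of _ "s i + 1 + 1 + Suc (s i + 1)"]) (use G e B[of i] in auto)
  next
    case (Dec i)
    have i: "i < c" using K(2) unfolding KK Dec by simp
    have e: "K' = K0" "s' = s(i := s i - 1)" using st unfolding KK Dec by auto
    let ?p = "int (s i)"
    have 1: "go (s i) (At K 0, tp s, 0) = (At K 0, tp s, ?p)"
      by (rule seek) (use i in \<open>auto simp: KK Dec msk_i\<close>)
    show ?thesis
    proof (cases "s i")
      case 0
      then have "s' = s" using e by auto
      have 2: "go 1 (At K 0, tp s, ?p) = (Back K0, tp s, int 0)"
        using i 0 msk_i[OF i, of s 0] msk_c[of s 0] by (simp add: astep_def KK Dec)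
      note G = go_plus[OF go_plus[OF 1 2] rewind]
      show ?thesis by (rule exI[of _ "s i + 1 + Suc 0"]) (use G e \<open>s' = s\<close> B[of i] in auto)
    next
      case (Suc n)
      have 2: "go 1 (At K 0, tp s, ?p) = (At K 1, (tp s)(?p := enc c (base ?p) (msk (tp s ?p) - {i})), ?p - 1)"
        using i Suc msk_c[of s ?p] by (simp add: astep_def KK Dec msk_i)
      have 3: "go 1 (At K 1, (tp s)(?p := enc c (base ?p) (msk (tp s ?p) - {i})), ?p - 1) = (Back K0, tp s', int n)"
        using move_mark[OF i refl, of "?p - 1" n s] Suc by (simp add: astep_def KK Dec e)
      note G = go_plus[OF go_plus[OF go_plus[OF 1 2] 3] rewind]
      show ?thesis
        by (rule exI[of _ "s i + 1 + 1 + Suc n"]) (use G e B[of i] Suc in auto)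
    qed
  next
    case (Seq x y)
    show ?thesis by (rule one) (use st in \<open>auto simp: KK Seq astep_def\<close>)
  next
    case (IfZ i x y)
    have i: "i < c" using K(2) unfolding KK IfZ by simp
    show ?thesis by (rule one) (use st msk_i[OF i, of s 0] in \<open>auto simp: KK IfZ astep_def\<close>)
  next
    case (While i x)
    have i: "i < c" using K(2) unfolding KK While by simp
    show ?thesis by (rule one) (use st msk_i[OF i, of s 0] in \<open>auto simp: KK While astep_def\<close>)
  next
    case (Rd i x y z)
    have i: "i < c" using K(2) unfolding KK Rd by simp
    let ?p = "int (s i)"
    have 1: "go (s i) (At K 0, tp s, 0) = (At K 0, tp s, ?p)"
      by (rule seek) (use i in \<open>auto simp: KK Rd msk_i\<close>)
    have 2: "go 1 (At K 0, tp s, ?p) = (Back K', tp s', ?p)"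
      using i st by (auto simp: astep_def KK Rd msk_i)
    note G = go_plus[OF go_plus[OF 1 2] rewind]
    show ?thesis by (rule exI[of _ "s i + 1 + Suc (s i)"]) (use G B[of i] st in \<open>auto simp: KK Rd\<close>)
  qed
qed

lemma sstep_le: "snd (sstep rd (K, s)) i \<le> s i + 1"
  by (cases "(rd, (K, s))" rule: sstep.cases) auto

text \<open>A counter grows by at most one per step, so \<open>n\<close> bounds all of them after
  \<open>n\<close> steps and the total cost is quadratic.\<close>

lemma sim_steps:
  assumes K: "K \<in> ST m" and tops: "\<And>K. K \<in> ST m \<Longrightarrow> tops K \<subseteq> {..<c}"
  shows "\<exists>K' s' T. (sstep (\<lambda>j. base (int j)) ^^ n) (K, \<lambda>_. 0) = (K', s') \<and> K' \<in> ST m \<and> (\<forall>i. s' i \<le> n) \<and>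
    T \<le> n * (2*n + 6) \<and> go T (At K 0, tp (\<lambda>_. 0), 0) = (At K' 0, tp s', 0)"
proof (induction n)
  case 0 then show ?case using K by auto
next
  case (Suc n)
  then obtain K' s' T where IH: "(sstep (\<lambda>j. base (int j)) ^^ n) (K, \<lambda>_. 0) = (K', s')" "K' \<in> ST m" "\<forall>i. s' i \<le> n"
    "T \<le> n * (2*n + 6)" "go T (At K 0, tp (\<lambda>_. 0), 0) = (At K' 0, tp s', 0)" by blast
  obtain K2 s2 where st: "sstep (\<lambda>j. base (int j)) (K', s') = (K2, s2)" by (cases "sstep (\<lambda>j. base (int j)) (K', s')")
  have K2: "K2 \<in> ST m" using ST_step[OF IH(2), of "\<lambda>j. base (int j)" s'] st by simp
  have s2: "\<forall>i. s2 i \<le> Suc n" using sstep_le[of "\<lambda>j. base (int j)" K' s'] st IH(3)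
    by (metis Suc_eq_plus1 add_le_mono1 le_trans snd_conv)
  have "\<exists>t\<le>2*n+6. go t (At K' 0, tp s', 0) = (At K2 0, tp s2, 0)"
  proof (cases "K' = []")
    case True
    then show ?thesis using st by (intro exI[of _ 0]) auto
  next
    case False
    show ?thesis by (rule sim_step[OF False tops[OF IH(2)] _ st]) (use IH(3) in blast)
  qed
  then obtain t where t: "t \<le> 2*n+6" "go t (At K' 0, tp s', 0) = (At K2 0, tp s2, 0)" by blast
  have "go (T + t) (At K 0, tp (\<lambda>_. 0), 0) = (At K2 0, tp s2, 0)" by (rule go_plus[OF IH(5) t(2)])
  moreover have "T + t \<le> Suc n * (2 * Suc n + 6)" using IH(4) t(1) by (simp add: algebra_simps)
  moreover have "(sstep (\<lambda>j. base (int j)) ^^ Suc n) (K, \<lambda>_. 0) = (K2, s2)" using IH(1) st by simp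
  ultimately show ?case using K2 s2 by blast
qed

end

fun ctrs :: "com \<Rightarrow> nat set" where
  "ctrs (Inc i) = {i}" | "ctrs (Dec i) = {i}" | "ctrs (Seq a b) = ctrs a \<union> ctrs b"
| "ctrs (IfZ i a b) = insert i (ctrs a \<union> ctrs b)" | "ctrs (While i a) = insert i (ctrs a)"
| "ctrs (Rd i a b d) = insert i (ctrs a \<union> ctrs b \<union> ctrs d)"

lemma finite_ctrs: "finite (ctrs c)" by (induction c) auto

lemma cl_tops: "x \<in> cl a K \<Longrightarrow> tops x \<subseteq> ctrs a"
  by (induction a arbitrary: K) auto

definition rdw :: "bool list \<Rightarrow> nat \<Rightarrow> nat" where
  "rdw w j = (if j < length w then if w ! j then 2 else 1 else 0)"

text \<open>The two extra steps mark cell 0 at the start and read the answer off counter 0 at the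
  end. Every larger \<open>T\<close> is allowed since halting configurations are fixed
  points.\<close>

theorem compile:
  "\<exists>Q S \<delta>. valid_tm Q S \<delta> \<and> (\<forall>w t s' T. ex (rdw w) m (\<lambda>_. 0) t s' \<and> t * (2*t + 6) + 2 \<le> T
     \<longrightarrow> tm_decides_within \<delta> w T (s' 0 \<noteq> 0))"
proof -
  \<comment> \<open>Counter 0 holds the answer and gets a colour even if the program does not
    mention it.\<close>
  define c where "c = Suc (Max (insert 0 (ctrs m)))"
  have c: "i < c" if "i \<in> insert 0 (ctrs m)" for i unfolding c_def using that finite_ctrs
    by (meson Max_ge finite_insert le_imp_less_Suc)
  have dec: "tm_decides_within (ctm c m) w T (s' 0 \<noteq> 0)"
    if e: "ex (rdw w) m (\<lambda>_. 0) t s'" and T: "t * (2*t + 6) + 2 \<le> T" for w t s' T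
  proof -
    define tp0 where "tp0 = fst (snd (init_config w))"
    have tp0: "init_config w = (0, tp0, 0)" unfolding tp0_def init_config_def by simp
    have b: "tp0 p < 3" for p unfolding tp0_def init_config_def by auto
    interpret sim c m tp0 by unfold_locales (rule b)
    have rd: "(\<lambda>j. tp0 (int j)) = rdw w" unfolding tp0_def init_config_def rdw_def by (auto simp: fun_eq_iff)
    have tops: "tops K \<subseteq> {..<c}" if "K \<in> ST m" for K
      using that cl_tops[of K m "[]"] c unfolding ST_def by (auto simp: subset_iff)
    obtain K' s1 T1 where st: "(sstep (rdw w) ^^ t) ([m], \<lambda>_. 0) = (K', s1)" "T1 \<le> t * (2*t + 6)"
      "go T1 (At [m] 0, tp (\<lambda>_. 0), 0) = (At K' 0, tp s1, 0)"
      using sim_steps[OF ST_m tops, of t] unfolding rd by blast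
    have ks: "K' = []" "s1 = s'" using ex_sstep[OF e, of "[]"] st(1) by auto
    have tpe: "tp0(0 := enc c (bas (tp0 0)) {..c}) = tp (\<lambda>_. 0)"
    proof
      fix x :: int
      have "{i. i < c \<and> (0::int) = 0} \<union> {c} = {..c}" by auto
      then show "(tp0(0 := enc c (bas (tp0 0)) {..c})) x = tp (\<lambda>_. 0) x"
        using b[of 0] unfolding tape_def bas_def by (auto simp: enc_empty)
    qed
    have 1: "go 1 (Init, tp0, 0) = (At [m] 0, tp (\<lambda>_. 0), 0)"
      using tpe by (simp add: astep_def)
    define r where "r = (if s' 0 = 0 then Rej else Acc)"
    have 2: "go 1 (At [] 0, tp s', 0) = (r, tp s', 0)"
      using msk_i[OF c, of 0 s' 0] unfolding r_def by (auto simp: astep_def)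
    have 3: "go j (r, tp s', 0) = (r, tp s', 0)" for j
      by (induction j) (auto simp: r_def astep_def)
    have "go (1 + T1 + 1 + (T - (T1 + 2))) (Init, tp0, 0) = (r, tp s', 0)"
      by (rule go_plus[OF go_plus[OF go_plus[OF 1 st(3)[unfolded ks]] 2] 3])
    moreover have "1 + T1 + 1 + (T - (T1 + 2)) = T" using st(2) T by simp
    ultimately have "go T (Init, tp0, 0) = (r, tp s', 0)" by (rule subst[rotated])
    moreover have "\<forall>p. tp0 p < 3 * 2 ^ Suc c"
    proof
      fix p have "(3::nat) \<le> 3 * 2 ^ Suc c" by simp
      then show "tp0 p < 3 * 2 ^ Suc c" using b[of p] by linarith
    qed
    ultimately have "(tm_step (ctm c m) ^^ T) (cd Init, tp0, 0) = (cd r, tp s', 0)"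
      using ctm_astep[OF QS_base(1)] by blast
    then show ?thesis unfolding tm_decides_within_def tp0 r_def by (simp add: cd_simps)
  qed
  show ?thesis using ctm_valid[of m c] dec by blast
qed

section \<open>Model checking by counter programs\<close>

text \<open>Tracking only upper bounds lets branches of different cost be merged through
  \<open>run_eq\<close>.\<close>

definition run :: "(nat \<Rightarrow> nat) \<Rightarrow> com \<Rightarrow> (nat \<Rightarrow> nat) \<Rightarrow> nat \<Rightarrow> (nat \<Rightarrow> nat) \<Rightarrow> bool" where
  "run rd c s B s' \<longleftrightarrow> (\<exists>t\<le>B. ex rd c s t s')"

lemma run_eq: "run rd c s B s' \<Longrightarrow> B \<le> B' \<Longrightarrow> s' = s'' \<Longrightarrow> run rd c s B' s''"
  unfolding run_def using le_trans by blast

lemma run_Inc: "run rd (Inc i) s 1 (s(i := s i + 1))" unfolding run_def using ex_Inc by blast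
lemma run_Dec: "run rd (Dec i) s 1 (s(i := s i - 1))" unfolding run_def using ex_Dec by blast
lemma run_Seq: "run rd a s B1 s1 \<Longrightarrow> run rd b s1 B2 s2 \<Longrightarrow> run rd (Seq a b) s (B1 + B2 + 1) s2"
  unfolding run_def by (meson add_le_mono ex_Seq le_refl)
lemma run_IfZ: "s i = 0 \<Longrightarrow> run rd a s B s1 \<Longrightarrow> run rd (IfZ i a b) s (B + 1) s1"
  unfolding run_def by (meson add_le_mono ex_IfZ le_refl)
lemma run_IfN: "s i \<noteq> 0 \<Longrightarrow> run rd b s B s1 \<Longrightarrow> run rd (IfZ i a b) s (B + 1) s1"
  unfolding run_def by (meson add_le_mono ex_IfN le_refl)
lemma run_WhZ: "s i = 0 \<Longrightarrow> run rd (While i a) s 1 s"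
  unfolding run_def using ex_WhZ by blast
lemma run_WhN: "s i \<noteq> 0 \<Longrightarrow> run rd a s B1 s1 \<Longrightarrow> run rd (While i a) s1 B2 s2 \<Longrightarrow> run rd (While i a) s (B1 + B2 + 1) s2"
  unfolding run_def by (meson add_le_mono ex_WhN le_refl)
lemma run_Rd0: "rd (s i) = 0 \<Longrightarrow> run rd a s B s1 \<Longrightarrow> run rd (Rd i a b d) s (B + 1) s1"
  unfolding run_def by (meson add_le_mono ex_Rd0 le_refl)
lemma run_Rd1: "rd (s i) = 1 \<Longrightarrow> run rd b s B s1 \<Longrightarrow> run rd (Rd i a b d) s (B + 1) s1"
  unfolding run_def by (meson add_le_mono ex_Rd1 le_refl)
lemma run_Rd2: "rd (s i) \<noteq> 0 \<Longrightarrow> rd (s i) \<noteq> 1 \<Longrightarrow> run rd d s B s1 \<Longrightarrow> run rd (Rd i a b d) s (B + 1) s1"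
  unfolding run_def by (meson add_le_mono ex_Rd2 le_refl)

lemma run_While:
  assumes "\<And>j. j < n \<Longrightarrow> run rd b (st (Suc j)) B (st j)" "\<And>j. st j i = j" "st n = s" "st 0 = s'"
  shows "run rd (While i b) s (n * (B + 1) + 1) s'"
proof -
  have "run rd (While i b) (st m) (m * (B + 1) + 1) (st 0)" if "m \<le> n" for m
    using that
  proof (induction m)
    case 0 then show ?case using run_WhZ[of "st 0" i] assms(2) by simp
  next
    case (Suc m)
    have "run rd (While i b) (st (Suc m)) (B + (m * (B + 1) + 1) + 1) (st 0)"
      by (rule run_WhN) (use assms(1)[of m] Suc assms(2) in auto)
    then show ?case by (simp add: algebra_simps)
  qed
  from this[of n] show ?thesis using assms(3,4) by simp
qed

text \<open>Moving a counter destroys it, so \<open>add\<close> and \<open>sub\<close> keep a second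
  copy in the scratch counter \<open>t\<close> and move it back.\<close>

definition "mv2 x a b = While x (Seq (Dec x) (Seq (Inc a) (Inc b)))"
definition "mvr x a b = While x (Seq (Dec x) (Seq (Inc a) (Dec b)))"
definition "mv1 x a = While x (Seq (Dec x) (Inc a))"
definition "clr x = While x (Dec x)"
definition "add p x t = Seq (mv2 x p t) (mv1 t x)"
definition "sub p x t = Seq (mvr x t p) (mv1 t x)"

lemma run_mv2:
  assumes "x \<noteq> a" "x \<noteq> b" "a \<noteq> b"
  shows "run rd (mv2 x a b) s (6 * s x + 1) (s(x := 0, a := s a + s x, b := s b + s x))"
proof -
  have "run rd (mv2 x a b) s (s x * (5 + 1) + 1) (s(x := 0, a := s a + s x, b := s b + s x))"
    unfolding mv2_def
  proof (rule run_While[where st = "\<lambda>j. s(x := j, a := s a + (s x - j), b := s b + (s x - j))"])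
    fix j assume j: "j < s x"
    show "run rd (Seq (Dec x) (Seq (Inc a) (Inc b))) (s(x := Suc j, a := s a + (s x - Suc j), b := s b + (s x - Suc j))) 5
      (s(x := j, a := s a + (s x - j), b := s b + (s x - j)))"
      by (rule run_eq[OF run_Seq[OF run_Dec run_Seq[OF run_Inc run_Inc]]]) (use assms j in \<open>auto simp: fun_eq_iff\<close>)
  qed (use assms in \<open>auto simp: fun_eq_iff\<close>)
  then show ?thesis by (simp add: mult.commute)
qed

lemma run_mvr:
  assumes "x \<noteq> a" "x \<noteq> b" "a \<noteq> b"
  shows "run rd (mvr x a b) s (6 * s x + 1) (s(x := 0, a := s a + s x, b := s b - s x))"
proof -
  have "run rd (mvr x a b) s (s x * (5 + 1) + 1) (s(x := 0, a := s a + s x, b := s b - s x))"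
    unfolding mvr_def
  proof (rule run_While[where st = "\<lambda>j. s(x := j, a := s a + (s x - j), b := s b - (s x - j))"])
    fix j assume j: "j < s x"
    show "run rd (Seq (Dec x) (Seq (Inc a) (Dec b))) (s(x := Suc j, a := s a + (s x - Suc j), b := s b - (s x - Suc j))) 5
      (s(x := j, a := s a + (s x - j), b := s b - (s x - j)))"
      by (rule run_eq[OF run_Seq[OF run_Dec run_Seq[OF run_Inc run_Dec]]]) (use assms j in \<open>auto simp: fun_eq_iff\<close>)
  qed (use assms in \<open>auto simp: fun_eq_iff\<close>)
  then show ?thesis by (simp add: mult.commute)
qed

lemma run_mv1:
  assumes "x \<noteq> a"
  shows "run rd (mv1 x a) s (4 * s x + 1) (s(x := 0, a := s a + s x))"
proof -
  have "run rd (mv1 x a) s (s x * (3 + 1) + 1) (s(x := 0, a := s a + s x))"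
    unfolding mv1_def
  proof (rule run_While[where st = "\<lambda>j. s(x := j, a := s a + (s x - j))"])
    fix j assume j: "j < s x"
    show "run rd (Seq (Dec x) (Inc a)) (s(x := Suc j, a := s a + (s x - Suc j))) 3 (s(x := j, a := s a + (s x - j)))"
      by (rule run_eq[OF run_Seq[OF run_Dec run_Inc]]) (use assms j in \<open>auto simp: fun_eq_iff\<close>)
  qed (use assms in \<open>auto simp: fun_eq_iff\<close>)
  then show ?thesis by (simp add: mult.commute)
qed

lemma run_clr: "run rd (clr x) s (2 * s x + 1) (s(x := 0))"
proof -
  have "run rd (clr x) s (s x * (1 + 1) + 1) (s(x := 0))"
    unfolding clr_def
  proof (rule run_While[where st = "\<lambda>j. s(x := j)"])
    fix j assume j: "j < s x"
    show "run rd (Dec x) (s(x := Suc j)) 1 (s(x := j))"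
      by (rule run_eq[OF run_Dec]) auto
  qed auto
  then show ?thesis by (rule run_eq) auto
qed

lemma run_add:
  assumes "x \<noteq> p" "x \<noteq> t" "p \<noteq> t" "s t = 0"
  shows "run rd (add p x t) s (10 * s x + 3) (s(p := s p + s x))"
  unfolding add_def
  by (rule run_eq[OF run_Seq[OF run_mv2 run_mv1]]) (use assms in \<open>auto simp: fun_eq_iff\<close>)

lemma run_sub:
  assumes "x \<noteq> p" "x \<noteq> t" "p \<noteq> t" "s t = 0"
  shows "run rd (sub p x t) s (10 * s x + 3) (s(p := s p - s x))"
  unfolding sub_def
  by (rule run_eq[OF run_Seq[OF run_mvr run_mv1]]) (use assms in \<open>auto simp: fun_eq_iff\<close>)

text \<open>\<open>rX i\<close> holds the value of variable \<open>i\<close> and \<open>rL i\<close> the complement \<open>n - rX i\<close>, so that loops over the vertices need no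
  copy of \<open>n\<close>.  \<open>rS d\<close> and \<open>rF d\<close> belong to nesting depth \<open>d\<close> rather than to a variable, because a variable may be quantified
  again inside its own scope.\<close>

definition "rR = (0::nat)" definition "rN = (1::nat)" definition "rP = (2::nat)"
definition "rT = (3::nat)" definition "rU = (4::nat)" definition "rQ = (5::nat)"
definition rX :: "nat \<Rightarrow> nat" where "rX i = 4*i + 8"
definition rL :: "nat \<Rightarrow> nat" where "rL i = 4*i + 9"
definition rS :: "nat \<Rightarrow> nat" where "rS i = 4*i + 10"
definition rF :: "nat \<Rightarrow> nat" where "rF i = 4*i + 11"

lemma fixed_registers_distinct [simp]:
  "rR \<noteq> rN" "rR \<noteq> rP" "rR \<noteq> rT" "rR \<noteq> rU" "rR \<noteq> rQ" "rN \<noteq> rR" "rN \<noteq> rP" "rN \<noteq> rT" "rN \<noteq> rU" "rN \<noteq> rQ"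
  "rP \<noteq> rR" "rP \<noteq> rN" "rP \<noteq> rT" "rP \<noteq> rU" "rP \<noteq> rQ" "rT \<noteq> rR" "rT \<noteq> rN" "rT \<noteq> rP" "rT \<noteq> rU" "rT \<noteq> rQ"
  "rU \<noteq> rR" "rU \<noteq> rN" "rU \<noteq> rP" "rU \<noteq> rT" "rU \<noteq> rQ" "rQ \<noteq> rR" "rQ \<noteq> rN" "rQ \<noteq> rP" "rQ \<noteq> rT" "rQ \<noteq> rU"
  unfolding rR_def rN_def rP_def rT_def rU_def rQ_def by simp_all

lemma indexed_neq_fixed_registers [simp]:
  assumes "r \<in> {rR, rN, rP, rT, rU, rQ}"
  shows "rX i \<noteq> r" "rL i \<noteq> r" "rS i \<noteq> r" "rF i \<noteq> r" "r \<noteq> rX i" "r \<noteq> rL i" "r \<noteq> rS i" "r \<noteq> rF i"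
  using assms unfolding rR_def rN_def rP_def rT_def rU_def rQ_def rX_def rL_def rS_def rF_def by auto

lemma indexed_registers_distinct [simp]:
  "rX i \<noteq> rL j" "rX i \<noteq> rS j" "rX i \<noteq> rF j" "rL i \<noteq> rX j" "rL i \<noteq> rS j" "rL i \<noteq> rF j"
  "rS i \<noteq> rX j" "rS i \<noteq> rL j" "rS i \<noteq> rF j" "rF i \<noteq> rX j" "rF i \<noteq> rL j" "rF i \<noteq> rS j"
  unfolding rX_def rL_def rS_def rF_def by presburger+

lemma indexed_registers_inject [simp]:
  "rX i = rX j \<longleftrightarrow> i = j" "rL i = rL j \<longleftrightarrow> i = j" "rS i = rS j \<longleftrightarrow> i = j" "rF i = rF j \<longleftrightarrow> i = j"
  unfolding rX_def rL_def rS_def rF_def by auto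

text \<open>Idle because the scratch register \<open>rT\<close> is 0 between operations.\<close>

definition "nop = While rT (Inc rT)"

lemma run_nop: "s rT = 0 \<Longrightarrow> run rd nop s 1 s" unfolding nop_def by (rule run_WhZ)

definition "mul x = Seq (While x (Seq (Dec x) (Seq (Inc rU) (add rP rN rT)))) (mv1 rU x)"

lemma run_mul:
  assumes x: "x \<notin> {rN, rP, rT, rU}" and s: "s rT = 0" "s rU = 0"
  shows "run rd (mul x) s (s x * (10 * s rN + 12) + 3) (s(rP := s rP + s x * s rN))"
proof -
  let ?st = "\<lambda>j. s(x := j, rU := s x - j, rP := s rP + (s x - j) * s rN)"
  have 1: "run rd (While x (Seq (Dec x) (Seq (Inc rU) (add rP rN rT)))) s (s x * ((10 * s rN + 7) + 1) + 1) (?st 0)"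
  proof (rule run_While[where st = ?st])
    fix j assume j: "j < s x"
    then have e: "s x - j = Suc (s x - Suc j)" by simp
    show "run rd (Seq (Dec x) (Seq (Inc rU) (add rP rN rT))) (?st (Suc j)) (10 * s rN + 7) (?st j)"
    proof (rule run_eq[OF run_Seq[OF run_Dec run_Seq[OF run_Inc run_add]]])
      let ?s1 = "(?st (Suc j))(x := ?st (Suc j) x - 1)"
      let ?s2 = "?s1(rU := ?s1 rU + 1)"
      show "?s2(rP := ?s2 rP + ?s2 rN) = ?st j" using x e by (auto simp: fun_eq_iff)
      show "1 + (1 + (10 * ?s2 rN + 3) + 1) + 1 \<le> 10 * s rN + 7" using x by auto
      show "?s2 rT = 0" using x s by auto
    qed simp_all
  qed (use x s in \<open>auto simp: fun_eq_iff\<close>)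
  show ?thesis unfolding mul_def
  proof (rule run_eq[OF run_Seq[OF 1 run_mv1]])
    show "rU \<noteq> x" using x by auto
    show "(?st 0)(rU := 0, x := ?st 0 x + ?st 0 rU) = s(rP := s rP + s x * s rN)"
      using x s by (auto simp: fun_eq_iff)
    show "s x * (10 * s rN + 7 + 1) + 1 + (4 * ?st 0 rU + 1) + 1 \<le> s x * (10 * s rN + 12) + 3"
      using x by (simp add: algebra_simps)
  qed
qed

section \<open>Evaluation of first-order formulas\<close>

datatype fm = Eq nat nat | Ad nat nat | Nt fm | An fm fm | Ex nat fm

fun sem :: "nat \<Rightarrow> (nat \<Rightarrow> nat \<Rightarrow> bool) \<Rightarrow> fm \<Rightarrow> (nat \<Rightarrow> nat) \<Rightarrow> bool" where
  "sem n a (Eq i j) e = (e i = e j)"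
| "sem n a (Ad i j) e = a (e i) (e j)"
| "sem n a (Nt f) e = (\<not> sem n a f e)"
| "sem n a (An f g) e = (sem n a f e \<and> sem n a g e)"
| "sem n a (Ex i f) e = (\<exists>x<n. sem n a f (e(i := x)))"

fun vars :: "fm \<Rightarrow> nat set" where
  "vars (Eq i j) = {i,j}" | "vars (Ad i j) = {i,j}" | "vars (Nt f) = vars f"
| "vars (An f g) = vars f \<union> vars g" | "vars (Ex i f) = insert i (vars f)"

lemma finite_vars: "finite (vars f)" by (induction f) auto

text \<open>The truth value ends up in \<open>rR\<close>, which is at most 1 before, so
  \<open>Dec rR\<close> clears it. For \<open>Eq\<close>, copies of both values are counted down
  together, and \<open>rR\<close> drops if one runs out early. For \<open>Ad\<close>, the input is
  read at row times \<open>n\<close> plus column. For \<open>Ex\<close>, \<open>mv2\<close> empties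
  \<open>rX i\<close> both into \<open>rL i\<close>, which becomes \<open>n\<close>, and into the
  save register; the loop counts witnesses in \<open>rF d\<close>, and the last \<open>mvr\<close>
  restores the variable and its complement.\<close>

fun chk :: "nat \<Rightarrow> fm \<Rightarrow> com" where
  "chk d (Eq i j) =
     Seq (add rP (rX i) rT) (Seq (add rQ (rX j) rT) (Seq (Dec rR) (Seq (Inc rR)
       (Seq (While rP (Seq (Dec rP) (IfZ rQ (Dec rR) (Dec rQ)))) (Seq (IfZ rQ nop (Dec rR)) (clr rQ))))))"
| "chk d (Ad i j) =
     Seq (mul (rX i)) (Seq (add rP (rX j) rT) (Seq (Dec rR) (Seq (Rd rP nop nop (Inc rR)) (clr rP))))"
| "chk d (Nt f) = Seq (chk d f) (IfZ rR (Inc rR) (Dec rR))"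
| "chk d (An f g) = Seq (chk d f) (IfZ rR nop (chk d g))"
| "chk d (Ex i f) =
     Seq (mv2 (rX i) (rL i) (rS d))
      (Seq (While (rL i) (Seq (chk (Suc d) f) (Seq (IfZ rR nop (Inc (rF d))) (Seq (Inc (rX i)) (Dec (rL i))))))
        (Seq (mv1 (rX i) (rL i)) (Seq (Dec rR) (Seq (IfZ (rF d) nop (Inc rR)) (Seq (clr (rF d)) (mvr (rS d) (rX i) (rL i)))))))"

fun tb :: "fm \<Rightarrow> nat \<Rightarrow> nat" where
  "tb (Eq i j) n = 50 * (n + 1)"
| "tb (Ad i j) n = 50 * (n + 1) * (n + 1)"
| "tb (Nt f) n = tb f n + 3"
| "tb (An f g) n = tb f n + tb g n + 4"
| "tb (Ex i f) n = 50 * (n + 1) * (tb f n + 1)"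

definition inv :: "nat \<Rightarrow> nat \<Rightarrow> nat set \<Rightarrow> (nat \<Rightarrow> nat) \<Rightarrow> bool" where
  "inv n d Z s \<longleftrightarrow> s rR \<le> 1 \<and> s rN = n \<and> s rP = 0 \<and> s rT = 0 \<and> s rU = 0 \<and> s rQ = 0 \<and>
     (\<forall>i\<in>Z. s (rX i) < n \<and> s (rL i) = n - s (rX i)) \<and> (\<forall>j\<ge>d. s (rS j) = 0 \<and> s (rF j) = 0)"

lemma run_Eq:
  assumes "inv n d {i,j} s"
  shows "run rd (chk d (Eq i j)) s (tb (Eq i j) n) (s(rR := if s (rX i) = s (rX j) then 1 else 0))"
proof -
  have s: "s rR \<le> 1" "s rN = n" "s rP = 0" "s rT = 0" "s rU = 0" "s rQ = 0" "s (rX i) < n" "s (rX j) < n"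
    using assms unfolding inv_def by auto
  let ?x = "s (rX i)" let ?y = "s (rX j)"
  let ?st = "\<lambda>l. s(rP := l, rQ := ?y - (?x - l), rR := if ?x - l \<le> ?y then 1 else (0::nat))"
  have 1: "run rd (add rP (rX i) rT) s (10 * ?x + 3) (s(rP := ?x))"
    by (rule run_eq[OF run_add]) (use s in auto)
  have 2: "run rd (add rQ (rX j) rT) (s(rP := ?x)) (10 * ?y + 3) (s(rP := ?x, rQ := ?y))"
    by (rule run_eq[OF run_add]) (use s in auto)
  have 3: "run rd (Dec rR) (s(rP := ?x, rQ := ?y)) 1 (s(rP := ?x, rQ := ?y, rR := 0))"
    by (rule run_eq[OF run_Dec]) (use s in auto)
  have 4: "run rd (Inc rR) (s(rP := ?x, rQ := ?y, rR := 0)) 1 (?st ?x)"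
    by (rule run_eq[OF run_Inc]) (use s in auto)
  have 5: "run rd (While rP (Seq (Dec rP) (IfZ rQ (Dec rR) (Dec rQ)))) (?st ?x) (?x * (4 + 1) + 1) (?st 0)"
  proof (rule run_While[where st = ?st])
    fix l assume l: "l < ?x"
    show "run rd (Seq (Dec rP) (IfZ rQ (Dec rR) (Dec rQ))) (?st (Suc l)) 4 (?st l)"
    proof (cases "?y - (?x - Suc l) = 0")
      case True
      show ?thesis
        by (rule run_eq[OF run_Seq[OF run_Dec run_IfZ[OF _ run_Dec]]]) (use True l in \<open>auto simp: fun_eq_iff\<close>)
    next
      case False
      show ?thesis
        by (rule run_eq[OF run_Seq[OF run_Dec run_IfN[OF _ run_Dec]]]) (use False l in \<open>auto simp: fun_eq_iff\<close>)
    qed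
  qed (auto simp: fun_eq_iff)
  let ?s6 = "s(rP := 0, rQ := ?y - ?x, rR := if ?x = ?y then 1 else (0::nat))"
  have 6: "run rd (IfZ rQ nop (Dec rR)) (?st 0) 2 ?s6"
  proof (cases "?y - ?x = 0")
    case True
    show ?thesis by (rule run_eq[OF run_IfZ[OF _ run_nop]]) (use True s in \<open>auto simp: fun_eq_iff\<close>)
  next
    case False
    show ?thesis by (rule run_eq[OF run_IfN[OF _ run_Dec]]) (use False in \<open>auto simp: fun_eq_iff\<close>)
  qed
  have 7: "run rd (clr rQ) ?s6 (2 * n + 1) (s(rR := if ?x = ?y then 1 else 0))"
    by (rule run_eq[OF run_clr]) (use s in \<open>auto simp: fun_eq_iff\<close>)
  show ?thesis unfolding chk.simps
    by (rule run_eq[OF run_Seq[OF 1 run_Seq[OF 2 run_Seq[OF 3 run_Seq[OF 4 run_Seq[OF 5 run_Seq[OF 6 7]]]]]]])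
      (use s in auto)
qed

lemma run_Ad:
  assumes "inv n d {i,j} s" and rd: "\<And>x y. x < n \<Longrightarrow> y < n \<Longrightarrow> rd (x * n + y) = (if a x y then 2 else 1)"
  shows "run rd (chk d (Ad i j)) s (tb (Ad i j) n) (s(rR := if a (s (rX i)) (s (rX j)) then 1 else 0))"
proof -
  have s: "s rR \<le> 1" "s rN = n" "s rP = 0" "s rT = 0" "s rU = 0" "s rQ = 0" "s (rX i) < n" "s (rX j) < n"
    using assms(1) unfolding inv_def by auto
  let ?x = "s (rX i)" let ?y = "s (rX j)"
  have 1: "run rd (mul (rX i)) s (?x * (10 * n + 12) + 3) (s(rP := ?x * n))"
    by (rule run_eq[OF run_mul]) (use s in auto)
  have 2: "run rd (add rP (rX j) rT) (s(rP := ?x * n)) (10 * ?y + 3) (s(rP := ?x * n + ?y))"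
    by (rule run_eq[OF run_add]) (use s in auto)
  have 3: "run rd (Dec rR) (s(rP := ?x * n + ?y)) 1 (s(rP := ?x * n + ?y, rR := 0))"
    by (rule run_eq[OF run_Dec]) (use s in auto)
  let ?s4 = "s(rP := ?x * n + ?y, rR := if a ?x ?y then 1 else (0::nat))"
  have 4: "run rd (Rd rP nop nop (Inc rR)) (s(rP := ?x * n + ?y, rR := 0)) 2 ?s4"
  proof (cases "a ?x ?y")
    case True
    show ?thesis by (rule run_eq[OF run_Rd2[OF _ _ run_Inc]]) (use True s rd in auto)
  next
    case False
    show ?thesis by (rule run_eq[OF run_Rd1[OF _ run_nop]]) (use False s rd in auto)
  qed
  have 5: "run rd (clr rP) ?s4 (2 * (?x * n + ?y) + 1) (s(rR := if a ?x ?y then 1 else 0))"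
    by (rule run_eq[OF run_clr]) (use s in \<open>auto simp: fun_eq_iff\<close>)
  have b: "?x * n \<le> n * n" using s by simp
  have "?x * (10 * n + 12) \<le> n * (10 * n + 12)" using s by (intro mult_le_mono1) simp
  then show ?thesis unfolding chk.simps
    by (intro run_eq[OF run_Seq[OF 1 run_Seq[OF 2 run_Seq[OF 3 run_Seq[OF 4 5]]]]])
      (use s b in \<open>simp_all add: algebra_simps\<close>)
qed

lemma run_chk:
  assumes rd: "\<And>x y. x < n \<Longrightarrow> y < n \<Longrightarrow> rd (x * n + y) = (if a x y then 2 else 1)"
  shows "inv n d (vars f) s \<Longrightarrow>
    run rd (chk d f) s (tb f n) (s(rR := if sem n a f (\<lambda>i. s (rX i)) then 1 else 0))"
proof (induction f arbitrary: d s)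
  case (Eq i j) show ?case unfolding sem.simps by (rule run_Eq) (use Eq in simp)
next
  case (Ad i j) show ?case unfolding sem.simps by (rule run_Ad) (use Ad rd in simp_all)
next
  case (Nt f)
  let ?b = "sem n a f (\<lambda>i. s (rX i))"
  have 1: "run rd (chk d f) s (tb f n) (s(rR := if ?b then 1 else 0))"
    by (rule Nt.IH) (use Nt.prems in simp)
  have 2: "run rd (IfZ rR (Inc rR) (Dec rR)) (s(rR := if ?b then 1 else 0)) 2 (s(rR := if \<not> ?b then 1 else 0))"
  proof (cases ?b)
    case True show ?thesis by (rule run_eq[OF run_IfN[OF _ run_Dec]]) (use True in auto)
  next
    case False show ?thesis by (rule run_eq[OF run_IfZ[OF _ run_Inc]]) (use False in auto)
  qed
  show ?case unfolding chk.simps by (rule run_eq[OF run_Seq[OF 1 2]]) auto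
next
  case (An f g)
  let ?b = "sem n a f (\<lambda>i. s (rX i))" let ?c = "sem n a g (\<lambda>i. s (rX i))"
  have i: "inv n d (vars f) s" "inv n d (vars g) (s(rR := 1))" using An.prems unfolding inv_def by auto
  have 1: "run rd (chk d f) s (tb f n) (s(rR := if ?b then 1 else 0))" by (rule An.IH(1)[OF i(1)])
  have 2: "run rd (IfZ rR nop (chk d g)) (s(rR := if ?b then 1 else 0)) (tb g n + 2) (s(rR := if ?b \<and> ?c then 1 else 0))"
  proof (cases ?b)
    case True
    have "run rd (chk d g) (s(rR := 1)) (tb g n) (s(rR := if ?c then 1 else 0))"
      by (rule run_eq[OF An.IH(2)[OF i(2)]]) auto
    then have "run rd (IfZ rR nop (chk d g)) (s(rR := 1)) (tb g n + 2) (s(rR := if ?c then 1 else 0))"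
      by (intro run_eq[OF run_IfN]) auto
    then show ?thesis by (simp only: True if_True simp_thms)
  next
    case False
    have "s rT = 0" using i(1) unfolding inv_def by simp
    then show ?thesis by (intro run_eq[OF run_IfZ[OF _ run_nop]]) (use False in auto)
  qed
  show ?case unfolding chk.simps by (rule run_eq[OF run_Seq[OF 1 2]]) auto
next
  case (Ex i f)
  let ?e = "\<lambda>i. s (rX i)"
  have s: "s rR \<le> 1" "s rN = n" "s rP = 0" "s rT = 0" "s rU = 0" "s rQ = 0" "s (rX i) < n" "s (rL i) = n - s (rX i)"
    "\<forall>l\<in>vars f. s (rX l) < n \<and> s (rL l) = n - s (rX l)" "\<forall>j\<ge>d. s (rS j) = 0 \<and> s (rF j) = 0"
    using Ex.prems unfolding inv_def by auto
  let ?x = "s (rX i)"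
  define s1 where "s1 = s(rX i := 0, rL i := n, rS d := ?x)"
  have 1: "run rd (mv2 (rX i) (rL i) (rS d)) s (6 * ?x + 1) s1" unfolding s1_def
    by (rule run_eq[OF run_mv2]) (use s in auto)
  define S where "S x \<longleftrightarrow> sem n a f (?e(i := x))" for x
  \<comment> \<open>The state with \<open>l\<close> values still to be tried: \<open>rR\<close>
    holds the verdict on the last value, or its old content before the first round.\<close>
  define st where "st l = s1(rL i := l, rX i := n - l, rF d := card {x. x < n - l \<and> S x},
      rR := if l \<ge> n then s rR else if S (n - Suc l) then 1 else 0)" for l
  let ?body = "Seq (chk (Suc d) f) (Seq (IfZ rR nop (Inc (rF d))) (Seq (Inc (rX i)) (Dec (rL i))))"
  have 2: "run rd (While (rL i) ?body) s1 (n * ((tb f n + 8) + 1) + 1) (st 0)"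
  proof (rule run_While[where st = st])
    fix l assume l: "l < n"
    define x where "x = n - Suc l"
    have x: "x < n" "n - l = Suc x" "n - Suc x = l" using l unfolding x_def by auto
    have iv: "inv n (Suc d) (vars f) (st (Suc l))"
      using s l unfolding inv_def st_def s1_def by auto
    have ee: "(\<lambda>j. st (Suc l) (rX j)) = ?e(i := x)" unfolding st_def s1_def x_def by (auto simp: fun_eq_iff)
    have a1: "run rd (chk (Suc d) f) (st (Suc l)) (tb f n) ((st (Suc l))(rR := if S x then 1 else 0))"
      using Ex.IH[OF iv] unfolding ee S_def .
    have cd: "card {y. y < Suc x \<and> S y} = card {y. y < x \<and> S y} + (if S x then 1 else 0)"
    proof -
      have "{y. y < Suc x \<and> S y} = (if S x then insert x {y. y < x \<and> S y} else {y. y < x \<and> S y})"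
        by (auto simp: less_Suc_eq)
      then show ?thesis by simp
    qed
    let ?s2 = "(st (Suc l))(rR := if S x then 1 else (0::nat), rF d := card {y. y < Suc x \<and> S y})"
    have a2: "run rd (IfZ rR nop (Inc (rF d))) ((st (Suc l))(rR := if S x then 1 else 0)) 2 ?s2"
    proof (cases "S x")
      case True
      show ?thesis by (rule run_eq[OF run_IfN[OF _ run_Inc]])
         (use True cd in \<open>auto simp: fun_eq_iff st_def x_def\<close>)
    next
      case False
      show ?thesis by (rule run_eq[OF run_IfZ[OF _ run_nop]])
         (use False cd s in \<open>auto simp: fun_eq_iff st_def s1_def x_def\<close>)
    qed
    have a3: "run rd (Seq (Inc (rX i)) (Dec (rL i))) ?s2 3 (st l)"
      by (rule run_eq[OF run_Seq[OF run_Inc run_Dec]]) (use l x in \<open>auto simp: fun_eq_iff st_def x_def[symmetric]\<close>)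
    show "run rd ?body (st (Suc l)) (tb f n + 8) (st l)"
      by (rule run_eq[OF run_Seq[OF a1 run_Seq[OF a2 a3]]]) auto
  qed (use s in \<open>auto simp: fun_eq_iff st_def s1_def\<close>)
  define r0 where "r0 = st 0 rR"
  define c0 where "c0 = card {x. x < n \<and> S x}"
  have st0: "st 0 = s1(rL i := 0, rX i := n, rF d := c0, rR := r0)" "r0 \<le> 1"
    using s unfolding st_def r0_def c0_def by (auto simp: fun_eq_iff)
  have c0: "c0 \<le> n" "c0 \<noteq> 0 \<longleftrightarrow> sem n a (Ex i f) ?e"
  proof -
    have "c0 \<le> card {..<n}" unfolding c0_def by (rule card_mono) auto
    then show "c0 \<le> n" by simp
    show "c0 \<noteq> 0 \<longleftrightarrow> sem n a (Ex i f) ?e" unfolding c0_def S_def by auto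
  qed
  \<comment> \<open>The loop ends with \<open>n\<close> in \<open>rX i\<close> and 0 in
    \<open>rL i\<close>. Moving one into the other produces the state from which \<open>mvr\<close>
    recovers the saved value.\<close>
  have 3: "run rd (mv1 (rX i) (rL i)) (st 0) (4 * n + 1) (s1(rF d := c0, rR := r0))"
    unfolding st0(1) by (rule run_eq[OF run_mv1]) (auto simp: fun_eq_iff s1_def)
  have 4: "run rd (Dec rR) (s1(rF d := c0, rR := r0)) 1 (s1(rF d := c0, rR := 0))"
    by (rule run_eq[OF run_Dec]) (use st0 in auto)
  let ?r = "if sem n a (Ex i f) ?e then 1 else (0::nat)"
  have 5: "run rd (IfZ (rF d) nop (Inc rR)) (s1(rF d := c0, rR := 0)) 2 (s1(rF d := c0, rR := ?r))"
  proof (cases "c0 = 0")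
    case True
    show ?thesis by (rule run_eq[OF run_IfZ[OF _ run_nop]]) (use True c0 s in \<open>auto simp: s1_def\<close>)
  next
    case False
    then have "?r = 1" using c0(2) by simp
    then show ?thesis by (intro run_eq[OF run_IfN[OF _ run_Inc]]) (use False in auto)
  qed
  have 6: "run rd (clr (rF d)) (s1(rF d := c0, rR := ?r)) (2 * n + 1) (s1(rR := ?r))"
    by (rule run_eq[OF run_clr]) (use c0(1) s in \<open>auto simp: fun_eq_iff s1_def\<close>)
  have 7: "run rd (mvr (rS d) (rX i) (rL i)) (s1(rR := ?r)) (6 * ?x + 1) (s(rR := ?r))"
    by (rule run_eq[OF run_mvr]) (use s in \<open>auto simp: fun_eq_iff s1_def\<close>)
  show ?case unfolding chk.simps
  proof (rule run_eq[OF run_Seq[OF 1 run_Seq[OF 2 run_Seq[OF 3 run_Seq[OF 4 run_Seq[OF 5 run_Seq[OF 6 7]]]]]]])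
    have "?x \<le> n" using s by simp
    then show "6 * ?x + 1 + (n * (tb f n + 8 + 1) + 1 + (4 * n + 1 + (1 + (2 + (2 * n + 1 + (6 * ?x + 1) + 1) + 1) + 1) + 1) + 1) + 1
      \<le> tb (Ex i f) n"
      by (simp add: algebra_simps)
  qed (rule refl)
qed

lemma tb_poly: "\<exists>c d. \<forall>n. tb f n \<le> c * (n + 1) ^ d"
proof (induction f)
  case (Eq i j) show ?case by (rule exI[of _ 50], rule exI[of _ 1]) simp
next
  case (Ad i j) show ?case by (rule exI[of _ 50], rule exI[of _ 2]) (simp add: power2_eq_square algebra_simps)
next
  case (Nt f)
  then obtain c d where "\<forall>n. tb f n \<le> c * (n + 1) ^ d" by blast
  then have "tb (Nt f) n \<le> (c + 3) * (n + 1) ^ d" for n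
    using add_mono[of "tb f n" "c * (n+1)^d" 3 "3 * (n+1)^d"] by (simp add: algebra_simps)
  then show ?case by blast
next
  case (An f g)
  then obtain c d c' d' where 1: "\<forall>n. tb f n \<le> c * (n + 1) ^ d" "\<forall>n. tb g n \<le> c' * (n + 1) ^ d'" by blast
  have "tb (An f g) n \<le> (c + c' + 4) * (n + 1) ^ (d + d')" for n
  proof -
    have "c * (n+1)^d \<le> c * (n+1)^(d+d')" "c' * (n+1)^d' \<le> c' * (n+1)^(d+d')"
      by (intro mult_le_mono2 power_increasing; simp)+
    moreover have "(4::nat) \<le> 4 * (n+1)^(d+d')" by simp
    ultimately have "tb f n + tb g n + 4 \<le> c * (n+1)^(d+d') + c' * (n+1)^(d+d') + 4 * (n+1)^(d+d')"
      using 1 by (meson add_le_mono le_trans)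
    then show ?thesis by (simp add: algebra_simps)
  qed
  then show ?case by blast
next
  case (Ex i f)
  then obtain c d where 1: "\<forall>n. tb f n \<le> c * (n + 1) ^ d" by blast
  have "tb (Ex i f) n \<le> (50 * (c + 1)) * (n + 1) ^ Suc d" for n
  proof -
    have "tb f n + 1 \<le> c * (n+1)^d + 1 * (n+1)^d" using 1 by (intro add_mono) auto
    then have "tb f n + 1 \<le> (c + 1) * (n + 1)^d" by (simp add: algebra_simps)
    then have "50 * (n+1) * (tb f n + 1) \<le> 50 * (n+1) * ((c + 1) * (n + 1)^d)" by (rule mult_le_mono2)
    then show ?thesis by (simp add: algebra_simps)
  qed
  then show ?case by blast
qed

text \<open>Scans to the first blank, with \<open>rR\<close> as loop flag; the input contains no
  blank inside.\<close>

definition "lenp = Seq (Inc rR) (While rR (Rd rP (Dec rR) (Inc rP) (Inc rP)))"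

lemma run_lenp:
  assumes "s rR = 0" "s rP = 0"
  shows "run (rdw w) lenp s (3 * length w + 6) (s(rP := length w))"
proof -
  have "run (rdw w) (While rR (Rd rP (Dec rR) (Inc rP) (Inc rP))) (s(rR := 1, rP := length w - j)) (3 * j + 4)
     (s(rP := length w))" if "j \<le> length w" for j
    using that
  proof (induction j)
    case 0
    show ?case
      by (rule run_eq[OF run_WhN[OF _ run_Rd0[OF _ run_Dec] run_WhZ]]) (use assms in \<open>auto simp: rdw_def fun_eq_iff\<close>)
  next
    case (Suc j)
    let ?s = "s(rR := 1, rP := length w - Suc j)"
    have "run (rdw w) (Rd rP (Dec rR) (Inc rP) (Inc rP)) ?s 2 (s(rR := 1, rP := length w - j))"
    proof (cases "w ! (length w - Suc j)")
      case True
      show ?thesis by (rule run_eq[OF run_Rd2[OF _ _ run_Inc]]) (use True Suc.prems in \<open>auto simp: rdw_def fun_eq_iff\<close>)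
    next
      case False
      show ?thesis by (rule run_eq[OF run_Rd1[OF _ run_Inc]]) (use False Suc.prems in \<open>auto simp: rdw_def fun_eq_iff\<close>)
    qed
    note r = this
    show ?case
      by (rule run_eq[OF run_WhN[OF _ r Suc.IH]]) (use Suc.prems in auto)
  qed
  from this[of "length w"] have 2: "run (rdw w) (While rR (Rd rP (Dec rR) (Inc rP) (Inc rP))) (s(rR := 1)) (3 * length w + 4)
     (s(rP := length w))" using assms by (simp add: fun_upd_idem)
  have 1: "run (rdw w) (Inc rR) s 1 (s(rR := 1))" by (rule run_eq[OF run_Inc]) (use assms in auto)
  show ?thesis unfolding lenp_def by (rule run_eq[OF run_Seq[OF 1 2]]) auto
qed

text \<open>A square is the sum of the first odd numbers: each round subtracts
  \<open>2*rN + 1\<close>, so the number of rounds is the root.\<close>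

definition "sqrtp = While rP (Seq (sub rP rN rT) (Seq (sub rP rN rT) (Seq (Dec rP) (Inc rN))))"

lemma run_sqrtp:
  assumes "s rP = n * n" "s rN = 0" "s rT = 0"
  shows "run rd sqrtp s (n * (20 * n + 12) + 1) (s(rP := 0, rN := n))"
proof -
  have "run rd sqrtp (s(rP := n * n - (n - j) * (n - j), rN := n - j)) (j * (20 * n + 12) + 1) (s(rP := 0, rN := n))"
    if "j \<le> n" for j
    using that
  proof (induction j)
    case 0
    show ?case unfolding sqrtp_def by (rule run_eq[OF run_WhZ]) auto
  next
    case (Suc j)
    define m where "m = n - Suc j"
    have m: "n - j = Suc m" "m < n" using Suc.prems unfolding m_def by auto
    let ?s = "s(rP := n * n - m * m, rN := m)"
    let ?s1 = "s(rP := n * n - m * m - m, rN := m)"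
    let ?s2 = "s(rP := n * n - m * m - m - m, rN := m)"
    have 1: "run rd (sub rP rN rT) ?s (10 * m + 3) ?s1"
      by (rule run_eq[OF run_sub]) (use assms in \<open>auto simp: fun_eq_iff\<close>)
    have 2: "run rd (sub rP rN rT) ?s1 (10 * m + 3) ?s2"
      by (rule run_eq[OF run_sub]) (use assms in \<open>auto simp: fun_eq_iff\<close>)
    have 3: "run rd (Seq (Dec rP) (Inc rN)) ?s2 3 (s(rP := n * n - (n - j) * (n - j), rN := n - j))"
      by (rule run_eq[OF run_Seq[OF run_Dec run_Inc]]) (use m in \<open>auto simp: fun_eq_iff\<close>)
    have "m * m < n * n" using m(2) by (simp add: mult_strict_mono)
    then have nz: "?s rP \<noteq> 0" by simp
    have "run rd sqrtp ?s (10 * m + 3 + (10 * m + 3 + 3 + 1) + 1 + (j * (20 * n + 12) + 1) + 1) (s(rP := 0, rN := n))"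
      unfolding sqrtp_def
      by (rule run_WhN[OF nz run_Seq[OF 1 run_Seq[OF 2 3]] Suc.IH[OF Suc_leD[OF Suc.prems], unfolded sqrtp_def]])
    then show ?case unfolding m_def[symmetric] by (rule run_eq) (use m in auto)
  qed
  from this[of n] show ?thesis using assms by (simp add: fun_upd_idem)
qed

text \<open>Setting the complement registers to \<open>n\<close> gives all variables the value
  0.\<close>

fun initp :: "nat \<Rightarrow> com" where
  "initp 0 = nop"
| "initp (Suc v) = Seq (initp v) (add (rL v) rN rT)"

lemma run_initp:
  assumes "s rT = 0" "\<forall>i. s (rL i) = 0"
  shows "run rd (initp v) s (v * (10 * s rN + 4) + 1) (\<lambda>x. if x \<in> rL ` {..<v} then s rN else s x)"
proof (induction v)
  case 0 then show ?case using run_nop[of s rd] assms by simp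
next
  case (Suc v)
  let ?s = "\<lambda>x. if x \<in> rL ` {..<v} then s rN else s x"
  have "run rd (add (rL v) rN rT) ?s (10 * s rN + 3) (\<lambda>x. if x \<in> rL ` {..<Suc v} then s rN else s x)"
    by (rule run_eq[OF run_add]) (use assms in \<open>auto simp: fun_eq_iff less_Suc_eq\<close>)
  from run_Seq[OF Suc this] show ?case by (auto intro: run_eq)
qed

definition "mainp v f = Seq lenp (Seq sqrtp (Seq (initp v) (chk 0 f)))"

definition enc_adj :: "nat \<Rightarrow> (nat \<Rightarrow> nat \<Rightarrow> bool) \<Rightarrow> bool list" where
  "enc_adj n a = map (\<lambda>p. a (p div n) (p mod n)) [0..<n * n]"

lemma run_mainp:
  assumes v: "vars f \<subseteq> {..<v}" and n: "0 < n"
  shows "\<exists>s'. run (rdw (enc_adj n a)) (mainp v f) (\<lambda>_. 0) (60 * (v + 1) * (n + 1)^2 + tb f n) s' \<and>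
     (s' 0 \<noteq> 0 \<longleftrightarrow> sem n a f (\<lambda>_. 0))"
proof -
  let ?w = "enc_adj n a"
  have lw: "length ?w = n * n" unfolding enc_adj_def by simp
  have rd: "rdw ?w (x * n + y) = (if a x y then 2 else 1)" if "x < n" "y < n" for x y
  proof -
    have "x * n + y < Suc x * n" using that by simp
    also have "\<dots> \<le> n * n" using that by (intro mult_le_mono1) simp
    finally have l: "x * n + y < n * n" .
    then have "?w ! (x * n + y) = a x y" unfolding enc_adj_def using that by simp
    then show ?thesis unfolding rdw_def lw using l by simp
  qed
  let ?z = "(\<lambda>_. 0) :: nat \<Rightarrow> nat"
  have 1: "run (rdw ?w) lenp ?z (3 * (n*n) + 6) (?z(rP := n*n))"
    using run_lenp[of ?z ?w] unfolding lw by simp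
  have 2: "run (rdw ?w) sqrtp (?z(rP := n*n)) (n * (20 * n + 12) + 1) (?z(rN := n))"
    by (rule run_eq[OF run_sqrtp[of _ n]]) (auto simp: fun_eq_iff)
  define s3 where "s3 = (\<lambda>x. if x \<in> rL ` {..<v} then n else (?z(rN := n)) x)"
  have 3: "run (rdw ?w) (initp v) (?z(rN := n)) (v * (10 * n + 4) + 1) s3"
    by (rule run_eq[OF run_initp]) (auto simp: s3_def)
  have iv: "inv n 0 (vars f) s3" using v n unfolding inv_def s3_def by (auto simp: image_iff)
  have ex: "(\<lambda>i. s3 (rX i)) = (\<lambda>_. 0)" unfolding s3_def by (auto simp: fun_eq_iff)
  define s4 where "s4 = s3(rR := if sem n a f (\<lambda>_. 0) then 1 else 0)"
  have 4: "run (rdw ?w) (chk 0 f) s3 (tb f n) s4"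
    using run_chk[where a = a, OF rd iv] unfolding ex s4_def by simp
  have "run (rdw ?w) (mainp v f) ?z (60 * (v + 1) * (n + 1)^2 + tb f n) s4"
    unfolding mainp_def
    by (rule run_eq[OF run_Seq[OF 1 run_Seq[OF 2 run_Seq[OF 3 4]]]])
      (auto simp: power2_eq_square algebra_simps)
  moreover have "s4 0 \<noteq> 0 \<longleftrightarrow> sem n a f (\<lambda>_. 0)" unfolding s4_def rR_def by simp
  ultimately show ?thesis by blast
qed

text \<open>For a fixed formula the counter program is polynomial in \<open>n\<close>, the machine
  squares this up to a factor, and the input length \<open>n*n\<close> is at least \<open>n\<close>.
  Positivity of \<open>n\<close> makes the initial value 0 a vertex.\<close>

theorem model_checking:
  "\<exists>Q S \<delta> c d. valid_tm Q S \<delta> \<and> (\<forall>n a. 0 < n \<longrightarrow>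
     tm_decides_within \<delta> (enc_adj n a) (c * (length (enc_adj n a) + 1) ^ d) (sem n a f (\<lambda>_. 0)))"
proof -
  obtain v where v: "vars f \<subseteq> {..<v}" using finite_vars[of f] finite_nat_set_iff_bounded by (meson lessThan_iff subsetI)
  obtain Q S \<delta> where M: "valid_tm Q S \<delta>" "\<And>w t s' T. ex (rdw w) (mainp v f) (\<lambda>_. 0) t s' \<Longrightarrow> t * (2*t + 6) + 2 \<le> T
     \<Longrightarrow> tm_decides_within \<delta> w T (s' 0 \<noteq> 0)" using compile[of "mainp v f"] by blast
  obtain c d where cd: "\<And>n. tb f n \<le> c * (n + 1) ^ d" using tb_poly[of f] by blast
  define C where "C = 60 * (v + 1) + c + 1"
  \<comment> \<open>Majorises both exponents, 2 from the start-up and \<open>d\<close> from the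
    evaluation.\<close>
  define e where "e = d + 2"
  have "tm_decides_within \<delta> (enc_adj n a) (10 * C^2 * (length (enc_adj n a) + 1) ^ (2 * e)) (sem n a f (\<lambda>_. 0))"
    if n: "0 < n" for n a
  proof -
    let ?l = "length (enc_adj n a)"
    obtain s' t where r: "t \<le> 60 * (v + 1) * (n + 1)^2 + tb f n" "ex (rdw (enc_adj n a)) (mainp v f) (\<lambda>_. 0) t s'"
      "s' 0 \<noteq> 0 \<longleftrightarrow> sem n a f (\<lambda>_. 0)" using run_mainp[OF v n, of a] unfolding run_def by blast
    have "n \<le> ?l" unfolding enc_adj_def by simp
    then have l: "n + 1 \<le> ?l + 1" by simp
    define B where "B = C * (?l + 1) ^ e"
    have p: "(n + 1)^j \<le> (?l + 1)^e" if "j \<le> e" for j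
      by (rule le_trans[OF power_mono[OF l] power_increasing[OF that]]) simp_all
    have "(n + 1)^2 \<le> (?l + 1)^e" "(n + 1)^d \<le> (?l + 1)^e" by (rule p; simp add: e_def)+
    then have "60 * (v + 1) * (n + 1)^2 + c * (n + 1)^d \<le> 60 * (v + 1) * (?l + 1)^e + c * (?l + 1)^e"
      by (intro add_mono mult_le_mono2)
    then have tB: "t \<le> B" using r(1) cd[of n] unfolding B_def C_def by (simp add: algebra_simps)
    have B1: "1 \<le> B" unfolding B_def C_def by simp
    have "t * (2*t + 6) + 2 \<le> B * (2*B + 6) + 2" using tB by (intro add_mono mult_le_mono) auto
    also have "\<dots> \<le> 10 * (B * B)"
    proof -
      have "B * 1 \<le> B * B" by (rule mult_le_mono2[OF B1])
      then have "B \<le> B * B" by (simp only: mult_1_right)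
      moreover have "B * (2*B + 6) + 2 = 2 * (B * B) + 6 * B + 2" by (simp add: algebra_simps)
      ultimately show ?thesis using B1 by linarith
    qed
    also have "B * B = C^2 * (?l + 1) ^ (2 * e)" unfolding B_def
      by (simp add: power2_eq_square power_mult mult.commute mult.left_commute power_mult_distrib)
    finally have "t * (2*t + 6) + 2 \<le> 10 * C^2 * (?l + 1) ^ (2 * e)" by (simp add: mult.assoc)
    from M(2)[OF r(2) this] show ?thesis using r(3) by simp
  qed
  then show ?thesis using M(1) by blast
qed

section \<open>The first-order characterisation\<close>

text \<open>One formula must serve all \<open>n\<close>, all relations and all assignments. Only its
  existence is recorded, so formulas need not be written out but follow from closure
  properties.\<close>

definition fo :: "(nat \<Rightarrow> (nat \<Rightarrow> nat \<Rightarrow> bool) \<Rightarrow> (nat \<Rightarrow> nat) \<Rightarrow> bool) \<Rightarrow> bool" where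
  "fo P \<longleftrightarrow> (\<exists>f. \<forall>n a e. sem n a f e = P n a e)"

lemma fo_cong: "fo P \<Longrightarrow> (\<And>n a e. P n a e = Q n a e) \<Longrightarrow> fo Q" unfolding fo_def by simp

lemma fo_eq: "fo (\<lambda>n a e. e i = e j)" unfolding fo_def by (rule exI[of _ "Eq i j"]) simp
lemma fo_ad: "fo (\<lambda>n a e. a (e i) (e j))" unfolding fo_def by (rule exI[of _ "Ad i j"]) simp
lemma fo_not: "fo P \<Longrightarrow> fo (\<lambda>n a e. \<not> P n a e)" unfolding fo_def using sem.simps(3) by metis
lemma fo_and: "fo P \<Longrightarrow> fo Q \<Longrightarrow> fo (\<lambda>n a e. P n a e \<and> Q n a e)" unfolding fo_def using sem.simps(4) by metis
lemma fo_ex: "fo P \<Longrightarrow> fo (\<lambda>n a e. \<exists>x<n. P n a (e(i := x)))" unfolding fo_def using sem.simps(5) by metis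
lemma fo_or: "fo P \<Longrightarrow> fo Q \<Longrightarrow> fo (\<lambda>n a e. P n a e \<or> Q n a e)"
  by (rule fo_cong[OF fo_not[OF fo_and[OF fo_not fo_not]]]) auto
lemma fo_imp: "fo P \<Longrightarrow> fo Q \<Longrightarrow> fo (\<lambda>n a e. P n a e \<longrightarrow> Q n a e)"
  by (rule fo_cong[OF fo_or[OF fo_not]]) auto
lemma fo_all: "fo P \<Longrightarrow> fo (\<lambda>n a e. \<forall>x<n. P n a (e(i := x)))"
  by (rule fo_cong[OF fo_not[OF fo_ex[OF fo_not]]]) auto
lemma fo_const: "fo (\<lambda>n a e. b)"
proof (cases b)
  case True then show ?thesis by (intro fo_cong[OF fo_eq[of 0 0]]) simp
next
  case False then show ?thesis by (intro fo_cong[OF fo_not[OF fo_eq[of 0 0]]]) simp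
qed

lemma fo_ball: "finite I \<Longrightarrow> (\<And>i. i \<in> I \<Longrightarrow> fo (P i)) \<Longrightarrow> fo (\<lambda>n a e. \<forall>i\<in>I. P i n a e)"
proof (induction rule: finite_induct)
  case empty show ?case by (rule fo_cong[OF fo_const[of True]]) simp
next
  case (insert j I)
  have 1: "fo (P j)" by (rule insert.prems) simp
  have 2: "fo (\<lambda>n a e. \<forall>i\<in>I. P i n a e)" by (rule insert.IH, rule insert.prems) simp
  show ?case by (rule fo_cong[OF fo_and[OF 1 2]]) simp
qed

lemma fo_bex:
  assumes "finite I" "\<And>i. i \<in> I \<Longrightarrow> fo (P i)"
  shows "fo (\<lambda>n a e. \<exists>i\<in>I. P i n a e)"
proof -
  have "fo (\<lambda>n a e. \<forall>i\<in>I. \<not> P i n a e)" by (rule fo_ball[OF assms(1)], rule fo_not, rule assms(2))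
  then show ?thesis by (rule fo_cong[OF fo_not]) simp
qed

text \<open>A disjunction over all subsets of the fixed finite \<open>I\<close>; thereby any
  condition \<open>B\<close>, in particular a cardinality bound, is expressible.\<close>

lemma fo_set:
  assumes I: "finite I" and P: "\<And>i. i \<in> I \<Longrightarrow> fo (P i)"
  shows "fo (\<lambda>n a e. B {i\<in>I. P i n a e})"
proof -
  have iff: "fo (\<lambda>n a e. P i n a e \<longleftrightarrow> i \<in> J)" if i: "i \<in> I" for i J
  proof (cases "i \<in> J")
    case True then show ?thesis by (intro fo_cong[OF P[OF i]]) simp
  next
    case False then show ?thesis by (intro fo_cong[OF fo_not[OF P[OF i]]]) simp
  qed
  have "fo (\<lambda>n a e. \<exists>J\<in>Pow I. B J \<and> (\<forall>i\<in>I. P i n a e \<longleftrightarrow> i \<in> J))"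
    by (rule fo_bex, simp add: I, rule fo_and, rule fo_const, rule fo_ball[OF I], rule iff)
  then show ?thesis
  proof (rule fo_cong)
    fix n a e
    show "(\<exists>J\<in>Pow I. B J \<and> (\<forall>i\<in>I. P i n a e \<longleftrightarrow> i \<in> J)) = B {i\<in>I. P i n a e}" (is "?l = ?r")
    proof
      assume ?l
      then obtain J where J: "J \<subseteq> I" "B J" "\<forall>i\<in>I. P i n a e \<longleftrightarrow> i \<in> J" by auto
      then have "{i\<in>I. P i n a e} = J" by auto
      then show ?r using J(2) by simp
    next
      assume ?r then show ?l by (intro bexI[of _ "{i\<in>I. P i n a e}"]) auto
    qed
  qed
qed

lemma fo_exs:
  "finite I \<Longrightarrow> fo P \<Longrightarrow> fo (\<lambda>n a e. \<exists>xs. (\<forall>i\<in>I. xs i < n) \<and> P n a (\<lambda>i. if i \<in> I then xs i else e i))"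
proof (induction rule: finite_induct)
  case empty then show ?case by (intro fo_cong[OF empty]) simp
next
  case (insert j I)
  note IH = insert.IH[OF insert.prems]
  show ?case
  proof (rule fo_cong[OF fo_ex[OF IH, of j]])
    fix n a and e :: "nat \<Rightarrow> nat"
    show "(\<exists>x<n. \<exists>xs. (\<forall>i\<in>I. xs i < n) \<and> P n a (\<lambda>i. if i \<in> I then xs i else (e(j := x)) i)) =
      (\<exists>xs. (\<forall>i\<in>insert j I. xs i < n) \<and> P n a (\<lambda>i. if i \<in> insert j I then xs i else e i))" (is "?l = ?r")
    proof
      assume ?l
      then obtain x xs where x: "x < n" "\<forall>i\<in>I. xs i < n" "P n a (\<lambda>i. if i \<in> I then xs i else (e(j := x)) i)" by blast
      have "(\<lambda>i. if i \<in> insert j I then (xs(j := x)) i else e i) = (\<lambda>i. if i \<in> I then xs i else (e(j := x)) i)"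
        using insert.hyps(2) by (auto simp: fun_eq_iff)
      then show ?r using x insert.hyps(2) by (intro exI[of _ "xs(j := x)"]) auto
    next
      assume ?r
      then obtain xs where x: "\<forall>i\<in>insert j I. xs i < n" "P n a (\<lambda>i. if i \<in> insert j I then xs i else e i)" by blast
      have "(\<lambda>i. if i \<in> I then xs i else (e(j := xs j)) i) = (\<lambda>i. if i \<in> insert j I then xs i else e i)"
        by (auto simp: fun_eq_iff)
      then show ?l using x by (intro exI[of _ "xs j"] conjI exI[of _ xs]) auto
    qed
  qed
qed

section \<open>Formulas for STD sets, triples and matchings\<close>

definition tF :: "(nat \<Rightarrow> nat \<Rightarrow> bool) \<Rightarrow> nat \<Rightarrow> nat \<Rightarrow> bool" where "tF a x y \<longleftrightarrow> x = y \<or> a x y"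
definition nF :: "nat \<Rightarrow> (nat \<Rightarrow> nat \<Rightarrow> bool) \<Rightarrow> nat \<Rightarrow> nat \<Rightarrow> bool" where
  "nF n a x y \<longleftrightarrow> x \<noteq> y \<and> (a x y \<or> (\<exists>w<n. a x w \<and> a w y))"
text \<open>The set is listed by variables with repetitions allowed, so \<open>s\<close> of them
  describe nonempty sets of at most \<open>s\<close> elements.\<close>

definition sF :: "nat \<Rightarrow> nat \<Rightarrow> (nat \<Rightarrow> nat \<Rightarrow> bool) \<Rightarrow> (nat \<Rightarrow> nat) \<Rightarrow> bool" where
  "sF s n a e \<longleftrightarrow> (\<forall>x<n. \<exists>j\<in>{..<s}. tF a x (e j)) \<and> (\<forall>i\<in>{..<s}. \<exists>j\<in>{..<s}. nF n a (e i) (e j))"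
definition tripF :: "nat \<Rightarrow> nat \<Rightarrow> (nat \<Rightarrow> nat \<Rightarrow> bool) \<Rightarrow> (nat \<Rightarrow> nat) \<Rightarrow> bool" where
  "tripF s n a e \<longleftrightarrow> (\<exists>i\<in>{..<s}. \<exists>j\<in>{..<s}. \<exists>l\<in>{..<s}. a (e i) (e j) \<and> nF n a (e j) (e l) \<and> e l \<noteq> e i)"

lemma fo_tF: "fo (\<lambda>n a e. tF a (e i) (e j))" unfolding tF_def by (intro fo_or fo_eq fo_ad)

text \<open>Variable \<open>s\<close> is fresh and can be quantified as the intermediate
  vertex.\<close>

lemma fo_nF: assumes "i < s" "j < s" shows "fo (\<lambda>n a e. nF n a (e i) (e j))"
  unfolding nF_def
proof (intro fo_and fo_not fo_or fo_eq fo_ad)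
  show "fo (\<lambda>n a e. \<exists>w<n. a (e i) w \<and> a w (e j))"
    by (rule fo_cong[OF fo_ex[OF fo_and[OF fo_ad[of i s] fo_ad[of s j]], of s]]) (use assms in auto)
qed

lemma fo_sF: "fo (sF s)"
  unfolding sF_def[abs_def]
proof (intro fo_and)
  have "fo (\<lambda>n a e. \<exists>j\<in>{..<s}. tF a (e s) (e j))" by (intro fo_bex fo_tF) auto
  from fo_all[OF this, of s] show "fo (\<lambda>n a e. \<forall>x<n. \<exists>j\<in>{..<s}. tF a x (e j))"
    by (rule fo_cong) auto
  show "fo (\<lambda>n a e. \<forall>i\<in>{..<s}. \<exists>j\<in>{..<s}. nF n a (e i) (e j))" by (intro fo_ball fo_bex fo_nF) auto
qed

lemma fo_tripF: "fo (tripF s)"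
  unfolding tripF_def[abs_def] by (intro fo_bex fo_and fo_not fo_eq fo_ad fo_nF[of _ s]) auto

definition AF :: "nat \<Rightarrow> nat \<Rightarrow> (nat \<Rightarrow> nat \<Rightarrow> bool) \<Rightarrow> bool" where
  "AF s n a \<longleftrightarrow> (\<exists>xs. (\<forall>i\<in>{..<s}. xs i < n) \<and> sF s n a xs)"
definition TF :: "nat \<Rightarrow> nat \<Rightarrow> (nat \<Rightarrow> nat \<Rightarrow> bool) \<Rightarrow> bool" where
  "TF s n a \<longleftrightarrow> (\<exists>xs. (\<forall>i\<in>{..<s}. xs i < n) \<and> sF s n a xs \<and> tripF s n a xs)"

lemma sF_cong: "(\<And>i. i < s \<Longrightarrow> e i = e' i) \<Longrightarrow> sF s n a e = sF s n a e'" unfolding sF_def by auto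
lemma tripF_cong: "(\<And>i. i < s \<Longrightarrow> e i = e' i) \<Longrightarrow> tripF s n a e = tripF s n a e'"
  unfolding tripF_def by (intro bex_cong refl) auto

lemma fo_AF: "fo (\<lambda>n a e. AF s n a)"
proof (rule fo_cong[OF fo_exs[OF _ fo_sF[of s], of "{..<s}"]])
  show "(\<exists>xs. (\<forall>i\<in>{..<s}. xs i < n) \<and> sF s n a (\<lambda>i. if i \<in> {..<s} then xs i else e i)) = AF s n a" for n a e
    unfolding AF_def by (intro arg_cong[where f = HOL.Ex] ext conj_cong refl sF_cong) auto
qed simp

lemma fo_TF: "fo (\<lambda>n a e. TF s n a)"
proof (rule fo_cong[OF fo_exs[OF _ fo_and[OF fo_sF[of s] fo_tripF[of s]], of "{..<s}"]])
  show "(\<exists>xs. (\<forall>i\<in>{..<s}. xs i < n) \<and> sF s n a (\<lambda>i. if i \<in> {..<s} then xs i else e i) \<and>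
     tripF s n a (\<lambda>i. if i \<in> {..<s} then xs i else e i)) = TF s n a" for n a e
    unfolding TF_def by (intro arg_cong[where f = HOL.Ex] ext conj_cong refl sF_cong tripF_cong) auto
qed simp

text \<open>Variables \<open>2*p\<close>, \<open>2*p+1\<close> with \<open>p < m\<close> are the ends of the matching edges.  From \<open>2*m\<close> on, variables
  alternate between elements of \<open>R\<close> and representatives of the cliques it dominates.\<close>

definition lF :: "(nat \<Rightarrow> nat \<Rightarrow> bool) \<Rightarrow> (nat \<Rightarrow> nat) \<Rightarrow> nat \<Rightarrow> nat \<Rightarrow> bool" where
  "lF a e x p \<longleftrightarrow> tF a x (e (2*p)) \<or> tF a x (e (2*p+1))"
definition fF :: "nat \<Rightarrow> nat \<Rightarrow> (nat \<Rightarrow> nat \<Rightarrow> bool) \<Rightarrow> (nat \<Rightarrow> nat) \<Rightarrow> nat \<Rightarrow> bool" where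
  "fF k m a e x \<longleftrightarrow> card {p\<in>{..<m}. \<not> lF a e x p} < k"
definition iF :: "nat \<Rightarrow> (nat \<Rightarrow> nat \<Rightarrow> bool) \<Rightarrow> (nat \<Rightarrow> nat) \<Rightarrow> bool" where
  "iF m a e \<longleftrightarrow> (\<forall>p\<in>{..<m}. a (e (2*p)) (e (2*p+1))) \<and>
     (\<forall>p\<in>{..<m}. \<forall>q\<in>{..<m}-{p}. \<not> lF a e (e (2*p)) q \<and> \<not> lF a e (e (2*p+1)) q)"
text \<open>A violation of \<open>good\<close>: \<open>r\<close> vertices of \<open>F\<close>,
  possibly repeated, dominate the \<open>r\<close> different cliques given by pairwise nonadjacent
  representatives in \<open>W\<close>.\<close>

definition vF :: "nat \<Rightarrow> nat \<Rightarrow> nat \<Rightarrow> nat \<Rightarrow> (nat \<Rightarrow> nat \<Rightarrow> bool) \<Rightarrow> (nat \<Rightarrow> nat) \<Rightarrow> bool" where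
  "vF k m r n a e \<longleftrightarrow> (\<forall>j\<in>{..<r}. fF k m a e (e (2*m+2*j))) \<and> (\<forall>j\<in>{..<r}. \<not> fF k m a e (e (2*m+2*j+1))) \<and>
     (\<forall>i\<in>{..<r}. \<forall>j\<in>{..<r}-{i}. \<not> tF a (e (2*m+2*i+1)) (e (2*m+2*j+1))) \<and>
     (\<forall>u<n. \<not> fF k m a e u \<longrightarrow> (\<forall>i\<in>{..<r}. tF a u (e (2*m+2*i+1)) \<longrightarrow> (\<exists>j\<in>{..<r}. a u (e (2*m+2*j)))))"

lemma fo_lF: "fo (\<lambda>n a e. lF a e (e i) p)" unfolding lF_def by (intro fo_or fo_tF)
lemma fo_fF: "fo (\<lambda>n a e. fF k m a e (e i))"
  unfolding fF_def by (intro fo_set[where B = "\<lambda>J. card J < k"] fo_not fo_lF) simp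
lemma fo_iF: "fo (\<lambda>n a e. iF m a e)"
  unfolding iF_def by (intro fo_and fo_ball fo_not fo_lF fo_ad) auto

lemma fF_cong: "(\<And>i. i < 2*m \<Longrightarrow> e i = e' i) \<Longrightarrow> fF k m a e x = fF k m a e' x"
  unfolding fF_def lF_def by (intro arg_cong2[where f = "(<)"] arg_cong[where f = card] Collect_cong conj_cong refl) auto

lemma fo_vF: "fo (vF k m r)"
  unfolding vF_def[abs_def]
proof (intro fo_and)
  let ?z = "2*m+2*r"
  have "fo (\<lambda>n a e. \<not> fF k m a e (e ?z) \<longrightarrow> (\<forall>i\<in>{..<r}. tF a (e ?z) (e (2*m+2*i+1)) \<longrightarrow>
     (\<exists>j\<in>{..<r}. a (e ?z) (e (2*m+2*j)))))"
    by (intro fo_imp fo_not fo_fF fo_ball fo_bex fo_tF fo_ad) auto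
  from fo_all[OF this, of ?z]
  show "fo (\<lambda>n a e. \<forall>u<n. \<not> fF k m a e u \<longrightarrow> (\<forall>i\<in>{..<r}. tF a u (e (2*m+2*i+1)) \<longrightarrow>
     (\<exists>j\<in>{..<r}. a u (e (2*m+2*j)))))"
  proof (rule fo_cong)
    fix n a and e :: "nat \<Rightarrow> nat"
    have "fF k m a (e(?z := x)) y = fF k m a e y" for x y by (rule fF_cong) auto
    then show "(\<forall>x<n. \<not> fF k m a (e(?z := x)) ((e(?z := x)) ?z) \<longrightarrow>
       (\<forall>i\<in>{..<r}. tF a ((e(?z := x)) ?z) ((e(?z := x)) (2*m+2*i+1)) \<longrightarrow>
       (\<exists>j\<in>{..<r}. a ((e(?z := x)) ?z) ((e(?z := x)) (2*m+2*j))))) =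
      (\<forall>u<n. \<not> fF k m a e u \<longrightarrow> (\<forall>i\<in>{..<r}. tF a u (e (2*m+2*i+1)) \<longrightarrow> (\<exists>j\<in>{..<r}. a u (e (2*m+2*j)))))"
      by auto
  qed
qed (intro fo_ball fo_not fo_fF fo_tF; simp)+

definition ov :: "nat \<Rightarrow> nat \<Rightarrow> (nat \<Rightarrow> nat) \<Rightarrow> (nat \<Rightarrow> nat) \<Rightarrow> nat \<Rightarrow> nat" where
  "ov l h xs e i = (if i \<in> {l..<h} then xs i else e i)"

definition MF :: "nat \<Rightarrow> nat \<Rightarrow> nat \<Rightarrow> nat \<Rightarrow> (nat \<Rightarrow> nat \<Rightarrow> bool) \<Rightarrow> (nat \<Rightarrow> nat) \<Rightarrow> bool" where
  "MF k m r0 n a e \<longleftrightarrow> (\<exists>xs. (\<forall>i\<in>{0..<2*m}. xs i < n) \<and> iF m a (ov 0 (2*m) xs e) \<and>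
     \<not> (\<exists>r\<in>{1..r0}. \<exists>ys. (\<forall>i\<in>{2*m..<2*m+2*r}. ys i < n) \<and> vF k m r n a (ov (2*m) (2*m+2*r) ys (ov 0 (2*m) xs e))))"

lemma fo_MF: "fo (MF k m r0)"
proof -
  have "fo (\<lambda>n a e. \<exists>ys. (\<forall>i\<in>{2*m..<2*m+2*r}. ys i < n) \<and> vF k m r n a (\<lambda>i. if i \<in> {2*m..<2*m+2*r} then ys i else e i))" for r
    by (rule fo_exs[OF _ fo_vF]) simp
  then have "fo (\<lambda>n a e. iF m a e \<and> \<not> (\<exists>r\<in>{1..r0}. \<exists>ys. (\<forall>i\<in>{2*m..<2*m+2*r}. ys i < n) \<and>
     vF k m r n a (\<lambda>i. if i \<in> {2*m..<2*m+2*r} then ys i else e i)))"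
    by (intro fo_and fo_iF fo_not fo_bex) auto
  from fo_exs[OF _ this, of "{0..<2*m}"] show ?thesis
    unfolding MF_def[abs_def] ov_def[abs_def] by simp
qed

context legs begin

text \<open>Sets of vertices and of cliques become lists of vertices. Repetitions among the
  \<open>f j\<close> are harmless: they only make \<open>card R\<close> smaller than
  \<open>r\<close>, which is at most \<open>card (domd R)\<close>.\<close>

lemma good_iff: "good \<longleftrightarrow> \<not> (\<exists>r\<in>{1..5*k+2}. \<exists>f c. (\<forall>j<r. f j \<in> F) \<and> (\<forall>j<r. c j \<in> W) \<and>
    (\<forall>i<r. \<forall>j<r. i \<noteq> j \<longrightarrow> \<not> tch (c i) (c j)) \<and> (\<forall>u\<in>W. \<forall>i<r. tch u (c i) \<longrightarrow> (\<exists>j<r. nb u (f j))))"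
  (is "good \<longleftrightarrow> \<not> ?V")
proof -
  have "\<not> good" if V: ?V
  proof -
    obtain r f c where r: "r \<in> {1..5*k+2}" and f: "\<forall>j<r. f j \<in> F" and c: "\<forall>j<r. c j \<in> W"
      and cc: "\<forall>i<r. \<forall>j<r. i \<noteq> j \<longrightarrow> \<not> tch (c i) (c j)"
      and u: "\<forall>u\<in>W. \<forall>i<r. tch u (c i) \<longrightarrow> (\<exists>j<r. nb u (f j))" using V by (elim bexE exE conjE)
    define R where "R = f ` {..<r}"
    have "f 0 \<in> R" using r unfolding R_def by auto
    then have R: "R \<subseteq> F" "R \<noteq> {}" "card R \<le> r" using f card_image_le[of "{..<r}" f] unfolding R_def by auto
    have "inj_on (\<lambda>i. cls (c i)) {..<r}"
    proof (rule inj_onI)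
      fix i j assume ij: "i \<in> {..<r}" "j \<in> {..<r}" "cls (c i) = cls (c j)"
      have "c j \<in> cls (c i)" using cls_KK[of "c j"] c ij by simp
      then have "tch (c i) (c j)" unfolding cls_def by simp
      then show "i = j" using cc ij by blast
    qed
    then have "card ((\<lambda>i. cls (c i)) ` {..<r}) = r" by (simp add: card_image)
    moreover have "(\<lambda>i. cls (c i)) ` {..<r} \<subseteq> domd R"
    proof
      fix K assume "K \<in> (\<lambda>i. cls (c i)) ` {..<r}"
      then obtain i where i: "i < r" "K = cls (c i)" by blast
      have K: "K \<in> KK" using cls_KK c i by blast
      have "\<exists>f\<in>R. nb w f" if w: "w \<in> K" for w
      proof -
        have "w \<in> W" "tch w (c i)" using w i(2) tch_sym unfolding cls_def by auto
        then show ?thesis using u i(1) unfolding R_def by blast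
      qed
      then show "K \<in> domd R" using K unfolding domd_def by blast
    qed
    ultimately have "r \<le> card (domd R)" using card_mono[OF fin_domd] by metis
    then have "\<not> card (domd R) < card R" using R(3) by simp
    moreover have "card R \<le> 5*k+2" using R(3) r by simp
    ultimately show "\<not> good" using R unfolding good_def by blast
  qed
  moreover have ?V if ng: "\<not> good"
  proof -
    obtain R where R: "R \<subseteq> F" "R \<noteq> {}" "card R \<le> 5*k+2" "card R \<le> card (domd R)"
      using ng not_less unfolding good_def by blast
    have finR: "finite R" using R(1) finF finite_subset by blast
    define r where "r = card R"
    have r: "r \<in> {1..5*k+2}" using R finR unfolding r_def by (simp add: Suc_le_eq card_gt_0_iff)
    obtain C where C: "C \<subseteq> domd R" "card C = r" "finite C"
      using R(4) unfolding r_def by (rule obtain_subset_with_card_n)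
    obtain f where f: "bij_betw f {0..<r} R" using ex_bij_betw_nat_finite[OF finR] unfolding r_def by blast
    obtain g where g: "bij_betw g {0..<r} C" using ex_bij_betw_nat_finite[OF C(3)] C(2) by blast
    have gC: "g i \<in> C" "g i \<in> KK" if "i < r" for i
      using bij_betwE[OF g] that subset_trans[OF C(1) domd_KK] by auto
    have "\<exists>x. i < r \<longrightarrow> x \<in> g i" for i using KK_ne gC(2) by blast
    then obtain c where c: "\<And>i. i < r \<Longrightarrow> c i \<in> g i" by metis
    have 1: "\<forall>j<r. f j \<in> F" using bij_betwE[OF f] R(1) by auto
    have 2: "\<forall>j<r. c j \<in> W" using c gC(2) KK_W by blast
    have 3: "\<forall>i<r. \<forall>j<r. i \<noteq> j \<longrightarrow> \<not> tch (c i) (c j)"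
    proof (intro allI impI notI)
      fix i j assume ij: "i < r" "j < r" "i \<noteq> j" "tch (c i) (c j)"
      have "g i = g j" using KK_eq[OF gC(2)[OF ij(1)] gC(2)[OF ij(2)] c[OF ij(1)] c[OF ij(2)] ij(4)] .
      then show False using bij_betw_imp_inj_on[OF g] ij unfolding inj_on_def by simp
    qed
    have 4: "\<forall>u\<in>W. \<forall>i<r. tch u (c i) \<longrightarrow> (\<exists>j<r. nb u (f j))"
    proof (intro ballI allI impI)
      fix u i assume u: "u \<in> W" "i < r" "tch u (c i)"
      have "u \<in> g i" using KK_closed[OF gC(2)[OF u(2)] c[OF u(2)] u(1)] tch_sym[OF u(3)] by blast
      moreover have "g i \<in> domd R" using gC(1)[OF u(2)] C(1) by blast
      ultimately obtain h where h: "h \<in> R" "nb u h" unfolding domd_def by blast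
      have "h \<in> f ` {0..<r}" using bij_betw_imp_surj_on[OF f] h(1) by simp
      then obtain j where "j < r" "h = f j" by auto
      then show "\<exists>j<r. nb u (f j)" using h(2) by blast
    qed
    show ?V using r 1 2 3 4 by blast
  qed
  ultimately show ?thesis by blast
qed

end

lemma enumerate_set:
  assumes "finite D" "D \<noteq> {}" "card D \<le> s"
  shows "\<exists>xs. xs ` {..<s} = D"
proof -
  obtain f where f: "bij_betw f {0..<card D} D" using ex_bij_betw_nat_finite[OF assms(1)] by blast
  have p: "0 < card D" using assms by (simp add: card_gt_0_iff)
  \<comment> \<open>Positions beyond \<open>card D\<close> repeat the first element.\<close>
  define xs where "xs i = f (if i < card D then i else 0)" for i
  have fD: "f i \<in> D" if "i < card D" for i using bij_betwE[OF f] that by auto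
  have "xs ` {..<s} = D"
  proof
    show "xs ` {..<s} \<subseteq> D" unfolding xs_def using fD p by auto
    show "D \<subseteq> xs ` {..<s}"
    proof
      fix d assume "d \<in> D"
      then have "d \<in> f ` {0..<card D}" using bij_betw_imp_surj_on[OF f] by simp
      then obtain i where "i < card D" "d = f i" by auto
      then show "d \<in> xs ` {..<s}" using assms(3) unfolding xs_def by (intro image_eqI[of _ _ i]) auto
    qed
  qed
  then show ?thesis by blast
qed

section \<open>Agreement of the formulas with the graph notions\<close>

locale nat_conn_graph = conn_graph +
  fixes n :: nat
  assumes vn: "verts G = {0..<n}" and npos: "0 < n"
begin

lemma verts_iff_less: "x \<in> verts G \<longleftrightarrow> x < n" using vn by simp

lemma tF_tch: "tF (adj G) x y \<longleftrightarrow> tch x y" unfolding tF_def tch_def ..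
lemma nF_near: "nF n (adj G) x y \<longleftrightarrow> near x y"
  unfolding nF_def near_def using nb_V2 vn by auto

lemma sF_STD: assumes "\<forall>i\<in>{..<s}. xs i < n" shows "sF s n (adj G) xs \<longleftrightarrow> STD (xs ` {..<s})"
  using assms unfolding sF_def STD_def tF_tch nF_near by (auto simp: verts_iff_less)

lemma tripF_triple: "tripF s n (adj G) xs \<longleftrightarrow> triple (xs ` {..<s})"
  unfolding tripF_def triple_def nF_near by blast

lemma STD_enum: assumes "STD D" "card D \<le> s"
  shows "\<exists>xs. xs ` {..<s} = D \<and> (\<forall>i\<in>{..<s}. xs i < n)"
proof -
  have "D \<noteq> {}" using assms(1) npos vn unfolding STD_def by auto
  then obtain xs where xs: "xs ` {..<s} = D" using enumerate_set[OF STD_fin[OF assms(1)] _ assms(2)] by blast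
  then show ?thesis using STD_V[OF assms(1)] vn by (intro exI[of _ xs]) auto
qed

lemma card_enum: "card (xs ` {..<s}) \<le> s" using card_image_le[of "{..<s}" xs] by simp

lemma AF_Agood: "AF s n (adj G) \<longleftrightarrow> Agood s"
  unfolding AF_def Agood_def using STD_enum sF_STD card_enum by metis

lemma TF_Tgood: "TF s n (adj G) \<longleftrightarrow> Tgood s"
  unfolding TF_def Tgood_def tripF_triple using STD_enum sF_STD card_enum by metis

lemma legs_of_iF:
  assumes i: "iF m (adj G) e"
  defines "L \<equiv> (\<lambda>p. (e (2*p), e (2*p+1))) ` {..<m}"
  shows "imatch L" "card L = m" "finite L" "\<And>x. card {p\<in>L. \<not> touch x p} = card {p\<in>{..<m}. \<not> lF (adj G) e x p}"
proof -
  have l: "lF (adj G) e x p \<longleftrightarrow> touch x (e (2*p), e (2*p+1))" for x p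
    unfolding lF_def touch_def tF_tch by simp
  have s: "\<not> touch (e (2*p)) (e (2*q), e (2*q+1)) \<and> \<not> touch (e (2*p+1)) (e (2*q), e (2*q+1))"
    if "p < m" "q < m" "p \<noteq> q" for p q
    using i that unfolding iF_def l by blast
  have "imatch L \<and> card L = card {..<m}" unfolding L_def
    by (rule imatchI) (use i s in \<open>auto simp: iF_def touch_def\<close>)
  then show "imatch L" "card L = m" by auto
  show "finite L" unfolding L_def by simp
  have inj: "inj_on (\<lambda>p. (e (2*p), e (2*p+1))) {..<m}"
  proof (rule inj_onI, rule ccontr)
    fix p q assume pq: "p \<in> {..<m}" "q \<in> {..<m}" "(e (2*p), e (2*p+1)) = (e (2*q), e (2*q+1))" "p \<noteq> q"
    have "\<not> touch (e (2*p)) (e (2*q), e (2*q+1))" using s[of p q] pq by simp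
    then show False using pq(3) unfolding touch_def by simp
  qed
  fix x
  have "{p\<in>L. \<not> touch x p} = (\<lambda>p. (e (2*p), e (2*p+1))) ` {p\<in>{..<m}. \<not> lF (adj G) e x p}"
    unfolding L_def l by blast
  then show "card {p\<in>L. \<not> touch x p} = card {p\<in>{..<m}. \<not> lF (adj G) e x p}"
    using card_image[OF inj_on_subset[OF inj]] by (metis (no_types, lifting) mem_Collect_eq subsetI)
qed

text \<open>\<open>F\<close> depends only on the variables below \<open>2*m\<close>, so overriding
  the later ones by the list of a violation leaves it unchanged.\<close>

lemma vF_good:
  assumes fr: "P3_kP2_free k G" and i: "iF (9*k+10) (adj G) e"
  defines "L \<equiv> (\<lambda>p. (e (2*p), e (2*p+1))) ` {..<9*k+10}"
  shows "legs_good k L \<longleftrightarrow> \<not> (\<exists>r\<in>{1..5*k+2}. \<exists>ys. (\<forall>i\<in>{2*(9*k+10)..<2*(9*k+10)+2*r}. ys i < n) \<and>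
     vF k (9*k+10) r n (adj G) (ov (2*(9*k+10)) (2*(9*k+10)+2*r) ys e))"
proof -
  define m where "m = 9*k+10"
  note lg = legs_of_iF[OF i, folded L_def]
  interpret legs "verts G" "adj G" k L
    by unfold_locales (use P3_kP2_free_free[OF fr] lg conn in auto)
  have FF: "x \<in> F \<longleftrightarrow> x < n \<and> fF k m (adj G) e x" for x unfolding F_def fF_def m_def lg(4) by (simp add: verts_iff_less)
  have WW: "x \<in> W \<longleftrightarrow> x < n \<and> \<not> fF k m (adj G) e x" for x unfolding W_def using FF by (auto simp: verts_iff_less)
  have ffe: "fF k m (adj G) (ov (2*m) h ys e) x = fF k m (adj G) e x" for h ys x
    by (rule fF_cong) (simp add: ov_def)
  have eq: "(\<exists>ys. (\<forall>i\<in>{2*m..<2*m+2*r}. ys i < n) \<and> vF k m r n (adj G) (ov (2*m) (2*m+2*r) ys e)) \<longleftrightarrow>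
    (\<exists>f c. (\<forall>j<r. f j \<in> F) \<and> (\<forall>j<r. c j \<in> W) \<and>
    (\<forall>i<r. \<forall>j<r. i \<noteq> j \<longrightarrow> \<not> tch (c i) (c j)) \<and> (\<forall>u\<in>W. \<forall>i<r. tch u (c i) \<longrightarrow> (\<exists>j<r. adj G u (f j))))" (is "?l \<longleftrightarrow> ?r") for r
  proof
    assume ?l
    then obtain ys where ys: "\<forall>i\<in>{2*m..<2*m+2*r}. ys i < n" "vF k m r n (adj G) (ov (2*m) (2*m+2*r) ys e)" by blast
    have o: "ov (2*m) (2*m+2*r) ys e (2*m+2*j) = ys (2*m+2*j)" "ov (2*m) (2*m+2*r) ys e (2*m+2*j+1) = ys (2*m+2*j+1)"
      if "j < r" for j using that unfolding ov_def by auto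
    note v = ys(2)[unfolded vF_def ffe tF_tch]
    show ?r
    proof (rule exI[of _ "\<lambda>j. ys (2*m+2*j)"], rule exI[of _ "\<lambda>j. ys (2*m+2*j+1)"], intro conjI allI impI ballI)
      show "ys (2*m+2*j) \<in> F" if "j < r" for j using v o that ys(1) unfolding FF by auto
      show "ys (2*m+2*j+1) \<in> W" if "j < r" for j using v o that ys(1) unfolding WW by auto
      show "\<not> tch (ys (2*m+2*i+1)) (ys (2*m+2*j+1))" if "i < r" "j < r" "i \<noteq> j" for i j
        using v o[OF that(1)] o[OF that(2)] that by (metis Diff_iff lessThan_iff singletonD)
      show "\<exists>j<r. adj G u (ys (2*m+2*j))" if "u \<in> W" "i < r" "tch u (ys (2*m+2*i+1))" for u i
        using v o that unfolding WW by (metis lessThan_iff)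
    qed
  next
    assume ?r
    then obtain f c where f: "\<forall>j<r. f j \<in> F" and c: "\<forall>j<r. c j \<in> W"
      and cc: "\<forall>i<r. \<forall>j<r. i \<noteq> j \<longrightarrow> \<not> tch (c i) (c j)"
      and u: "\<forall>u\<in>W. \<forall>i<r. tch u (c i) \<longrightarrow> (\<exists>j<r. adj G u (f j))" by (elim exE conjE)
    define ys where "ys i = (if even (i - 2*m) then f ((i - 2*m) div 2) else c ((i - 2*m) div 2))" for i
    have o: "ov (2*m) (2*m+2*r) ys e (2*m+2*j) = f j" "ov (2*m) (2*m+2*r) ys e (2*m+2*j+1) = c j"
      if "j < r" for j using that unfolding ov_def ys_def by auto
    have "\<forall>i\<in>{2*m..<2*m+2*r}. ys i < n"
    proof
      fix i assume "i \<in> {2*m..<2*m+2*r}"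
      then have "(i - 2*m) div 2 < r" by auto
      then show "ys i < n" using f c unfolding ys_def FF WW by simp
    qed
    moreover have "vF k m r n (adj G) (ov (2*m) (2*m+2*r) ys e)"
      unfolding vF_def ffe tF_tch
    proof (intro conjI ballI allI impI)
      show "fF k m (adj G) e (ov (2*m) (2*m+2*r) ys e (2*m+2*j))" if "j \<in> {..<r}" for j
        using that f o(1)[of j] unfolding FF by simp
      show "\<not> fF k m (adj G) e (ov (2*m) (2*m+2*r) ys e (2*m+2*j+1))" if "j \<in> {..<r}" for j
        using that c o(2)[of j] unfolding WW by simp
      show "\<not> tch (ov (2*m) (2*m+2*r) ys e (2*m+2*i+1)) (ov (2*m) (2*m+2*r) ys e (2*m+2*j+1))"
        if "i \<in> {..<r}" "j \<in> {..<r} - {i}" for i j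
        using that cc o(2)[of i] o(2)[of j] by simp
      show "\<exists>j\<in>{..<r}. adj G w (ov (2*m) (2*m+2*r) ys e (2*m+2*j))"
        if "w < n" "\<not> fF k m (adj G) e w" "i \<in> {..<r}" "tch w (ov (2*m) (2*m+2*r) ys e (2*m+2*i+1))" for w i
      proof -
        have "w \<in> W" "i < r" "tch w (c i)" using that o(2)[of i] unfolding WW by auto
        then obtain j where "j < r" "adj G w (f j)" using u by blast
        then show ?thesis using o(1) by (intro bexI[of _ j]) auto
      qed
    qed
    ultimately show ?l by blast
  qed
  show ?thesis unfolding good_iff m_def[symmetric] eq ..
qed

lemma MF_Mgood:
  assumes fr: "P3_kP2_free k G"
  shows "MF k (9*k+10) (5*k+2) n (adj G) e \<longleftrightarrow> Mgood k"
proof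
  let ?m = "9*k+10"
  assume "MF k ?m (5*k+2) n (adj G) e"
  then obtain xs where xs: "iF ?m (adj G) (ov 0 (2*?m) xs e)"
     "\<not> (\<exists>r\<in>{1..5*k+2}. \<exists>ys. (\<forall>i\<in>{2*?m..<2*?m+2*r}. ys i < n) \<and>
       vF k ?m r n (adj G) (ov (2*?m) (2*?m+2*r) ys (ov 0 (2*?m) xs e)))" unfolding MF_def by blast
  show "Mgood k" unfolding Mgood_def
    using legs_of_iF(1-3)[OF xs(1)] vF_good[OF fr xs(1)] xs(2) by blast
next
  let ?m = "9*k+10"
  assume "Mgood k"
  then obtain L where L: "finite L" "imatch L" "card L = ?m" "legs_good k L" unfolding Mgood_def by blast
  obtain h where h: "bij_betw h {..<?m} L"
    using ex_bij_betw_nat_finite[OF L(1)] L(3) by (auto simp: atLeast0LessThan)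
  define xs where "xs i = (if even i then fst (h (i div 2)) else snd (h (i div 2)))" for i
  define e' where "e' = ov 0 (2*?m) xs e"
  have o: "e' (2*p) = fst (h p)" "e' (2*p+1) = snd (h p)" if "p < ?m" for p
    using that unfolding e'_def ov_def xs_def by auto
  have hL: "h p \<in> L" if "p < ?m" for p using bij_betwE[OF h] that by auto
  have hi: "h p \<noteq> h q" if "p < ?m" "q < ?m" "p \<noteq> q" for p q
    using bij_betw_imp_inj_on[OF h] that unfolding inj_on_def by auto
  have im1: "adj G (fst p) (snd p)" if "p \<in> L" for p using L(2) that unfolding imatch_def by blast
  have im2: "\<not> touch (fst p) q \<and> \<not> touch (snd p) q" if "p \<in> L" "q \<in> L" "p \<noteq> q" for p q
    using L(2) that unfolding imatch_def by blast
  have iF: "iF ?m (adj G) e'" unfolding iF_def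
  proof (intro conjI ballI)
    fix p assume p: "p \<in> {..<?m}"
    show "adj G (e' (2*p)) (e' (2*p+1))" using im1[OF hL] o p by simp
    fix q assume q: "q \<in> {..<?m} - {p}"
    have "\<not> touch (fst (h p)) (h q) \<and> \<not> touch (snd (h p)) (h q)"
      by (rule im2[OF hL hL hi]) (use p q in auto)
    then show "\<not> lF (adj G) e' (e' (2*p)) q" "\<not> lF (adj G) e' (e' (2*p+1)) q"
      using o[of p] o[of q] p q unfolding lF_def tF_tch touch_def by auto
  qed
  have "(\<lambda>p. (e' (2*p), e' (2*p+1))) ` {..<?m} = h ` {..<?m}"
    using o by (intro image_cong refl) simp
  then have LL: "(\<lambda>p. (e' (2*p), e' (2*p+1))) ` {..<?m} = L" using bij_betw_imp_surj_on[OF h] by simp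
  have "\<forall>i\<in>{0..<2*?m}. xs i < n"
  proof
    fix i assume "i \<in> {0..<2*?m}"
    then have "i div 2 < ?m" by auto
    then have "adj G (fst (h (i div 2))) (snd (h (i div 2)))" using im1 hL by blast
    then have "fst (h (i div 2)) \<in> verts G" "snd (h (i div 2)) \<in> verts G" using nb_V nb_V2 by blast+
    then show "xs i < n" unfolding xs_def vn by auto
  qed
  then show "MF k ?m (5*k+2) n (adj G) e"
    unfolding MF_def using iF iffD1[OF vF_good[OF fr iF] L(4)[folded LL]] unfolding e'_def
    by (intro exI[of _ xs] conjI)
qed

end

definition decF :: "nat \<Rightarrow> nat \<Rightarrow> (nat \<Rightarrow> nat \<Rightarrow> bool) \<Rightarrow> (nat \<Rightarrow> nat) \<Rightarrow> bool" where
  "decF k n a e = (let C = size_bound k ((k+2)*(9*k+10) + 2*k + 4) in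
    (\<exists>s\<in>{..<C}. TF s n a \<and> \<not> AF (s - 1) n a) \<or>
    (\<not> AF (C - 1) n a \<and> \<not> MF k (9*k+10) (5*k+2) n a e \<and> (\<exists>x<n. \<exists>y<n. x \<noteq> y)))"

lemma fo_decF: "fo (decF k)"
proof -
  have "fo (\<lambda>n a e. \<exists>y<n. (e(Suc 0 := y)) 0 \<noteq> (e(Suc 0 := y)) (Suc 0))"
    by (intro fo_ex[of "\<lambda>n a e. e 0 \<noteq> e (Suc 0)"] fo_not fo_eq)
  then have "fo (\<lambda>n a e. \<exists>y<n. e 0 \<noteq> y)" by simp
  from fo_ex[OF this, of 0] have two: "fo (\<lambda>n (a :: nat \<Rightarrow> nat \<Rightarrow> bool) (e :: nat \<Rightarrow> nat). \<exists>x<n. \<exists>y<n. x \<noteq> y)" by simp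
  show ?thesis unfolding decF_def[abs_def] Let_def
    by (intro fo_or fo_and fo_not fo_bex fo_TF fo_AF fo_MF two) simp
qed

theorem theorem16:
  fixes k :: nat
  shows "\<exists>Q S (\<delta>::tm) (c::nat) (d::nat). valid_tm Q S \<delta> \<and>
    (\<forall>n E. let G = ({0..<n}, E) in
       simple_graph G \<and> connected_graph G \<and> P3_kP2_free k G \<longrightarrow>
       tm_decides_within \<delta> (encode_graph n G)
         (c * (length (encode_graph n G) + 1) ^ d) (one_edge_contraction G))"
proof -
  obtain f where f: "\<And>n a e. sem n a f e = decF k n a e" using fo_decF[of k] unfolding fo_def by blast
  obtain Q S \<delta> c d where M: "valid_tm Q S \<delta>" "\<And>n a. 0 < n \<Longrightarrow>
     tm_decides_within \<delta> (enc_adj n a) (c * (length (enc_adj n a) + 1) ^ d) (sem n a f (\<lambda>_. 0))"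
    using model_checking[of f] by blast
  have "tm_decides_within \<delta> (encode_graph n G) (c * (length (encode_graph n G) + 1) ^ d) (one_edge_contraction G)"
    if G: "G = ({0..<n}, E)" "simple_graph G" "connected_graph G" "P3_kP2_free k G" for n E G
  proof -
    have vn: "verts G = {0..<n}" unfolding verts_def G(1) by simp
    \<comment> \<open>Connected graphs are nonempty by definition, so the value 0 given to all
      variables is a vertex.\<close>
    have npos: "0 < n" using G(3) vn unfolding connected_graph_def by auto
    interpret nat_conn_graph G n by unfold_locales (rule G(2) G(3) vn npos)+
    have "decF k n (adj G) (\<lambda>_. 0) \<longleftrightarrow> one_edge_contraction G"
      unfolding local_characterisation[OF G(4) refl] decF_def Let_def AF_Agood TF_Tgood MF_Mgood[OF G(4)] vn
      by (simp add: Bex_def)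
    moreover have "encode_graph n G = enc_adj n (adj G)" unfolding encode_graph_def enc_adj_def ..
    ultimately show ?thesis using M(2)[OF npos, of "adj G"] f by simp
  qed
  then have "\<forall>n E. let G = ({0..<n}, E) in
       simple_graph G \<and> connected_graph G \<and> P3_kP2_free k G \<longrightarrow>
       tm_decides_within \<delta> (encode_graph n G)
         (c * (length (encode_graph n G) + 1) ^ d) (one_edge_contraction G)" unfolding Let_def by blast
  then show ?thesis using M(1) by blast
qed

end
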